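(* Let $\Lambda$ be a finite dimensional algebra over an algebraically closed field $k$, and let $X$ and $Y$ be finitely generated left $\Lambda$-modules. Then $$E'_\Lambda(X,Y)=\langle Y,X\rangle-g^Y\cdot c^X,$$ $$E_\Lambda(X,Y)=\langle Y,X\rangle+\langle X,Y\rangle-g^Y\cdot c^X-g^X\cdot c^Y,$$ $$E_\Lambda(X)=2\bigl(\langle X,X\rangle-g^X\cdot c^X\bigr).$$
   Context: $\langle X,Y\rangle:=\dim_k\operatorname{Hom}_\Lambda(X,Y)$; $\tau=D\operatorname{Tr}$ is the Auslander-Reiten translation. For modules $X,Y$ (regarded as pairs $(X,0)$, $(Y,0)$): $E'_\Lambda(X,Y)=\langle X,\tau Y\rangle$, $E_\Lambda(X,Y)=E'_\Lambda(X,Y)+E'_\Lambda(Y,X)$ and $E_\Lambda(X)=E_\Lambda(X,X)$. Let $P(1),\dots,P(n)$ be the isomorphism classes of indecomposable projective $\Lambda$-modules and $S(i)$ the simple top of $P(i)$. For a module $M$ with minimal projective presentation $P_1\to P_0\to M\to0$, the $g$-vector $g^M=(g^M_1,\dots,g^M_n)$ is defined by $P_0-P_1=\sum_{i=1}^ng_i^MP(i)$ in the Grothendieck group $K_0(\operatorname{proj}\Lambda)$ of the additive category of finitely generated projectives. The dimension vector $c^M=(c_1^M,\dots,c_n^M)$ has $c_i^M$ equal to the multiplicity of $S(i)$ as a composition factor of $M$. For vectors $a,b$, $a\cdot b=\sum_{i=1}^na_ib_i$. *)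

theory Defs
  imports "HOL-Algebra.Algebra" "Jordan_Normal_Form.Missing_VectorSpace"
begin

no_notation Polynomials.var (\<open>X\<index>\<close>)

section \<open>Finite-dimensional algebras and their left modules\<close>

text \<open>
  An algebra over \<open>K\<close> is a record of type \<open>('k, 'a) module\<close>: the ring fields carry the (not
  necessarily commutative) multiplication, and the scalar multiplication is the action of \<open>K\<close>.
  The zero algebra is allowed.
\<close>

locale fd_algebra = vectorspace K \<Lambda> + A?: ring \<Lambda>
  for K :: "'k ring" and \<Lambda> :: "('k, 'a) module" +
  assumes smult_mult_left:
      "\<lbrakk>c \<in> carrier K; x \<in> carrier \<Lambda>; y \<in> carrier \<Lambda>\<rbrakk> \<Longrightarrow>
        (c \<odot>\<^bsub>\<Lambda>\<^esub> x) \<otimes>\<^bsub>\<Lambda>\<^esub> y = c \<odot>\<^bsub>\<Lambda>\<^esub> (x \<otimes>\<^bsub>\<Lambda>\<^esub> y)"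
    and smult_mult_right:
      "\<lbrakk>c \<in> carrier K; x \<in> carrier \<Lambda>; y \<in> carrier \<Lambda>\<rbrakk> \<Longrightarrow>
        x \<otimes>\<^bsub>\<Lambda>\<^esub> (c \<odot>\<^bsub>\<Lambda>\<^esub> y) = c \<odot>\<^bsub>\<Lambda>\<^esub> (x \<otimes>\<^bsub>\<Lambda>\<^esub> y)"
    and finite_dimensional: "fin_dim"

text \<open>
  \<^locale>\<open>module\<close> requires a commutative base ring, hence a separate locale. As usual for the record
  type \<open>module\<close>, the fields \<^const>\<open>monoid.mult\<close> and \<^const>\<open>monoid.one\<close> of a module are junk.
\<close>

locale left_module = R?: ring R + M?: abelian_group M
  for R :: "('a, 'r) ring_scheme" (structure) and M :: "('a, 'm) module" (structure) +
  assumes smult_closed: "\<lbrakk>a \<in> carrier R; x \<in> carrier M\<rbrakk> \<Longrightarrow> a \<odot>\<^bsub>M\<^esub> x \<in> carrier M"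
    and smult_l_distr:
      "\<lbrakk>a \<in> carrier R; b \<in> carrier R; x \<in> carrier M\<rbrakk> \<Longrightarrow>
        (a \<oplus>\<^bsub>R\<^esub> b) \<odot>\<^bsub>M\<^esub> x = a \<odot>\<^bsub>M\<^esub> x \<oplus>\<^bsub>M\<^esub> b \<odot>\<^bsub>M\<^esub> x"
    and smult_r_distr:
      "\<lbrakk>a \<in> carrier R; x \<in> carrier M; y \<in> carrier M\<rbrakk> \<Longrightarrow>
        a \<odot>\<^bsub>M\<^esub> (x \<oplus>\<^bsub>M\<^esub> y) = a \<odot>\<^bsub>M\<^esub> x \<oplus>\<^bsub>M\<^esub> a \<odot>\<^bsub>M\<^esub> y"
    and smult_assoc:
      "\<lbrakk>a \<in> carrier R; b \<in> carrier R; x \<in> carrier M\<rbrakk> \<Longrightarrow>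
        (a \<otimes>\<^bsub>R\<^esub> b) \<odot>\<^bsub>M\<^esub> x = a \<odot>\<^bsub>M\<^esub> (b \<odot>\<^bsub>M\<^esub> x)"
    and smult_one: "x \<in> carrier M \<Longrightarrow> \<one>\<^bsub>R\<^esub> \<odot>\<^bsub>M\<^esub> x = x"

definition fin_gen :: "('k, 'a) module \<Rightarrow> ('a, 'm) module \<Rightarrow> bool" where
  "fin_gen \<Lambda> M \<longleftrightarrow>
    (\<exists>S. finite S \<and> S \<subseteq> carrier M \<and>
      (\<forall>N. Module.submodule N \<Lambda> M \<and> S \<subseteq> N \<longrightarrow> N = carrier M))"

definition quot_module :: "('a, 'm) module \<Rightarrow> 'm set \<Rightarrow> ('a, 'm set) module" where
  "quot_module M N =
    \<lparr>carrier = a_rcosets\<^bsub>M\<^esub> N, monoid.mult = (\<lambda>C D. N), monoid.one = N, ring.zero = N, ring.add = set_add M,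
     module.smult = (\<lambda>a C. \<Union>x\<in>C. N +>\<^bsub>M\<^esub> (a \<odot>\<^bsub>M\<^esub> x))\<rparr>"

text \<open>
  Homomorphisms are taken extensional on the carrier, so that distinct elements of \<open>Homs R M N\<close> are
  distinct maps; otherwise the dimension of a Hom space would be meaningless.
\<close>

definition Homs :: "('a, 'r) ring_scheme \<Rightarrow> ('a, 'm) module \<Rightarrow> ('a, 'n) module \<Rightarrow> ('m \<Rightarrow> 'n) set" where
  "Homs R M N = LinearCombinations.module_hom R M N \<inter> extensional (carrier M)"

definition mod_iso :: "('k, 'a) module \<Rightarrow> ('a, 'm) module \<Rightarrow> ('a, 'n) module \<Rightarrow> bool" where
  "mod_iso \<Lambda> M N \<longleftrightarrow> (\<exists>f \<in> Homs \<Lambda> M N. bij_betw f (carrier M) (carrier N))"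

text \<open>The field \<open>K\<close> acts on a \<open>\<Lambda>\<close>-module through the scalars \<open>c \<cdot> 1\<close> of \<open>\<Lambda>\<close>.\<close>

definition hom_space ::
  "('k, 'a) module \<Rightarrow> ('a, 'm) module \<Rightarrow> ('a, 'n) module \<Rightarrow> ('k, 'm \<Rightarrow> 'n) module" where
  "hom_space \<Lambda> M N =
    \<lparr>carrier = Homs \<Lambda> M N,
     monoid.mult = (\<lambda>f g. \<lambda>x\<in>carrier M. \<zero>\<^bsub>N\<^esub>), monoid.one = (\<lambda>x\<in>carrier M. \<zero>\<^bsub>N\<^esub>),
     ring.zero = (\<lambda>x\<in>carrier M. \<zero>\<^bsub>N\<^esub>),
     ring.add = (\<lambda>f g. \<lambda>x\<in>carrier M. f x \<oplus>\<^bsub>N\<^esub> g x),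
     module.smult = (\<lambda>c f. \<lambda>x\<in>carrier M. (c \<odot>\<^bsub>\<Lambda>\<^esub> \<one>\<^bsub>\<Lambda>\<^esub>) \<odot>\<^bsub>N\<^esub> f x)\<rparr>"

definition hom_dim ::
  "'k ring \<Rightarrow> ('k, 'a) module \<Rightarrow> ('a, 'm) module \<Rightarrow> ('a, 'n) module \<Rightarrow> nat" where
  "hom_dim K \<Lambda> M N = vectorspace.dim K (hom_space \<Lambda> M N)"


section \<open>Simple modules, tops and composition multiplicities\<close>

definition simple_module :: "('k, 'a) module \<Rightarrow> ('a, 'm) module \<Rightarrow> bool" where
  "simple_module \<Lambda> S \<longleftrightarrow>
    left_module \<Lambda> S \<and> carrier S \<noteq> {\<zero>\<^bsub>S\<^esub>} \<and>
    (\<forall>N. Module.submodule N \<Lambda> S \<longrightarrow> N = {\<zero>\<^bsub>S\<^esub>} \<or> N = carrier S)"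

definition maximal_submodule :: "('k, 'a) module \<Rightarrow> 'm set \<Rightarrow> ('a, 'm) module \<Rightarrow> bool" where
  "maximal_submodule \<Lambda> N M \<longleftrightarrow>
    Module.submodule N \<Lambda> M \<and> N \<noteq> carrier M \<and>
    (\<forall>U. Module.submodule U \<Lambda> M \<and> N \<subseteq> U \<longrightarrow> U = N \<or> U = carrier M)"

definition mod_rad :: "('k, 'a) module \<Rightarrow> ('a, 'm) module \<Rightarrow> 'm set" where
  "mod_rad \<Lambda> M = carrier M \<inter> \<Inter>{N. maximal_submodule \<Lambda> N M}"

definition mod_top :: "('k, 'a) module \<Rightarrow> ('a, 'm) module \<Rightarrow> ('a, 'm set) module" where
  "mod_top \<Lambda> M = quot_module M (mod_rad \<Lambda> M)"

definition composition_factor :: "('a, 'm) module \<Rightarrow> (nat \<Rightarrow> 'm set) \<Rightarrow> nat \<Rightarrow> ('a, 'm set) module" where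
  "composition_factor M F j = quot_module (M\<lparr>carrier := F (Suc j)\<rparr>) (F j)"

definition composition_series ::
  "('k, 'a) module \<Rightarrow> ('a, 'm) module \<Rightarrow> nat \<Rightarrow> (nat \<Rightarrow> 'm set) \<Rightarrow> bool" where
  "composition_series \<Lambda> M l F \<longleftrightarrow>
    F 0 = {\<zero>\<^bsub>M\<^esub>} \<and> F l = carrier M \<and>
    (\<forall>j\<le>l. Module.submodule (F j) \<Lambda> M) \<and>
    (\<forall>j<l. F j \<subseteq> F (Suc j) \<and> simple_module \<Lambda> (composition_factor M F j))"

text \<open>By Jordan--Hoelder the number counted here does not depend on the composition series.\<close>

definition comp_mult :: "('k, 'a) module \<Rightarrow> ('a, 'm) module \<Rightarrow> ('a, 's) module \<Rightarrow> nat" where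
  "comp_mult \<Lambda> M S =
    (THE c. \<exists>l F. composition_series \<Lambda> M l F \<and>
      c = card {j. j < l \<and> mod_iso \<Lambda> (composition_factor M F j) S})"


section \<open>Finitely generated projective modules\<close>

text \<open>
  A category of modules has to live on a fixed carrier type. We use \<open>nat \<Rightarrow> 'a\<close>: every finitely
  generated module is a quotient of some \<open>\<Lambda>\<^sup>m\<close>, whose carrier embeds into this type, so transport of
  structure yields an isomorphic copy with elements in \<open>nat \<Rightarrow> 'a\<close> (the operations of a record are
  arbitrary, they need not be the pointwise ones).
\<close>

type_synonym 'a fg_univ = "('a, nat \<Rightarrow> 'a) module"

text \<open>
  The lifting property against all surjections between modules living on \<open>nat \<Rightarrow> 'a\<close>. For a finitely
  generated \<open>P\<close> this is projectivity in the usual sense, since it already splits a surjection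
  \<open>\<Lambda>\<^sup>m \<rightarrow> P\<close>.
\<close>

definition projective :: "('k, 'a) module \<Rightarrow> ('a, 'p) module \<Rightarrow> bool" where
  "projective \<Lambda> P \<longleftrightarrow>
    (\<forall>(M :: 'a fg_univ) (N :: 'a fg_univ) g f.
      left_module \<Lambda> M \<and> left_module \<Lambda> N \<and>
      g \<in> Homs \<Lambda> M N \<and> g ` carrier M = carrier N \<and> f \<in> Homs \<Lambda> P N \<longrightarrow>
      (\<exists>h \<in> Homs \<Lambda> P M. \<forall>x\<in>carrier P. g (h x) = f x))"

definition indecomposable :: "('k, 'a) module \<Rightarrow> ('a, 'm) module \<Rightarrow> bool" where
  "indecomposable \<Lambda> M \<longleftrightarrow>
    carrier M \<noteq> {\<zero>\<^bsub>M\<^esub>} \<and>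
    (\<forall>U V. Module.submodule U \<Lambda> M \<and> Module.submodule V \<Lambda> M \<and>
      U <+>\<^bsub>M\<^esub> V = carrier M \<and> U \<inter> V = {\<zero>\<^bsub>M\<^esub>} \<longrightarrow> U = {\<zero>\<^bsub>M\<^esub>} \<or> V = {\<zero>\<^bsub>M\<^esub>})"

definition fg_proj :: "('k, 'a) module \<Rightarrow> 'a fg_univ set" where
  "fg_proj \<Lambda> = {P. left_module \<Lambda> P \<and> fin_gen \<Lambda> P \<and> projective \<Lambda> P}"

text \<open>\<open>P 1, \<dots>, P n\<close> represent the isomorphism classes of indecomposable projectives.\<close>

definition indec_proj_reps :: "('k, 'a) module \<Rightarrow> nat \<Rightarrow> (nat \<Rightarrow> 'a fg_univ) \<Rightarrow> bool" where
  "indec_proj_reps \<Lambda> n P \<longleftrightarrow>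
    (\<forall>i\<in>{1..n}. P i \<in> fg_proj \<Lambda> \<and> indecomposable \<Lambda> (P i)) \<and>
    (\<forall>i\<in>{1..n}. \<forall>j\<in>{1..n}. mod_iso \<Lambda> (P i) (P j) \<longrightarrow> i = j) \<and>
    (\<forall>Q\<in>fg_proj \<Lambda>. indecomposable \<Lambda> Q \<longrightarrow> (\<exists>i\<in>{1..n}. mod_iso \<Lambda> Q (P i)))"


section \<open>Minimal projective presentations\<close>

definition superfluous :: "('k, 'a) module \<Rightarrow> 'm set \<Rightarrow> ('a, 'm) module \<Rightarrow> bool" where
  "superfluous \<Lambda> N M \<longleftrightarrow>
    (\<forall>U. Module.submodule U \<Lambda> M \<and> N <+>\<^bsub>M\<^esub> U = carrier M \<longrightarrow> U = carrier M)"

text \<open>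
  \<open>P1 \<rightarrow> P0 \<rightarrow> M \<rightarrow> 0\<close> (with maps \<open>f\<close> and \<open>p\<close>) is exact, and both \<open>P0 \<rightarrow> M\<close> and \<open>P1 \<rightarrow> ker p\<close> are
  projective covers.
\<close>

definition min_proj_pres ::
  "('k, 'a) module \<Rightarrow> ('a, 'm) module \<Rightarrow>
    'a fg_univ \<Rightarrow> 'a fg_univ \<Rightarrow> ((nat \<Rightarrow> 'a) \<Rightarrow> nat \<Rightarrow> 'a) \<Rightarrow> ((nat \<Rightarrow> 'a) \<Rightarrow> 'm) \<Rightarrow> bool" where
  "min_proj_pres \<Lambda> M P1 P0 f p \<longleftrightarrow>
    P1 \<in> fg_proj \<Lambda> \<and> P0 \<in> fg_proj \<Lambda> \<and> f \<in> Homs \<Lambda> P1 P0 \<and> p \<in> Homs \<Lambda> P0 M \<and>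
    p ` carrier P0 = carrier M \<and>
    f ` carrier P1 = a_kernel P0 M p \<and>
    superfluous \<Lambda> (a_kernel P0 M p) P0 \<and>
    superfluous \<Lambda> (a_kernel P1 P0 f) P1"

text \<open>
  A minimal projective presentation exists for every finitely generated \<open>M\<close> and is unique up to
  isomorphism; we fix one, as the definition of \<open>Tr\<close> requires.
\<close>

definition the_min_pres ::
  "('k, 'a) module \<Rightarrow> ('a, 'm) module \<Rightarrow>
    'a fg_univ \<times> 'a fg_univ \<times> ((nat \<Rightarrow> 'a) \<Rightarrow> nat \<Rightarrow> 'a)" where
  "the_min_pres \<Lambda> M = (SOME (P1, P0, f). \<exists>p. min_proj_pres \<Lambda> M P1 P0 f p)"


section \<open>The Auslander--Reiten translation\<close>

text \<open>Right \<open>\<Lambda>\<close>-modules are treated as left modules over the opposite algebra.\<close>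

definition opp_algebra :: "('k, 'a) module \<Rightarrow> ('k, 'a) module" where
  "opp_algebra \<Lambda> = \<Lambda>\<lparr>monoid.mult := (\<lambda>x y. y \<otimes>\<^bsub>\<Lambda>\<^esub> x)\<rparr>"

definition regular_module :: "('a, 'r) ring_scheme \<Rightarrow> ('a, 'a) module" where
  "regular_module R =
    \<lparr>carrier = carrier R, monoid.mult = monoid.mult R, monoid.one = \<one>\<^bsub>R\<^esub>,
     ring.zero = \<zero>\<^bsub>R\<^esub>, ring.add = ring.add R, module.smult = monoid.mult R\<rparr>"

definition underlying_space :: "('k, 'a) module \<Rightarrow> ('a, 'm) module \<Rightarrow> ('k, 'm) module" where
  "underlying_space \<Lambda> M =
    \<lparr>carrier = carrier M, monoid.mult = monoid.mult M, monoid.one = \<one>\<^bsub>M\<^esub>,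
     ring.zero = \<zero>\<^bsub>M\<^esub>, ring.add = ring.add M,
     module.smult = (\<lambda>c x. (c \<odot>\<^bsub>\<Lambda>\<^esub> \<one>\<^bsub>\<Lambda>\<^esub>) \<odot>\<^bsub>M\<^esub> x)\<rparr>"

text \<open>
  \<open>D = Hom\<^sub>K(-, K)\<close>. For a left \<open>\<Lambda>\<close>-module \<open>M\<close> this is a module over the opposite of \<open>\<Lambda>\<close>; used below
  with the opposite algebra in place of \<open>\<Lambda>\<close>, giving a left \<open>\<Lambda>\<close>-module again.
\<close>

definition k_dual :: "'k ring \<Rightarrow> ('k, 'a) module \<Rightarrow> ('a, 'm) module \<Rightarrow> ('a, 'm \<Rightarrow> 'k) module" where
  "k_dual K \<Lambda> M =
    \<lparr>carrier = Homs K (underlying_space \<Lambda> M) (regular_module K),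
     monoid.mult = (\<lambda>\<phi> \<psi>. \<lambda>x\<in>carrier M. \<zero>\<^bsub>K\<^esub>), monoid.one = (\<lambda>x\<in>carrier M. \<zero>\<^bsub>K\<^esub>),
     ring.zero = (\<lambda>x\<in>carrier M. \<zero>\<^bsub>K\<^esub>),
     ring.add = (\<lambda>\<phi> \<psi>. \<lambda>x\<in>carrier M. \<phi> x \<oplus>\<^bsub>K\<^esub> \<psi> x),
     module.smult = (\<lambda>a \<phi>. \<lambda>x\<in>carrier M. \<phi> (a \<odot>\<^bsub>M\<^esub> x))\<rparr>"

text \<open>\<open>M\<^sup>* = Hom\<^sub>\<Lambda>(M, \<Lambda>)\<close>, a right \<open>\<Lambda>\<close>-module via \<open>(g a)(x) = g(x) a\<close>.\<close>

definition algebra_dual :: "('k, 'a) module \<Rightarrow> ('a, 'm) module \<Rightarrow> ('a, 'm \<Rightarrow> 'a) module" where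
  "algebra_dual \<Lambda> M =
    \<lparr>carrier = Homs \<Lambda> M (regular_module \<Lambda>),
     monoid.mult = (\<lambda>g h. \<lambda>x\<in>carrier M. \<zero>\<^bsub>\<Lambda>\<^esub>), monoid.one = (\<lambda>x\<in>carrier M. \<zero>\<^bsub>\<Lambda>\<^esub>),
     ring.zero = (\<lambda>x\<in>carrier M. \<zero>\<^bsub>\<Lambda>\<^esub>),
     ring.add = (\<lambda>g h. \<lambda>x\<in>carrier M. g x \<oplus>\<^bsub>\<Lambda>\<^esub> h x),
     module.smult = (\<lambda>a g. \<lambda>x\<in>carrier M. g x \<otimes>\<^bsub>\<Lambda>\<^esub> a)\<rparr>"

text \<open>\<open>Tr M\<close> is the cokernel of \<open>f\<^sup>* : P0\<^sup>* \<rightarrow> P1\<^sup>*\<close>.\<close>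

definition transpose_module ::
  "('k, 'a) module \<Rightarrow> ('a, 'm) module \<Rightarrow> ('a, ((nat \<Rightarrow> 'a) \<Rightarrow> 'a) set) module" where
  "transpose_module \<Lambda> M =
    (case the_min_pres \<Lambda> M of (P1, P0, f) \<Rightarrow>
      quot_module (algebra_dual \<Lambda> P1)
        ((\<lambda>g. compose (carrier P1) g f) ` carrier (algebra_dual \<Lambda> P0)))"

definition ar_translate ::
  "'k ring \<Rightarrow> ('k, 'a) module \<Rightarrow> ('a, 'm) module \<Rightarrow>
    ('a, ((nat \<Rightarrow> 'a) \<Rightarrow> 'a) set \<Rightarrow> 'k) module" where
  "ar_translate K \<Lambda> M = k_dual K (opp_algebra \<Lambda>) (transpose_module \<Lambda> M)"


section \<open>The Grothendieck group of finitely generated projectives, g-vectors\<close>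

definition K0_relations :: "('k, 'a) module \<Rightarrow> ('a fg_univ \<Rightarrow>\<^sub>0 int) set" where
  "K0_relations \<Lambda> =
    generate (free_Abelian_group (fg_proj \<Lambda>))
      {frag_of C - frag_of A - frag_of B | A B C.
        A \<in> fg_proj \<Lambda> \<and> B \<in> fg_proj \<Lambda> \<and> C \<in> fg_proj \<Lambda> \<and> mod_iso \<Lambda> C (direct_sum A B)}"

text \<open>Note the multiplicative notation of \<^locale>\<open>comm_group\<close> for this abelian group.\<close>

definition K0_proj :: "('k, 'a) module \<Rightarrow> ('a fg_univ \<Rightarrow>\<^sub>0 int) set monoid" where
  "K0_proj \<Lambda> = free_Abelian_group (fg_proj \<Lambda>) Mod K0_relations \<Lambda>"

definition K0_class :: "('k, 'a) module \<Rightarrow> 'a fg_univ \<Rightarrow> ('a fg_univ \<Rightarrow>\<^sub>0 int) set" where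
  "K0_class \<Lambda> P = K0_relations \<Lambda> #>\<^bsub>free_Abelian_group (fg_proj \<Lambda>)\<^esub> frag_of P"

definition g_vector ::
  "('k, 'a) module \<Rightarrow> nat \<Rightarrow> (nat \<Rightarrow> 'a fg_univ) \<Rightarrow> ('a, 'm) module \<Rightarrow> nat \<Rightarrow> int" where
  "g_vector \<Lambda> n P M =
    (case the_min_pres \<Lambda> M of (P1, P0, f) \<Rightarrow>
      (THE g. (\<forall>i. i \<notin> {1..n} \<longrightarrow> g i = 0) \<and>
        K0_class \<Lambda> P0 \<otimes>\<^bsub>K0_proj \<Lambda>\<^esub> inv\<^bsub>K0_proj \<Lambda>\<^esub> K0_class \<Lambda> P1
          = finprod (K0_proj \<Lambda>) (\<lambda>i. K0_class \<Lambda> (P i) [^]\<^bsub>K0_proj \<Lambda>\<^esub> g i) {1..n}))"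

text \<open>The simple module \<open>S(i)\<close> is the top of \<open>P(i)\<close>.\<close>

definition dim_vector ::
  "('k, 'a) module \<Rightarrow> (nat \<Rightarrow> 'a fg_univ) \<Rightarrow> ('a, 'm) module \<Rightarrow> nat \<Rightarrow> int" where
  "dim_vector \<Lambda> P M i = int (comp_mult \<Lambda> M (mod_top \<Lambda> (P i)))"

definition vec_dot :: "nat \<Rightarrow> (nat \<Rightarrow> int) \<Rightarrow> (nat \<Rightarrow> int) \<Rightarrow> int" where
  "vec_dot n a b = (\<Sum>i=1..n. a i * b i)"


section \<open>The E-invariant\<close>

definition E_prime ::
  "'k ring \<Rightarrow> ('k, 'a) module \<Rightarrow> ('a, 'x) module \<Rightarrow> ('a, 'y) module \<Rightarrow> nat" where
  "E_prime K \<Lambda> X Y = hom_dim K \<Lambda> X (ar_translate K \<Lambda> Y)"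

definition E_sym ::
  "'k ring \<Rightarrow> ('k, 'a) module \<Rightarrow> ('a, 'x) module \<Rightarrow> ('a, 'y) module \<Rightarrow> nat" where
  "E_sym K \<Lambda> X Y = E_prime K \<Lambda> X Y + E_prime K \<Lambda> Y X"

definition E_self :: "'k ring \<Rightarrow> ('k, 'a) module \<Rightarrow> ('a, 'x) module \<Rightarrow> nat" where
  "E_self K \<Lambda> X = E_sym K \<Lambda> X X"

end

theory Submission
  imports Defs
begin

text \<open>
  Let \<open>P1 \<rightarrow> P0 \<rightarrow> Y \<rightarrow> 0\<close> be the minimal projective presentation. The formula for \<open>E'(X, Y)\<close> comes
  from the exact sequence
    \<open>0 \<rightarrow> Hom(Y, X) \<rightarrow> Hom(P0, X) \<rightarrow> Hom(P1, X) \<rightarrow> D Hom(X, D Tr Y) \<rightarrow> 0\<close>,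
  by counting dimensions: \<open>dim Hom(X, D Tr Y) = dim Hom(Y, X) - (dim Hom(P0, X) - dim Hom(P1, X))\<close>.
  The other two formulas are sums of instances of the first.

  Exactness on the left is the universal property of the cokernel \<open>Y\<close> (\<open>hom_dim_presentation\<close>). For the
  right end, a homomorphism from \<open>X\<close> to \<open>D Tr Y\<close> is a balanced pairing of \<open>X\<close> with \<open>Tr Y\<close>, the cokernel
  of \<open>Hom(P0, \<Lambda>) \<rightarrow> Hom(P1, \<Lambda>)\<close>. A functional \<open>\<phi>\<close> on \<open>Hom(P1, X)\<close> gives the pairing
  \<open>(x, g) \<mapsto> \<phi>(g(-) x)\<close>, which is well defined on \<open>Tr Y\<close> if \<open>\<phi>\<close> vanishes on the image of \<open>Hom(P0, X)\<close>.
  Dual bases of \<open>P1\<close> and \<open>P0\<close> express every homomorphism \<open>h\<close> from these modules as a finite sum of maps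
  \<open>g\<^sub>i(-) h(b\<^sub>i)\<close>, and therefore invert this construction (\<open>hom_dim_dual_cokernel\<close>).

  It remains to see that \<open>dim Hom(P0, X) - dim Hom(P1, X)\<close> is the product of the g-vector of \<open>Y\<close> with the
  dimension vector of \<open>X\<close>. Since \<open>Hom(P, -)\<close> is exact for projective \<open>P\<close>, and \<open>Hom(P(i), S)\<close> is
  one-dimensional or zero according to whether the simple module \<open>S\<close> is \<open>S(i)\<close> or not, \<open>dim Hom(P(i), X)\<close>
  is the multiplicity of \<open>S(i)\<close> in every composition series of \<open>X\<close> (\<open>comp_mult_eq_hom_dim\<close>). This is where
  the field has to be algebraically closed: it makes the endomorphisms of \<open>S\<close> scalars. As \<open>dim Hom(-, X)\<close> is
  additive on direct sums, it is a function on \<open>K\<^sub>0\<close> and may be evaluated at \<open>P0 - P1 = \<Sum>i. g\<^sub>i P(i)\<close>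
  (\<open>hom_dim_g_vector\<close>). The g-vector exists because projectives decompose into indecomposables, and it is
  unique because the additive functions \<open>dim Hom(-, S(j))\<close> read off its entries.

  The definitions rely on two facts about finite-dimensional modules: minimal projective presentations
  exist, and an indecomposable projective has only one maximal submodule. Both follow from Fitting's lemma,
  applied to the lifts of a map along a surjection (\<open>projective_cover_exists\<close>,
  \<open>maximal_submodule_unique\<close>).
\<close>

section \<open>Modules over a ring\<close>

lemma left_moduleI:
  assumes "ring R"
    and "\<zero>\<^bsub>M\<^esub> \<in> carrier M"
    and "\<And>x y. \<lbrakk>x \<in> carrier M; y \<in> carrier M\<rbrakk> \<Longrightarrow> x \<oplus>\<^bsub>M\<^esub> y \<in> carrier M"
    and "\<And>x. x \<in> carrier M \<Longrightarrow> \<exists>y\<in>carrier M. y \<oplus>\<^bsub>M\<^esub> x = \<zero>\<^bsub>M\<^esub>"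
    and "\<And>x y. \<lbrakk>x \<in> carrier M; y \<in> carrier M\<rbrakk> \<Longrightarrow> x \<oplus>\<^bsub>M\<^esub> y = y \<oplus>\<^bsub>M\<^esub> x"
    and "\<And>x y z. \<lbrakk>x \<in> carrier M; y \<in> carrier M; z \<in> carrier M\<rbrakk> \<Longrightarrow>
          (x \<oplus>\<^bsub>M\<^esub> y) \<oplus>\<^bsub>M\<^esub> z = x \<oplus>\<^bsub>M\<^esub> (y \<oplus>\<^bsub>M\<^esub> z)"
    and "\<And>x. x \<in> carrier M \<Longrightarrow> \<zero>\<^bsub>M\<^esub> \<oplus>\<^bsub>M\<^esub> x = x"
    and "\<And>a x. \<lbrakk>a \<in> carrier R; x \<in> carrier M\<rbrakk> \<Longrightarrow> a \<odot>\<^bsub>M\<^esub> x \<in> carrier M"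
    and "\<And>a b x. \<lbrakk>a \<in> carrier R; b \<in> carrier R; x \<in> carrier M\<rbrakk> \<Longrightarrow>
          (a \<oplus>\<^bsub>R\<^esub> b) \<odot>\<^bsub>M\<^esub> x = a \<odot>\<^bsub>M\<^esub> x \<oplus>\<^bsub>M\<^esub> b \<odot>\<^bsub>M\<^esub> x"
    and "\<And>a x y. \<lbrakk>a \<in> carrier R; x \<in> carrier M; y \<in> carrier M\<rbrakk> \<Longrightarrow>
          a \<odot>\<^bsub>M\<^esub> (x \<oplus>\<^bsub>M\<^esub> y) = a \<odot>\<^bsub>M\<^esub> x \<oplus>\<^bsub>M\<^esub> a \<odot>\<^bsub>M\<^esub> y"
    and "\<And>a b x. \<lbrakk>a \<in> carrier R; b \<in> carrier R; x \<in> carrier M\<rbrakk> \<Longrightarrow>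
          (a \<otimes>\<^bsub>R\<^esub> b) \<odot>\<^bsub>M\<^esub> x = a \<odot>\<^bsub>M\<^esub> (b \<odot>\<^bsub>M\<^esub> x)"
    and "\<And>x. x \<in> carrier M \<Longrightarrow> \<one>\<^bsub>R\<^esub> \<odot>\<^bsub>M\<^esub> x = x"
  shows "left_module R M"
proof -
  have "abelian_group M"
    by (rule abelian_groupI) (use assms in auto)
  then show ?thesis
    unfolding left_module_def left_module_axioms_def using assms by auto
qed

context left_module
begin

lemma abelian: "abelian_group M"
  by (rule M.abelian_group_axioms)

lemma smult_zero [simp]:
  assumes "a \<in> carrier R" shows "a \<odot>\<^bsub>M\<^esub> \<zero>\<^bsub>M\<^esub> = \<zero>\<^bsub>M\<^esub>"
proof -
  have "a \<odot>\<^bsub>M\<^esub> \<zero>\<^bsub>M\<^esub> = a \<odot>\<^bsub>M\<^esub> \<zero>\<^bsub>M\<^esub> \<oplus>\<^bsub>M\<^esub> a \<odot>\<^bsub>M\<^esub> \<zero>\<^bsub>M\<^esub>"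
    using smult_r_distr[OF assms M.zero_closed M.zero_closed] by simp
  then show ?thesis using M.add.r_cancel_one' smult_closed[OF assms M.zero_closed] by metis
qed

lemma zero_smult [simp]:
  assumes "x \<in> carrier M" shows "\<zero>\<^bsub>R\<^esub> \<odot>\<^bsub>M\<^esub> x = \<zero>\<^bsub>M\<^esub>"
proof -
  have "\<zero>\<^bsub>R\<^esub> \<odot>\<^bsub>M\<^esub> x = \<zero>\<^bsub>R\<^esub> \<odot>\<^bsub>M\<^esub> x \<oplus>\<^bsub>M\<^esub> \<zero>\<^bsub>R\<^esub> \<odot>\<^bsub>M\<^esub> x"
    using smult_l_distr[OF R.zero_closed R.zero_closed assms] by simp
  then show ?thesis using M.add.r_cancel_one' smult_closed[OF R.zero_closed assms] by metis
qed

lemma neg_one_smult: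
  assumes "x \<in> carrier M" shows "(\<ominus>\<^bsub>R\<^esub> \<one>\<^bsub>R\<^esub>) \<odot>\<^bsub>M\<^esub> x = \<ominus>\<^bsub>M\<^esub> x"
proof -
  have "(\<ominus>\<^bsub>R\<^esub> \<one>\<^bsub>R\<^esub>) \<odot>\<^bsub>M\<^esub> x \<oplus>\<^bsub>M\<^esub> x = (\<ominus>\<^bsub>R\<^esub> \<one>\<^bsub>R\<^esub> \<oplus>\<^bsub>R\<^esub> \<one>\<^bsub>R\<^esub>) \<odot>\<^bsub>M\<^esub> x"
    using smult_l_distr[of "\<ominus>\<^bsub>R\<^esub> \<one>\<^bsub>R\<^esub>" "\<one>\<^bsub>R\<^esub>" x] assms by (simp add: smult_one)
  also have "\<dots> = \<zero>\<^bsub>M\<^esub>" using assms by (simp add: R.l_neg)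
  finally show ?thesis
    using M.minus_equality[of "(\<ominus>\<^bsub>R\<^esub> \<one>\<^bsub>R\<^esub>) \<odot>\<^bsub>M\<^esub> x" x] assms smult_closed by simp
qed

lemma submodule_iff:
  "Module.submodule N R M \<longleftrightarrow>
    N \<subseteq> carrier M \<and> \<zero>\<^bsub>M\<^esub> \<in> N \<and> (\<forall>x\<in>N. \<forall>y\<in>N. x \<oplus>\<^bsub>M\<^esub> y \<in> N) \<and>
    (\<forall>a\<in>carrier R. \<forall>x\<in>N. a \<odot>\<^bsub>M\<^esub> x \<in> N)" (is "?L = ?R")
proof
  assume ?L
  then interpret N: Module.submodule N R M .
  show ?R
    using N.subset N.one_closed N.m_closed N.smult_closed by auto
next
  assume r: ?R
  have neg: "\<ominus>\<^bsub>M\<^esub> x \<in> N" if "x \<in> N" for x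
    using r that neg_one_smult[of x] R.a_inv_closed[OF R.one_closed] by (metis subsetD)
  have "subgroup N (add_monoid M)"
    by (rule M.add.subgroupI) (use r neg in \<open>auto simp: a_inv_def\<close>)
  then show ?L using r by (auto intro!: Module.submodule.intro submodule_axioms.intro)
qed

lemma submodule_carrier: "Module.submodule (carrier M) R M"
  by (auto simp: submodule_iff smult_closed)

lemma submodule_zero: "Module.submodule {\<zero>\<^bsub>M\<^esub>} R M"
  by (auto simp: submodule_iff)

lemma submodule_neg:
  assumes "Module.submodule N R M" "x \<in> N" shows "\<ominus>\<^bsub>M\<^esub> x \<in> N"
  using assms neg_one_smult[of x] R.a_inv_closed[OF R.one_closed]
  unfolding submodule_iff by (metis subsetD)

lemma submodule_minus:
  assumes "Module.submodule N R M" "x \<in> N" "y \<in> N" shows "x \<ominus>\<^bsub>M\<^esub> y \<in> N"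
  using assms submodule_neg[of N y] by (auto simp: submodule_iff a_minus_def)

lemma set_add_iff:
  "x \<in> U <+>\<^bsub>M\<^esub> V \<longleftrightarrow> (\<exists>u\<in>U. \<exists>v\<in>V. x = u \<oplus>\<^bsub>M\<^esub> v)"
  by (auto simp: set_add_def set_mult_def)

lemma submodule_set_add:
  assumes U: "Module.submodule U R M" and V: "Module.submodule V R M"
  shows "Module.submodule (U <+>\<^bsub>M\<^esub> V) R M"
  unfolding submodule_iff
proof (intro conjI ballI subsetI)
  note U' = U[unfolded submodule_iff] and V' = V[unfolded submodule_iff]
  show "x \<in> carrier M" if "x \<in> U <+>\<^bsub>M\<^esub> V" for x
    using that U' V' by (auto simp: set_add_iff)
  show "\<zero>\<^bsub>M\<^esub> \<in> U <+>\<^bsub>M\<^esub> V"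
    unfolding set_add_iff using U' V' by (metis M.l_zero M.zero_closed)
  show "x \<oplus>\<^bsub>M\<^esub> y \<in> U <+>\<^bsub>M\<^esub> V" if xy: "x \<in> U <+>\<^bsub>M\<^esub> V" "y \<in> U <+>\<^bsub>M\<^esub> V" for x y
  proof -
    from xy obtain u v u' v' where
      *: "u \<in> U" "v \<in> V" "u' \<in> U" "v' \<in> V" "x = u \<oplus>\<^bsub>M\<^esub> v" "y = u' \<oplus>\<^bsub>M\<^esub> v'"
      by (auto simp: set_add_iff)
    then have "x \<oplus>\<^bsub>M\<^esub> y = (u \<oplus>\<^bsub>M\<^esub> u') \<oplus>\<^bsub>M\<^esub> (v \<oplus>\<^bsub>M\<^esub> v')"
      using U' V' by (simp add: M.a_ac subset_iff)
    then show ?thesis using * U' V' unfolding set_add_iff by blast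
  qed
  show "a \<odot>\<^bsub>M\<^esub> x \<in> U <+>\<^bsub>M\<^esub> V" if a: "a \<in> carrier R" and x: "x \<in> U <+>\<^bsub>M\<^esub> V" for a x
  proof -
    from x obtain u v where *: "u \<in> U" "v \<in> V" "x = u \<oplus>\<^bsub>M\<^esub> v"
      by (auto simp: set_add_iff)
    then have "a \<odot>\<^bsub>M\<^esub> x = a \<odot>\<^bsub>M\<^esub> u \<oplus>\<^bsub>M\<^esub> a \<odot>\<^bsub>M\<^esub> v"
      using U' V' a by (simp add: smult_r_distr subset_iff)
    then show ?thesis using * U' V' a unfolding set_add_iff by blast
  qed
qed

lemma left_module_sub:
  assumes "Module.submodule N R M" shows "left_module R (M\<lparr>carrier := N\<rparr>)"
proof (rule left_moduleI)
  note N = assms[unfolded submodule_iff]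
  show "\<exists>y\<in>carrier (M\<lparr>carrier := N\<rparr>). y \<oplus>\<^bsub>M\<lparr>carrier := N\<rparr>\<^esub> x = \<zero>\<^bsub>M\<lparr>carrier := N\<rparr>\<^esub>"
    if "x \<in> carrier (M\<lparr>carrier := N\<rparr>)" for x
    using that N submodule_neg[OF assms, of x] by (auto intro!: bexI[of _ "\<ominus>\<^bsub>M\<^esub> x"] M.l_neg)
qed (use assms[unfolded submodule_iff] R.ring_axioms in
    \<open>auto simp: subset_iff M.a_ac smult_l_distr smult_r_distr smult_assoc smult_one\<close>)

lemma submodule_sub_iff:
  assumes "Module.submodule N R M"
  shows "Module.submodule U R (M\<lparr>carrier := N\<rparr>) \<longleftrightarrow> Module.submodule U R M \<and> U \<subseteq> N"
  using left_module.submodule_iff[OF left_module_sub[OF assms], of U] submodule_iff[of U]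
    assms[unfolded submodule_iff] by auto

lemma finsum_in_submodule:
  assumes N: "Module.submodule N R M" and "\<And>i. i \<in> I \<Longrightarrow> f i \<in> N"
  shows "finsum M f I \<in> N"
  using assms(2)
proof (induction I rule: infinite_finite_induct)
  case (insert i I)
  then show ?case using N by (subst M.finsum_insert) (auto simp: submodule_iff)
qed (use N in \<open>auto simp: submodule_iff M.add.finprod_infinite\<close>)

lemma finsum_smult:
  assumes "a \<in> carrier R" and "\<And>i. i \<in> I \<Longrightarrow> f i \<in> carrier M"
  shows "(\<Oplus>\<^bsub>M\<^esub>i\<in>I. a \<odot>\<^bsub>M\<^esub> f i) = a \<odot>\<^bsub>M\<^esub> finsum M f I"
  using assms(2)
proof (induction I rule: infinite_finite_induct)
  case (insert i I)
  then show ?case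
    using assms(1) by (subst M.finsum_insert; (subst M.finsum_insert)?)
      (auto simp: smult_r_distr smult_closed)
qed (use assms(1) in \<open>auto simp: M.add.finprod_infinite\<close>)

end

text \<open>The module axioms are equations, so they pass to every structure onto which a module maps. This
  saves their verification for quotients and for spaces given as images.\<close>

lemma left_module_image:
  assumes M: "left_module R M"
    and surj: "T ` carrier M = carrier W"
    and zero: "T \<zero>\<^bsub>M\<^esub> = \<zero>\<^bsub>W\<^esub>"
    and add: "\<And>x y. \<lbrakk>x \<in> carrier M; y \<in> carrier M\<rbrakk> \<Longrightarrow> T (x \<oplus>\<^bsub>M\<^esub> y) = T x \<oplus>\<^bsub>W\<^esub> T y"
    and smult: "\<And>a x. \<lbrakk>a \<in> carrier R; x \<in> carrier M\<rbrakk> \<Longrightarrow> T (a \<odot>\<^bsub>M\<^esub> x) = a \<odot>\<^bsub>W\<^esub> T x"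
  shows "left_module R W"
proof -
  interpret M: left_module R M by fact
  have pre: "\<exists>x\<in>carrier M. w = T x" if "w \<in> carrier W" for w
    using surj that by auto
  have T: "T x \<in> carrier W" if "x \<in> carrier M" for x
    using surj that by auto
  show ?thesis
  proof (rule left_moduleI)
    show "ring R" ..
    show "\<zero>\<^bsub>W\<^esub> \<in> carrier W" using T[of "\<zero>\<^bsub>M\<^esub>"] zero by simp
  next
    fix x y assume "x \<in> carrier W" "y \<in> carrier W"
    then obtain x' y' where *: "x' \<in> carrier M" "y' \<in> carrier M" "x = T x'" "y = T y'"
      using pre by metis
    show "x \<oplus>\<^bsub>W\<^esub> y \<in> carrier W" using * T[of "x' \<oplus>\<^bsub>M\<^esub> y'"] by (simp add: add)
    show "x \<oplus>\<^bsub>W\<^esub> y = y \<oplus>\<^bsub>W\<^esub> x"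
      using * add[of x' y'] add[of y' x'] by (simp add: M.M.a_comm)
    fix z assume "z \<in> carrier W"
    then obtain z' where **: "z' \<in> carrier M" "z = T z'" using pre by metis
    show "x \<oplus>\<^bsub>W\<^esub> y \<oplus>\<^bsub>W\<^esub> z = x \<oplus>\<^bsub>W\<^esub> (y \<oplus>\<^bsub>W\<^esub> z)"
      using * ** by (simp flip: add add: M.M.a_assoc)
  next
    fix x assume "x \<in> carrier W"
    then obtain x' where *: "x' \<in> carrier M" "x = T x'" using pre by metis
    show "\<exists>y\<in>carrier W. y \<oplus>\<^bsub>W\<^esub> x = \<zero>\<^bsub>W\<^esub>"
      using * T zero by (intro bexI[of _ "T (\<ominus>\<^bsub>M\<^esub> x')"]) (simp_all flip: add add: M.M.l_neg)
    show "\<zero>\<^bsub>W\<^esub> \<oplus>\<^bsub>W\<^esub> x = x" using * by (simp flip: add zero)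
    show "\<one>\<^bsub>R\<^esub> \<odot>\<^bsub>W\<^esub> x = x" using * by (simp flip: smult add: M.smult_one)
    fix a assume a: "a \<in> carrier R"
    show "a \<odot>\<^bsub>W\<^esub> x \<in> carrier W"
      using * a T by (simp flip: smult add: M.smult_closed)
    fix b assume b: "b \<in> carrier R"
    show "(a \<oplus>\<^bsub>R\<^esub> b) \<odot>\<^bsub>W\<^esub> x = a \<odot>\<^bsub>W\<^esub> x \<oplus>\<^bsub>W\<^esub> b \<odot>\<^bsub>W\<^esub> x"
      using * a b by (simp flip: smult add add: M.smult_closed M.smult_l_distr)
    show "(a \<otimes>\<^bsub>R\<^esub> b) \<odot>\<^bsub>W\<^esub> x = a \<odot>\<^bsub>W\<^esub> (b \<odot>\<^bsub>W\<^esub> x)"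
      using * a b by (simp flip: smult add: M.smult_closed M.smult_assoc)
  next
    fix a x y assume a: "a \<in> carrier R" and "x \<in> carrier W" "y \<in> carrier W"
    then obtain x' y' where *: "x' \<in> carrier M" "y' \<in> carrier M" "x = T x'" "y = T y'"
      using pre by metis
    show "a \<odot>\<^bsub>W\<^esub> (x \<oplus>\<^bsub>W\<^esub> y) = a \<odot>\<^bsub>W\<^esub> x \<oplus>\<^bsub>W\<^esub> a \<odot>\<^bsub>W\<^esub> y"
      using * a by (simp flip: smult add add: M.smult_closed M.smult_r_distr)
  qed
qed

subsection \<open>Homomorphisms\<close>

lemma HomsI:
  assumes "f \<in> carrier M \<rightarrow>\<^sub>E carrier N"
    and "\<And>x y. \<lbrakk>x \<in> carrier M; y \<in> carrier M\<rbrakk> \<Longrightarrow> f (x \<oplus>\<^bsub>M\<^esub> y) = f x \<oplus>\<^bsub>N\<^esub> f y"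
    and "\<And>a x. \<lbrakk>a \<in> carrier R; x \<in> carrier M\<rbrakk> \<Longrightarrow> f (a \<odot>\<^bsub>M\<^esub> x) = a \<odot>\<^bsub>N\<^esub> f x"
  shows "f \<in> Homs R M N"
  using assms by (auto simp: Homs_def LinearCombinations.module_hom_def PiE_def)

lemma HomsD:
  assumes "f \<in> Homs R M N"
  shows Homs_closed: "x \<in> carrier M \<Longrightarrow> f x \<in> carrier N"
    and Homs_add: "\<lbrakk>x \<in> carrier M; y \<in> carrier M\<rbrakk> \<Longrightarrow> f (x \<oplus>\<^bsub>M\<^esub> y) = f x \<oplus>\<^bsub>N\<^esub> f y"
    and Homs_smult: "\<lbrakk>a \<in> carrier R; x \<in> carrier M\<rbrakk> \<Longrightarrow> f (a \<odot>\<^bsub>M\<^esub> x) = a \<odot>\<^bsub>N\<^esub> f x"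
    and Homs_extensional: "f \<in> extensional (carrier M)"
    and Homs_PiE: "f \<in> carrier M \<rightarrow>\<^sub>E carrier N"
  using assms by (auto simp: Homs_def LinearCombinations.module_hom_def PiE_def)

lemma Homs_restrictI:
  assumes "\<And>x. x \<in> carrier M \<Longrightarrow> f x \<in> carrier N"
    and "\<And>x y. \<lbrakk>x \<in> carrier M; y \<in> carrier M\<rbrakk> \<Longrightarrow> f (x \<oplus>\<^bsub>M\<^esub> y) = f x \<oplus>\<^bsub>N\<^esub> f y"
    and "\<And>a x. \<lbrakk>a \<in> carrier R; x \<in> carrier M\<rbrakk> \<Longrightarrow> f (a \<odot>\<^bsub>M\<^esub> x) = a \<odot>\<^bsub>N\<^esub> f x"
    and "left_module R M"
  shows "(\<lambda>x\<in>carrier M. f x) \<in> Homs R M N"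
proof -
  interpret M: left_module R M by fact
  show ?thesis by (rule HomsI) (auto simp: assms M.smult_closed)
qed

lemma Homs_eqI:
  assumes "f \<in> Homs R M N" "g \<in> Homs R M N" "\<And>x. x \<in> carrier M \<Longrightarrow> f x = g x"
  shows "f = g"
  using assms by (meson Homs_extensional extensionalityI)

lemma Homs_compose:
  assumes "left_module R L" "f \<in> Homs R L M" "g \<in> Homs R M N"
  shows "compose (carrier L) g f \<in> Homs R L N"
  unfolding compose_def
  by (rule Homs_restrictI) (use assms in \<open>auto simp: HomsD\<close>)

context
  fixes R :: "('a, 'r) ring_scheme" and M :: "('a, 'm) module" and N :: "('a, 'n) module" and f
  assumes M: "left_module R M" and N: "left_module R N" and f: "f \<in> Homs R M N"
begin

interpretation M: left_module R M by (rule M)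
interpretation N: left_module R N by (rule N)

lemma Homs_zero: "f \<zero>\<^bsub>M\<^esub> = \<zero>\<^bsub>N\<^esub>"
  using Homs_smult[OF f, of "\<zero>\<^bsub>R\<^esub>" "\<zero>\<^bsub>M\<^esub>"] Homs_closed[OF f, of "\<zero>\<^bsub>M\<^esub>"] by simp

lemma Homs_neg:
  assumes "x \<in> carrier M" shows "f (\<ominus>\<^bsub>M\<^esub> x) = \<ominus>\<^bsub>N\<^esub> f x"
  using Homs_smult[OF f, of "\<ominus>\<^bsub>R\<^esub> \<one>\<^bsub>R\<^esub>" x] assms Homs_closed[OF f assms]
  by (simp add: M.neg_one_smult N.neg_one_smult)

lemma Homs_minus:
  assumes "x \<in> carrier M" "y \<in> carrier M" shows "f (x \<ominus>\<^bsub>M\<^esub> y) = f x \<ominus>\<^bsub>N\<^esub> f y"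
  using assms by (simp add: a_minus_def Homs_neg Homs_add[OF f])

lemma Homs_finsum:
  assumes "\<And>i. i \<in> I \<Longrightarrow> u i \<in> carrier M"
  shows "f (finsum M u I) = finsum N (\<lambda>i. f (u i)) I"
  using assms
proof (induction I rule: infinite_finite_induct)
  case (insert i I)
  then show ?case
    by (subst M.finsum_insert; (subst N.finsum_insert)?)
      (auto simp: Homs_add[OF f] Homs_closed[OF f])
qed (auto simp: Homs_zero M.add.finprod_infinite N.add.finprod_infinite)

lemma submodule_image:
  assumes "Module.submodule U R M" shows "Module.submodule (f ` U) R N"
  unfolding N.submodule_iff
proof (intro conjI ballI)
  note U = assms[unfolded M.submodule_iff]
  show "f ` U \<subseteq> carrier N" using U Homs_closed[OF f] by auto
  show "\<zero>\<^bsub>N\<^esub> \<in> f ` U" using U Homs_zero by (metis image_eqI)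
  show "x \<oplus>\<^bsub>N\<^esub> y \<in> f ` U" if "x \<in> f ` U" "y \<in> f ` U" for x y
    using that U by (auto simp flip: Homs_add[OF f] simp: subset_iff)
  show "a \<odot>\<^bsub>N\<^esub> x \<in> f ` U" if "a \<in> carrier R" "x \<in> f ` U" for a x
    using that U by (auto simp flip: Homs_smult[OF f] simp: subset_iff)
qed

lemma submodule_vimage:
  assumes "Module.submodule V R N" shows "Module.submodule {x \<in> carrier M. f x \<in> V} R M"
  using assms unfolding M.submodule_iff N.submodule_iff
  by (auto simp: Homs_zero HomsD[OF f] M.smult_closed)

lemma a_kernel_iff: "x \<in> a_kernel M N f \<longleftrightarrow> x \<in> carrier M \<and> f x = \<zero>\<^bsub>N\<^esub>"
  by (auto simp: a_kernel_def kernel_def)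

lemma submodule_kernel: "Module.submodule (a_kernel M N f) R M"
proof -
  have "a_kernel M N f = {x \<in> carrier M. f x \<in> {\<zero>\<^bsub>N\<^esub>}}" by (auto simp: a_kernel_iff)
  then show ?thesis using submodule_vimage[OF N.submodule_zero] by simp
qed

lemma inj_on_iff_kernel: "inj_on f (carrier M) \<longleftrightarrow> a_kernel M N f = {\<zero>\<^bsub>M\<^esub>}"
proof
  assume "inj_on f (carrier M)"
  then show "a_kernel M N f = {\<zero>\<^bsub>M\<^esub>}"
    using Homs_zero by (auto simp: a_kernel_iff inj_on_def)
next
  assume k: "a_kernel M N f = {\<zero>\<^bsub>M\<^esub>}"
  show "inj_on f (carrier M)"
  proof (rule inj_onI)
    fix x y assume *: "x \<in> carrier M" "y \<in> carrier M" "f x = f y"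
    then have "f (x \<ominus>\<^bsub>M\<^esub> y) = \<zero>\<^bsub>N\<^esub>"
      using Homs_closed[OF f] by (simp add: Homs_minus)
    then have "x \<ominus>\<^bsub>M\<^esub> y \<in> a_kernel M N f" using * by (simp add: a_kernel_iff)
    then show "x = y" using k * by simp
  qed
qed

lemma Homs_corestrict:
  assumes "f ` carrier M \<subseteq> V" shows "f \<in> Homs R M (N\<lparr>carrier := V\<rparr>)"
  by (rule HomsI) (use assms HomsD[OF f] in \<open>auto simp: PiE_def\<close>)

lemma Homs_restrict:
  assumes "Module.submodule U R M" shows "restrict f U \<in> Homs R (M\<lparr>carrier := U\<rparr>) N"
  by (rule HomsI) (use assms HomsD[OF f] in \<open>auto simp: M.submodule_iff subset_iff\<close>)

end

lemma Homs_sub_codomain: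
  assumes "f \<in> Homs R M (N\<lparr>carrier := V\<rparr>)" "V \<subseteq> carrier N"
  shows "f \<in> Homs R M N"
  by (rule HomsI) (use assms(2) HomsD[OF assms(1)] in \<open>auto simp: PiE_def\<close>)

lemma Homs_id:
  assumes "left_module R M" shows "(\<lambda>x\<in>carrier M. x) \<in> Homs R M M"
  by (rule Homs_restrictI) (use assms in auto)

lemma mod_iso_inverse:
  assumes M: "left_module R M" and N: "left_module R N"
    and f: "f \<in> Homs R M N" and bij: "bij_betw f (carrier M) (carrier N)"
  obtains g where "g \<in> Homs R N M" "\<And>x. x \<in> carrier M \<Longrightarrow> g (f x) = x"
    "\<And>y. y \<in> carrier N \<Longrightarrow> f (g y) = y" "bij_betw g (carrier N) (carrier M)"
proof -
  interpret M: left_module R M by fact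
  interpret N: left_module R N by fact
  let ?g = "\<lambda>y\<in>carrier N. the_inv_into (carrier M) f y"
  have inj: "inj_on f (carrier M)" and im: "f ` carrier M = carrier N"
    using bij by (auto simp: bij_betw_def)
  have g_in: "the_inv_into (carrier M) f y \<in> carrier M" if "y \<in> carrier N" for y
    using that im by (intro the_inv_into_into[OF inj]) auto
  have fg: "f (the_inv_into (carrier M) f y) = y" if "y \<in> carrier N" for y
    using that im by (intro f_the_inv_into_f[OF inj]) auto
  have "?g \<in> Homs R N M"
  proof (rule Homs_restrictI)
    fix x y assume "x \<in> carrier N" "y \<in> carrier N"
    then show "the_inv_into (carrier M) f (x \<oplus>\<^bsub>N\<^esub> y)
      = the_inv_into (carrier M) f x \<oplus>\<^bsub>M\<^esub> the_inv_into (carrier M) f y"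
      by (intro the_inv_into_f_eq[OF inj]) (auto simp: Homs_add[OF f] g_in fg)
  next
    fix a x assume "a \<in> carrier R" "x \<in> carrier N"
    then show "the_inv_into (carrier M) f (a \<odot>\<^bsub>N\<^esub> x) = a \<odot>\<^bsub>M\<^esub> the_inv_into (carrier M) f x"
      by (intro the_inv_into_f_eq[OF inj]) (auto simp: Homs_smult[OF f] g_in fg M.smult_closed)
  qed (use g_in N in auto)
  moreover have "bij_betw ?g (carrier N) (carrier M)"
    using bij_betw_the_inv_into[OF bij] by (simp cong: bij_betw_cong)
  ultimately show thesis
    using that[of ?g] fg Homs_closed[OF f] the_inv_into_f_f[OF inj] by simp
qed

lemma mod_iso_sym:
  assumes "left_module R M" "left_module R N" "mod_iso R M N"
  shows "mod_iso R N M"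
proof -
  obtain f where f: "f \<in> Homs R M N" "bij_betw f (carrier M) (carrier N)"
    using assms(3) by (auto simp: mod_iso_def)
  obtain g where "g \<in> Homs R N M" "bij_betw g (carrier N) (carrier M)"
    using mod_iso_inverse[OF assms(1,2) f] by metis
  then show ?thesis by (auto simp: mod_iso_def)
qed

subsection \<open>Quotients\<close>

context left_module
begin

context
  fixes N assumes N: "Module.submodule N R M"
begin

lemma additive_subgroup_submodule: "additive_subgroup N M"
  by (rule additive_subgroup.intro) (use N in \<open>simp add: Module.submodule_def\<close>)

interpretation N: abelian_subgroup N M
  by (rule abelian_subgroupI3[OF additive_subgroup_submodule abelian])

lemma mem_coset_iff:
  assumes "x \<in> carrier M"
  shows "y \<in> N +>\<^bsub>M\<^esub> x \<longleftrightarrow> y \<in> carrier M \<and> y \<ominus>\<^bsub>M\<^esub> x \<in> N"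
proof
  assume "y \<in> N +>\<^bsub>M\<^esub> x"
  then show "y \<in> carrier M \<and> y \<ominus>\<^bsub>M\<^esub> x \<in> N"
    using N.a_elemrcos_carrier[OF assms] N.a_rcos_module_imp[OF assms]
    unfolding a_minus_def by blast
next
  assume "y \<in> carrier M \<and> y \<ominus>\<^bsub>M\<^esub> x \<in> N"
  then show "y \<in> N +>\<^bsub>M\<^esub> x"
    using N.a_rcos_module_rev[OF assms] unfolding a_minus_def by blast
qed

lemma coset_eq_iff:
  assumes "x \<in> carrier M" "y \<in> carrier M"
  shows "N +>\<^bsub>M\<^esub> x = N +>\<^bsub>M\<^esub> y \<longleftrightarrow> x \<ominus>\<^bsub>M\<^esub> y \<in> N"
proof
  assume "N +>\<^bsub>M\<^esub> x = N +>\<^bsub>M\<^esub> y"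
  then show "x \<ominus>\<^bsub>M\<^esub> y \<in> N"
    using N.a_rcos_self[OF assms(1)] mem_coset_iff[OF assms(2)] by simp
next
  assume "x \<ominus>\<^bsub>M\<^esub> y \<in> N"
  then show "N +>\<^bsub>M\<^esub> x = N +>\<^bsub>M\<^esub> y"
    using M.a_repr_independence[of x N y, symmetric] mem_coset_iff[OF assms(2)] assms
      N.a_subgroup by auto
qed

lemma quot_carrier: "carrier (quot_module M N) = (\<lambda>x. N +>\<^bsub>M\<^esub> x) ` carrier M"
  by (auto simp: quot_module_def A_RCOSETS_def RCOSETS_def a_r_coset_def)

lemma quot_zero: "\<zero>\<^bsub>quot_module M N\<^esub> = N +>\<^bsub>M\<^esub> \<zero>\<^bsub>M\<^esub>"
proof -
  have "N +>\<^bsub>M\<^esub> \<zero>\<^bsub>M\<^esub> = N"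
    using M.a_coset_add_zero N by (simp add: submodule_iff)
  then show ?thesis by (simp add: quot_module_def)
qed

lemma quot_add:
  assumes "x \<in> carrier M" "y \<in> carrier M"
  shows "(N +>\<^bsub>M\<^esub> x) \<oplus>\<^bsub>quot_module M N\<^esub> (N +>\<^bsub>M\<^esub> y) = N +>\<^bsub>M\<^esub> (x \<oplus>\<^bsub>M\<^esub> y)"
  using N.a_rcos_sum[OF assms] by (simp add: quot_module_def)

lemma quot_smult:
  assumes a: "a \<in> carrier R" and x: "x \<in> carrier M"
  shows "a \<odot>\<^bsub>quot_module M N\<^esub> (N +>\<^bsub>M\<^esub> x) = N +>\<^bsub>M\<^esub> (a \<odot>\<^bsub>M\<^esub> x)"
proof -
  have "N +>\<^bsub>M\<^esub> (a \<odot>\<^bsub>M\<^esub> y) = N +>\<^bsub>M\<^esub> (a \<odot>\<^bsub>M\<^esub> x)" if "y \<in> N +>\<^bsub>M\<^esub> x" for y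
  proof -
    have y: "y \<in> carrier M" "y \<ominus>\<^bsub>M\<^esub> x \<in> N" using that mem_coset_iff[OF x] by auto
    have "a \<odot>\<^bsub>M\<^esub> y \<ominus>\<^bsub>M\<^esub> a \<odot>\<^bsub>M\<^esub> x = a \<odot>\<^bsub>M\<^esub> (y \<ominus>\<^bsub>M\<^esub> x)"
    proof -
      have "a \<odot>\<^bsub>M\<^esub> (y \<ominus>\<^bsub>M\<^esub> x) \<oplus>\<^bsub>M\<^esub> a \<odot>\<^bsub>M\<^esub> x = a \<odot>\<^bsub>M\<^esub> y"
        using a x y by (simp flip: smult_r_distr add: a_minus_def M.a_assoc M.l_neg)
      then show ?thesis
        using a x y smult_closed by (metis M.minus_closed M.add.inv_solve_right a_minus_def)
    qed
    also have "\<dots> \<in> N" using N a y by (auto simp: submodule_iff)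
    finally show ?thesis using a x y by (simp add: coset_eq_iff smult_closed)
  qed
  moreover have "x \<in> N +>\<^bsub>M\<^esub> x" using N.a_rcos_self[OF x] .
  ultimately have "(\<Union>y\<in>N +>\<^bsub>M\<^esub> x. N +>\<^bsub>M\<^esub> (a \<odot>\<^bsub>M\<^esub> y)) = N +>\<^bsub>M\<^esub> (a \<odot>\<^bsub>M\<^esub> x)"
    by blast
  then show ?thesis by (simp add: quot_module_def)
qed

lemma left_module_quot: "left_module R (quot_module M N)"
  by (rule left_module_image[OF left_module_axioms quot_carrier[symmetric] quot_zero[symmetric]
        quot_add[symmetric] quot_smult[symmetric]])

lemma quot_proj_Homs: "(\<lambda>x\<in>carrier M. N +>\<^bsub>M\<^esub> x) \<in> Homs R M (quot_module M N)"
  by (rule Homs_restrictI[OF _ quot_add[symmetric] quot_smult[symmetric] left_module_axioms])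
    (simp add: quot_carrier)

lemma coset_eq_zero_iff:
  "x \<in> carrier M \<Longrightarrow> N +>\<^bsub>M\<^esub> x = \<zero>\<^bsub>quot_module M N\<^esub> \<longleftrightarrow> x \<in> N"
  using neg_one_smult[of "\<zero>\<^bsub>M\<^esub>"] by (simp add: quot_zero coset_eq_iff a_minus_def)

end

end

text \<open>The first isomorphism theorem, with the isomorphism pointing from the image to the quotient:
  it sends a point to its fibre.\<close>

lemma mod_iso_quot_kernel:
  assumes P: "left_module R P" and S: "left_module R S" and f: "f \<in> Homs R P S"
    and surj: "f ` carrier P = carrier S"
  shows "mod_iso R S (quot_module P (a_kernel P S f))"
proof -
  interpret P: left_module R P by fact
  interpret S: left_module R S by fact
  let ?N = "a_kernel P S f"
  have N: "Module.submodule ?N R P" using submodule_kernel[OF P S f] .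
  define F where "F = (\<lambda>s\<in>carrier S. {p \<in> carrier P. f p = s})"
  have F: "F (f p) = ?N +>\<^bsub>P\<^esub> p" if p: "p \<in> carrier P" for p
  proof (rule Set.set_eqI)
    fix q
    have "q \<ominus>\<^bsub>P\<^esub> p \<in> ?N \<longleftrightarrow> f q = f p" if "q \<in> carrier P"
      using p that Homs_closed[OF f] by (simp add: a_kernel_iff[OF P S f] Homs_minus[OF P S f])
    then show "q \<in> F (f p) \<longleftrightarrow> q \<in> ?N +>\<^bsub>P\<^esub> p"
      unfolding P.mem_coset_iff[OF N p] by (auto simp: F_def p Homs_closed[OF f])
  qed
  have pre: "\<exists>p\<in>carrier P. s = f p" if "s \<in> carrier S" for s using surj that by auto
  have "F \<in> Homs R S (quot_module P ?N)"
  proof (rule HomsI)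
    show "F \<in> carrier S \<rightarrow>\<^sub>E carrier (quot_module P ?N)"
    proof (rule PiE_I)
      fix s assume "s \<in> carrier S"
      then obtain p where "p \<in> carrier P" "s = f p" using pre by blast
      then show "F s \<in> carrier (quot_module P ?N)" using F by (simp add: P.quot_carrier[OF N])
    qed (simp add: F_def)
  next
    fix s t assume "s \<in> carrier S" "t \<in> carrier S"
    then obtain p q where *: "p \<in> carrier P" "s = f p" "q \<in> carrier P" "t = f q" using pre by blast
    then show "F (s \<oplus>\<^bsub>S\<^esub> t) = F s \<oplus>\<^bsub>quot_module P ?N\<^esub> F t"
      by (simp flip: Homs_add[OF f] add: F P.quot_add[OF N])
  next
    fix a s assume a: "a \<in> carrier R" and "s \<in> carrier S"
    then obtain p where *: "p \<in> carrier P" "s = f p" using pre by blast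
    then show "F (a \<odot>\<^bsub>S\<^esub> s) = a \<odot>\<^bsub>quot_module P ?N\<^esub> F s"
      using a by (simp flip: Homs_smult[OF f] add: F P.quot_smult[OF N] P.smult_closed)
  qed
  moreover have "bij_betw F (carrier S) (carrier (quot_module P ?N))"
    unfolding bij_betw_def
  proof
    show "inj_on F (carrier S)"
      by (rule inj_onI) (use pre in \<open>fastforce simp: F_def\<close>)
    show "F ` carrier S = carrier (quot_module P ?N)"
      unfolding surj[symmetric] P.quot_carrier[OF N] image_image using F by (auto cong: image_cong)
  qed
  ultimately show ?thesis unfolding mod_iso_def by blast
qed

section \<open>Linear algebra\<close>

lemma vectorspace_iff: "vectorspace K V \<longleftrightarrow> field K \<and> left_module K V"
proof
  assume "vectorspace K V"
  then interpret vectorspace K V .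
  show "field K \<and> left_module K V"
    by (auto intro!: left_moduleI module.M.a_comm module.M.a_assoc module.M.l_neg
        simp: field.field_axioms field.is_ring smult_l_distr smult_r_distr smult_assoc1)
next
  assume *: "field K \<and> left_module K V"
  interpret field K using * by blast
  interpret V: left_module K V using * by blast
  have "module K V"
    by (rule moduleI)
      (auto simp: V.smult_closed V.smult_l_distr V.smult_r_distr V.smult_assoc V.smult_one
        V.abelian is_cring)
  then show "vectorspace K V" using field_axioms by (simp add: vectorspace_def)
qed

text \<open>A vector space whose record has no further fields, hence a \<open>left_module\<close> as well: submodules,
  homomorphisms and kernels then mean the same in both worlds.\<close>

locale vspace = vectorspace K V for K :: "('k, 'm) ring_scheme" and V :: "('k, 'v) module"

lemma vspaceI: "vectorspace K V \<Longrightarrow> vspace K V"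
  by (simp add: vspace_def)

context vspace
begin

lemma left_module: "left_module K V"
  using vectorspace_axioms by (simp add: vectorspace_iff)

lemma subspace_iff: "subspace K W V \<longleftrightarrow> Module.submodule W K V"
  using left_module.submodule_iff[OF left_module, of W] vectorspace_axioms
  by (auto simp: subspace_def LinearCombinations.submodule_def module_axioms)

lemma vectorspace_sub:
  assumes "Module.submodule W K V" shows "vectorspace K (vs W)"
  using subspace_is_vs assms by (simp add: subspace_iff)

text \<open>Independent subsets of \<open>W\<close> are independent in \<open>V\<close>, hence of bounded size; a maximal one generates
  \<open>W\<close>.\<close>

lemma fin_dim_sub:
  assumes fd: fin_dim and W: "Module.submodule W K V"
  shows "vectorspace.fin_dim K (vs W)"
proof -
  interpret W: vectorspace K "vs W" by (rule vectorspace_sub[OF W])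
  have sub: "submodule K W V" using W by (simp add: subspace_iff[symmetric] subspace_def)
  have WV: "W \<subseteq> carrier V" using W by (simp add: left_module.submodule_iff[OF left_module])
  let ?P = "\<lambda>S. S \<subseteq> carrier (vs W) \<and> W.lin_indpt S"
  have "finite A \<and> card A \<le> dim" if "?P A" for A
    using that span_li_not_depend(2)[OF _ sub, of A] WV li_le_dim[OF fd, of A] by auto
  moreover have "?P {}" by (auto simp: W.lin_dep_def)
  ultimately obtain A where A: "finite A" "maximal A ?P"
    using maximal_exists[of ?P dim "{}"] by blast
  then have "W.gen_set A" by (intro W.max_li_is_gen)
  then show ?thesis using A by (auto simp: W.fin_dim_def maximal_def)
qed

lemma dim_sub_less:
  assumes fd: fin_dim and W: "Module.submodule W K V" and ne: "W \<noteq> carrier V"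
  shows "vectorspace.dim K (vs W) < dim"
proof (rule ccontr)
  assume ge: "\<not> vectorspace.dim K (vs W) < dim"
  interpret W: vectorspace K "vs W" by (rule vectorspace_sub[OF W])
  have sub: "submodule K W V" using W by (simp add: subspace_iff[symmetric] subspace_def)
  have WV: "W \<subseteq> carrier V" using W by (simp add: left_module.submodule_iff[OF left_module])
  obtain b where b: "finite b" "W.basis b"
    using W.finite_basis_exists fin_dim_sub[OF fd W] by blast
  have bW: "b \<subseteq> W" and li: "lin_indpt b"
    using b span_li_not_depend(2)[OF _ sub, of b] by (auto simp: W.basis_def)
  have "card b \<ge> dim" using ge W.dim_basis[OF b] by simp
  then have "basis b" using dim_li_is_basis fd b bW WV li by auto
  then have "span b = carrier V" by (simp add: basis_def)
  moreover have "span b \<subseteq> W" using span_is_subset[OF bW sub] .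
  ultimately show False using ne WV by blast
qed

lemma dim_sub_le:
  assumes fin_dim and "Module.submodule W K V"
  shows "vectorspace.dim K (vs W) \<le> dim"
  using dim_sub_less[OF assms] by (cases "W = carrier V") auto

lemma dim_zero_space: "vectorspace.dim K (vs {\<zero>\<^bsub>V\<^esub>}) = 0"
proof -
  interpret Z: vectorspace K "vs {\<zero>\<^bsub>V\<^esub>}"
    by (rule vectorspace_sub) (rule left_module.submodule_zero[OF left_module])
  have "Z.span {\<zero>\<^bsub>V\<^esub>} = {\<zero>\<^bsub>V\<^esub>}"
    using Z.span_is_subset2[of "{\<zero>\<^bsub>V\<^esub>}"] Z.in_own_span[of "{\<zero>\<^bsub>V\<^esub>}"] by auto
  then show ?thesis using Z.dim0I by simp
qed

lemma linear_mapI: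
  assumes "vectorspace K W" "T \<in> Homs K V W"
  shows "linear_map K V W T"
proof -
  interpret W: vectorspace K W by fact
  show ?thesis
    by unfold_locales (use assms(2) in \<open>auto simp: Homs_def\<close>)
qed

lemma rank_nullity_Homs:
  assumes "vectorspace K W" "T \<in> Homs K V W" fin_dim
  shows "vectorspace.dim K (W\<lparr>carrier := T ` carrier V\<rparr>)
    + vectorspace.dim K (V\<lparr>carrier := a_kernel V W T\<rparr>) = dim"
proof -
  interpret linear_map K V W T by (rule linear_mapI[OF assms(1,2)])
  have "a_kernel V W T = kerT" by (auto simp: a_kernel_def kernel_def ker_def)
  then show ?thesis using rank_nullity[OF assms(3)] by (simp add: im_def)
qed

lemma dim_eq_bij:
  assumes "vectorspace K W" "T \<in> Homs K V W" "bij_betw T (carrier V) (carrier W)" fin_dim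
  shows "vectorspace.dim K W = dim"
proof -
  interpret linear_map K V W T by (rule linear_mapI[OF assms(1,2)])
  show ?thesis using dim_eq assms(3,4) by (simp add: bij_betw_def)
qed

end

subsection \<open>Annihilators\<close>

lemma regular_module_simps [simp]:
  "carrier (regular_module R) = carrier R"
  "\<zero>\<^bsub>regular_module R\<^esub> = \<zero>\<^bsub>R\<^esub>"
  "x \<oplus>\<^bsub>regular_module R\<^esub> y = x \<oplus>\<^bsub>R\<^esub> y"
  "a \<odot>\<^bsub>regular_module R\<^esub> x = a \<otimes>\<^bsub>R\<^esub> x"
  by (simp_all add: regular_module_def)

lemma left_module_regular:
  assumes "ring R" shows "left_module R (regular_module R)"
proof -
  interpret ring R by fact
  show ?thesis
    by (rule left_moduleI)
      (auto simp: a_ac l_distr r_distr m_assoc intro!: bexI[of _ "\<ominus>\<^bsub>R\<^esub> _"] l_neg ring_axioms)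
qed

definition annihilator :: "('k, 'm) ring_scheme \<Rightarrow> ('k, 'v) module \<Rightarrow> 'v set \<Rightarrow> ('k, 'v \<Rightarrow> 'k) module" where
  "annihilator K V W =
    \<lparr>carrier = {\<phi> \<in> Homs K V (regular_module K). \<forall>w\<in>W. \<phi> w = \<zero>\<^bsub>K\<^esub>},
     monoid.mult = (\<lambda>\<phi> \<psi>. \<lambda>x\<in>carrier V. \<zero>\<^bsub>K\<^esub>), monoid.one = (\<lambda>x\<in>carrier V. \<zero>\<^bsub>K\<^esub>),
     ring.zero = (\<lambda>x\<in>carrier V. \<zero>\<^bsub>K\<^esub>),
     ring.add = (\<lambda>\<phi> \<psi>. \<lambda>x\<in>carrier V. \<phi> x \<oplus>\<^bsub>K\<^esub> \<psi> x),
     module.smult = (\<lambda>c \<phi>. \<lambda>x\<in>carrier V. c \<otimes>\<^bsub>K\<^esub> \<phi> x)\<rparr>"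

text \<open>Extend a basis of \<open>W\<close> by \<open>C\<close> to a basis of \<open>V\<close>. Sending \<open>v\<close> to the functional
  \<open>u \<mapsto> \<Sum>c\<in>C. v\<^sub>c u\<^sub>c\<close> is a map from \<open>V\<close> onto the annihilator of \<open>W\<close> with kernel \<open>W\<close>, so that
  the dimension formula is rank--nullity.\<close>

lemma (in vspace) annihilator_dim:
  assumes fd: fin_dim and W: "Module.submodule W K V"
  shows "vectorspace K (annihilator K V W) \<and> vectorspace.fin_dim K (annihilator K V W) \<and>
    vectorspace.dim K (annihilator K V W) + vectorspace.dim K (vs W) = dim"
proof -
  interpret V: left_module K V by (rule left_module)
  interpret W: vectorspace K "vs W" by (rule vectorspace_sub[OF W])
  have sub: "submodule K W V" using W by (simp add: subspace_iff[symmetric] subspace_def)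
  have WV: "W \<subseteq> carrier V" using W by (simp add: V.submodule_iff)
  obtain A where A: "finite A" "W.basis A"
    using W.finite_basis_exists fin_dim_sub[OF fd W] by blast
  have AW: "A \<subseteq> W" and li: "lin_indpt A" and spA: "span A = W"
    using A span_li_not_depend[OF _ sub, of A] by (auto simp: W.basis_def)
  obtain B0 where B0: "finite B0" "basis B0" using finite_basis_exists[OF fd] by blast
  have "A \<subseteq> span B0" using AW WV B0 by (auto simp: basis_def)
  then obtain C where C: "finite C" "C \<subseteq> carrier V" "C \<inter> A = {}"
      "int (card C) \<le> int (card B0) - int (card A)" "span (A \<union> C) = span B0"
    using replacement[OF A(1) B0(1) _ li] B0 by (auto simp: basis_def)
  define B where "B = A \<union> C"
  have finB: "finite B" and BV: "B \<subseteq> carrier V" using A C AW WV by (auto simp: B_def)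
  have "card B \<le> dim"
    using C(4) dim_basis[OF B0] card_Un_disjoint[OF A(1) C(1)] C(3)
    by (simp add: B_def Int_commute)
  then have basB: "basis B"
    using dim_gen_is_basis finB BV C(5) B0 by (auto simp: B_def basis_def)
  have ex1: "\<exists>!a. a \<in> B \<rightarrow>\<^sub>E carrier K \<and> lincomb a B = v" if "v \<in> carrier V" for v
    using basis_criterion[OF finB BV] basB that by blast
  \<comment> \<open>\<open>crd v b\<close> is the coordinate of \<open>v\<close> at the basis vector \<open>b\<close>.\<close>
  define crd where "crd v = (THE a. a \<in> B \<rightarrow>\<^sub>E carrier K \<and> lincomb a B = v)" for v
  have crd: "crd v \<in> B \<rightarrow>\<^sub>E carrier K" "lincomb (crd v) B = v" if "v \<in> carrier V" for v
    using theI'[OF ex1[OF that]] by (auto simp: crd_def)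
  have crdK: "crd v b \<in> carrier K" if "v \<in> carrier V" "b \<in> B" for v b
    using crd(1)[OF that(1)] that(2) by auto
  have crd_eq: "crd v b = a b" if "a \<in> B \<rightarrow> carrier K" "lincomb a B = v" "b \<in> B" for a v b
  proof -
    have v: "v \<in> carrier V" using that finB BV by auto
    have "lincomb (restrict a B) B = v"
      using that lincomb_restrict[OF BV, of "restrict a B" a] by auto
    then have "crd v = restrict a B"
      using ex1[OF v] crd[OF v] that(1) by (metis PiE_restrict restrict_PiE restrict_PiE_iff Pi_iff)
    then show ?thesis using that by simp
  qed
  have crd_add: "crd (v \<oplus>\<^bsub>V\<^esub> w) b = crd v b \<oplus>\<^bsub>K\<^esub> crd w b"
    if "v \<in> carrier V" "w \<in> carrier V" "b \<in> B" for v w b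
  proof (rule crd_eq)
    show "lincomb (\<lambda>b. crd v b \<oplus>\<^bsub>K\<^esub> crd w b) B = v \<oplus>\<^bsub>V\<^esub> w"
      using lincomb_sum[OF finB BV, of "crd v" "crd w"] crd that by auto
  qed (use that crdK in auto)
  have crd_smult: "crd (c \<odot>\<^bsub>V\<^esub> v) b = c \<otimes>\<^bsub>K\<^esub> crd v b"
    if "v \<in> carrier V" "c \<in> carrier K" "b \<in> B" for v c b
  proof (rule crd_eq)
    show "lincomb (\<lambda>b. c \<otimes>\<^bsub>K\<^esub> crd v b) B = c \<odot>\<^bsub>V\<^esub> v"
      using lincomb_smult[OF BV, of "crd v" c] crd that by auto
  qed (use that crdK in auto)
  have crd_W: "v \<in> W \<longleftrightarrow> (\<forall>c\<in>C. crd v c = \<zero>\<^bsub>K\<^esub>)" if v: "v \<in> carrier V" for v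
  proof
    assume "v \<in> W"
    then obtain a where a: "a \<in> A \<rightarrow> carrier K" "lincomb a A = v"
      using finite_in_span[OF A(1)] AW WV spA by blast
    let ?a = "\<lambda>b. if b \<in> A then a b else \<zero>\<^bsub>K\<^esub>"
    have "lincomb ?a B = lincomb ?a A"
      unfolding B_def using A C AW WV a by (intro lincomb_clean) auto
    also have "\<dots> = lincomb a A"
      using AW WV a by (intro lincomb_restrict) auto
    finally have "crd v c = ?a c" if "c \<in> C" for c
      using that a by (intro crd_eq) (auto simp: B_def)
    then show "\<forall>c\<in>C. crd v c = \<zero>\<^bsub>K\<^esub>" using C(3) by auto
  next
    assume 0: "\<forall>c\<in>C. crd v c = \<zero>\<^bsub>K\<^esub>"
    have "lincomb (crd v) B = lincomb (crd v) A"
      unfolding B_def using A C AW WV 0 crdK[OF v] by (intro lincomb_clean) (auto simp: B_def)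
    then have "v = lincomb (crd v) A" using crd[OF v] by simp
    moreover have "crd v \<in> A \<rightarrow> carrier K" using crdK[OF v] by (auto simp: B_def)
    ultimately have "v \<in> span A" unfolding span_def using A(1) by blast
    then show "v \<in> W" using spA by simp
  qed
  define \<phi> where "\<phi> v = (\<lambda>u\<in>carrier V. \<Oplus>\<^bsub>K\<^esub>c\<in>C. crd v c \<otimes>\<^bsub>K\<^esub> crd u c)" for v
  let ?D = "annihilator K V W"
  have CB: "c \<in> B" if "c \<in> C" for c using that by (auto simp: B_def)
  have phi_cong: "(\<Oplus>\<^bsub>K\<^esub>c\<in>C. f c) = (\<Oplus>\<^bsub>K\<^esub>c\<in>C. g c)"
    if "\<And>c. c \<in> C \<Longrightarrow> f c = g c" "\<And>c. c \<in> C \<Longrightarrow> g c \<in> carrier K" for f g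
    by (rule R.finsum_cong') (use that in auto)
  have phi_Homs: "\<phi> v \<in> carrier ?D" if v: "v \<in> carrier V" for v
  proof -
    have "\<phi> v \<in> Homs K V (regular_module K)"
      unfolding \<phi>_def
    proof (rule Homs_restrictI)
      fix x y assume xy: "x \<in> carrier V" "y \<in> carrier V"
      have "(\<Oplus>\<^bsub>K\<^esub>c\<in>C. crd v c \<otimes>\<^bsub>K\<^esub> crd (x \<oplus>\<^bsub>V\<^esub> y) c)
        = (\<Oplus>\<^bsub>K\<^esub>c\<in>C. crd v c \<otimes>\<^bsub>K\<^esub> crd x c \<oplus>\<^bsub>K\<^esub> crd v c \<otimes>\<^bsub>K\<^esub> crd y c)"
        by (rule phi_cong) (use v xy CB crdK in \<open>auto simp: crd_add R.r_distr\<close>)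
      then show "(\<Oplus>\<^bsub>K\<^esub>c\<in>C. crd v c \<otimes>\<^bsub>K\<^esub> crd (x \<oplus>\<^bsub>V\<^esub> y) c)
        = (\<Oplus>\<^bsub>K\<^esub>c\<in>C. crd v c \<otimes>\<^bsub>K\<^esub> crd x c) \<oplus>\<^bsub>regular_module K\<^esub> (\<Oplus>\<^bsub>K\<^esub>c\<in>C. crd v c \<otimes>\<^bsub>K\<^esub> crd y c)"
        using v xy CB crdK by (simp add: R.finsum_addf)
    next
      fix a x assume ax: "a \<in> carrier K" "x \<in> carrier V"
      have "(\<Oplus>\<^bsub>K\<^esub>c\<in>C. crd v c \<otimes>\<^bsub>K\<^esub> crd (a \<odot>\<^bsub>V\<^esub> x) c) = (\<Oplus>\<^bsub>K\<^esub>c\<in>C. a \<otimes>\<^bsub>K\<^esub> (crd v c \<otimes>\<^bsub>K\<^esub> crd x c))"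
        by (rule phi_cong) (use v ax CB crdK in \<open>auto simp: crd_smult R.m_lcomm\<close>)
      then show "(\<Oplus>\<^bsub>K\<^esub>c\<in>C. crd v c \<otimes>\<^bsub>K\<^esub> crd (a \<odot>\<^bsub>V\<^esub> x) c)
        = a \<odot>\<^bsub>regular_module K\<^esub> (\<Oplus>\<^bsub>K\<^esub>c\<in>C. crd v c \<otimes>\<^bsub>K\<^esub> crd x c)"
        using v ax CB crdK C(1) by (simp add: R.finsum_rdistr)
    qed (use v CB crdK left_module in \<open>auto intro!: R.finsum_closed\<close>)
    moreover have "\<phi> v w = \<zero>\<^bsub>K\<^esub>" if "w \<in> W" for w
    proof -
      have w: "w \<in> carrier V" using that WV by auto
      have "(\<Oplus>\<^bsub>K\<^esub>c\<in>C. crd v c \<otimes>\<^bsub>K\<^esub> crd w c) = (\<Oplus>\<^bsub>K\<^esub>c\<in>C. \<zero>\<^bsub>K\<^esub>)"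
        by (rule phi_cong) (use crd_W[OF w] that v CB crdK in auto)
      then show ?thesis using w by (simp add: \<phi>_def)
    qed
    ultimately show ?thesis by (simp add: annihilator_def)
  qed
  have surj: "\<exists>v\<in>carrier V. \<psi> = \<phi> v" if psi: "\<psi> \<in> carrier ?D" for \<psi>
  proof -
    have psiH: "\<psi> \<in> Homs K V (regular_module K)" and psi0: "\<And>w. w \<in> W \<Longrightarrow> \<psi> w = \<zero>\<^bsub>K\<^esub>"
      using psi by (auto simp: annihilator_def)
    \<comment> \<open>The coordinates of the preimage are the values of \<open>\<psi>\<close> on the basis.\<close>
    let ?v = "lincomb \<psi> B"
    have psiK: "\<psi> \<in> B \<rightarrow> carrier K" using BV Homs_closed[OF psiH] by auto
    have v: "?v \<in> carrier V" using BV psiK by auto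
    have "\<psi> u = \<phi> ?v u" if u: "u \<in> carrier V" for u
    proof -
      have "\<psi> u = \<psi> (lincomb (crd u) B)" using crd[OF u] by simp
      also have "\<dots> = (\<Oplus>\<^bsub>regular_module K\<^esub>b\<in>B. \<psi> (crd u b \<odot>\<^bsub>V\<^esub> b))"
        unfolding lincomb_def using BV crdK[OF u]
        by (intro Homs_finsum[OF left_module left_module_regular[OF R.ring_axioms] psiH]) auto
      also have "\<dots> = (\<Oplus>\<^bsub>K\<^esub>b\<in>B. \<psi> (crd u b \<odot>\<^bsub>V\<^esub> b))"
        by (simp add: finsum_def finprod_def regular_module_def)
      also have "\<dots> = (\<Oplus>\<^bsub>K\<^esub>b\<in>C. \<psi> (crd u b \<odot>\<^bsub>V\<^esub> b))"
      proof (rule R.add.finprod_mono_neutral_cong_right)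
        show "\<psi> (crd u b \<odot>\<^bsub>V\<^esub> b) = \<zero>\<^bsub>K\<^esub>" if "b \<in> B - C" for b
          using that psi0 AW W crdK[OF u] by (auto simp: B_def V.submodule_iff subset_iff)
        show "(\<lambda>b. \<psi> (crd u b \<odot>\<^bsub>V\<^esub> b)) \<in> B \<rightarrow> carrier K"
          using BV crdK[OF u] Homs_closed[OF psiH] by auto
      qed (use finB in \<open>auto simp: B_def\<close>)
      also have "\<dots> = (\<Oplus>\<^bsub>K\<^esub>b\<in>C. crd ?v b \<otimes>\<^bsub>K\<^esub> crd u b)"
      proof (rule phi_cong)
        fix c assume c: "c \<in> C"
        have "crd ?v c = \<psi> c" using c psiK CB by (intro crd_eq) auto
        then show "\<psi> (crd u c \<odot>\<^bsub>V\<^esub> c) = crd ?v c \<otimes>\<^bsub>K\<^esub> crd u c"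
          using c CB C(2) crdK[OF u] Homs_closed[OF psiH]
          by (simp add: Homs_smult[OF psiH] subset_iff R.m_comm)
      qed (use CB crdK u v in auto)
      finally show ?thesis using u by (simp add: \<phi>_def)
    qed
    then have "\<psi> = \<phi> ?v"
      using Homs_extensional[OF psiH] by (intro extensionalityI[of _ "carrier V"]) (auto simp: \<phi>_def)
    then show ?thesis using v by blast
  qed
  have phi_add: "\<phi> (x \<oplus>\<^bsub>V\<^esub> y) = \<phi> x \<oplus>\<^bsub>?D\<^esub> \<phi> y" if xy: "x \<in> carrier V" "y \<in> carrier V" for x y
  proof -
    have "(\<Oplus>\<^bsub>K\<^esub>c\<in>C. crd (x \<oplus>\<^bsub>V\<^esub> y) c \<otimes>\<^bsub>K\<^esub> crd u c) =
        (\<Oplus>\<^bsub>K\<^esub>c\<in>C. crd x c \<otimes>\<^bsub>K\<^esub> crd u c \<oplus>\<^bsub>K\<^esub> crd y c \<otimes>\<^bsub>K\<^esub> crd u c)" if u: "u \<in> carrier V" for u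
      by (rule phi_cong) (use u xy CB crdK in \<open>auto simp: crd_add R.l_distr\<close>)
    then show ?thesis using xy CB crdK
      by (auto simp: annihilator_def \<phi>_def R.finsum_addf intro!: restrict_ext)
  qed
  have phi_smult: "\<phi> (a \<odot>\<^bsub>V\<^esub> x) = a \<odot>\<^bsub>?D\<^esub> \<phi> x" if ax: "a \<in> carrier K" "x \<in> carrier V" for a x
  proof -
    have "(\<Oplus>\<^bsub>K\<^esub>c\<in>C. crd (a \<odot>\<^bsub>V\<^esub> x) c \<otimes>\<^bsub>K\<^esub> crd u c) =
        (\<Oplus>\<^bsub>K\<^esub>c\<in>C. a \<otimes>\<^bsub>K\<^esub> (crd x c \<otimes>\<^bsub>K\<^esub> crd u c))" if u: "u \<in> carrier V" for u
      by (rule phi_cong) (use u ax CB crdK in \<open>auto simp: crd_smult R.m_assoc\<close>)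
    then show ?thesis using ax CB crdK C(1)
      by (auto simp: annihilator_def \<phi>_def R.finsum_rdistr intro!: restrict_ext)
  qed
  have phi_zero: "\<phi> v = \<zero>\<^bsub>?D\<^esub> \<longleftrightarrow> v \<in> W" if v: "v \<in> carrier V" for v
  proof
    assume 0: "\<phi> v = \<zero>\<^bsub>?D\<^esub>"
    have "crd v c = \<zero>\<^bsub>K\<^esub>" if c: "c \<in> C" for c
    proof -
      have cV: "c \<in> carrier V" using c C by auto
      \<comment> \<open>\<open>\<phi> v\<close> takes the value \<open>crd v c\<close> at the basis vector \<open>c\<close>.\<close>
      let ?d = "\<lambda>b. if b = c then \<one>\<^bsub>K\<^esub> else \<zero>\<^bsub>K\<^esub>"
      have "lincomb ?d B = (\<Oplus>\<^bsub>V\<^esub>b\<in>B. if b = c then b else \<zero>\<^bsub>V\<^esub>)"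
        unfolding lincomb_def using BV by (intro M.finsum_cong') auto
      also have "\<dots> = c" using M.add.finprod_singleton_swap[of c B "\<lambda>b. b"] CB[OF c] finB BV by auto
      finally have d: "crd c b = ?d b" if "b \<in> B" for b
        using that by (intro crd_eq) auto
      have "\<zero>\<^bsub>K\<^esub> = \<phi> v c" using 0 cV by (simp add: annihilator_def)
      also have "\<dots> = (\<Oplus>\<^bsub>K\<^esub>b\<in>C. if b = c then crd v b else \<zero>\<^bsub>K\<^esub>)"
        unfolding \<phi>_def using cV d CB crdK[OF v] by (simp, intro phi_cong) auto
      also have "\<dots> = crd v c"
        using R.add.finprod_singleton_swap[of c C "crd v"] c CB C(1) crdK[OF v] by auto
      finally show ?thesis ..
    qed
    then show "v \<in> W" using crd_W[OF v] by blast
  next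
    assume "v \<in> W"
    then have "(\<Oplus>\<^bsub>K\<^esub>c\<in>C. crd v c \<otimes>\<^bsub>K\<^esub> crd u c) = (\<Oplus>\<^bsub>K\<^esub>c\<in>C. \<zero>\<^bsub>K\<^esub>)" if "u \<in> carrier V" for u
      by (intro phi_cong) (use crd_W[OF v] that CB crdK in auto)
    then show "\<phi> v = \<zero>\<^bsub>?D\<^esub>"
      by (auto simp: annihilator_def \<phi>_def intro!: restrict_ext)
  qed
  have im: "\<phi> ` carrier V = carrier ?D" using surj phi_Homs by blast
  have "left_module K ?D"
    by (rule left_module_image[OF left_module im _ phi_add phi_smult])
      (use phi_zero[OF M.zero_closed] W in \<open>auto simp: V.submodule_iff\<close>)
  then have D: "vectorspace K ?D" by (simp add: vectorspace_iff field.field_axioms)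
  let ?T = "restrict \<phi> (carrier V)"
  have T: "?T \<in> Homs K V ?D"
    using phi_Homs phi_add phi_smult left_module by (intro Homs_restrictI) auto
  have "a_kernel V ?D ?T = W"
    using phi_zero WV by (auto simp: a_kernel_def kernel_def)
  moreover have "?T ` carrier V = carrier ?D" using im by simp
  moreover have "?D\<lparr>carrier := carrier ?D\<rparr> = ?D" by simp
  moreover have "vectorspace.fin_dim K ?D"
    using linear_map.surj_fin_dim[OF linear_mapI[OF D T] fd] calculation(2) .
  ultimately show ?thesis using rank_nullity_Homs[OF D T fd] D by simp
qed

lemma annihilator_simps [simp]:
  "carrier (annihilator K V W) = {\<phi> \<in> Homs K V (regular_module K). \<forall>w\<in>W. \<phi> w = \<zero>\<^bsub>K\<^esub>}"
  "\<zero>\<^bsub>annihilator K V W\<^esub> = (\<lambda>x\<in>carrier V. \<zero>\<^bsub>K\<^esub>)"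
  "\<phi> \<oplus>\<^bsub>annihilator K V W\<^esub> \<psi> = (\<lambda>x\<in>carrier V. \<phi> x \<oplus>\<^bsub>K\<^esub> \<psi> x)"
  "c \<odot>\<^bsub>annihilator K V W\<^esub> \<phi> = (\<lambda>x\<in>carrier V. c \<otimes>\<^bsub>K\<^esub> \<phi> x)"
  by (simp_all add: annihilator_def)

subsection \<open>Eigenvalues\<close>

text \<open>
  A list \<open>[a\<^sub>0, \<dots>, a\<^sub>d]\<close> stands for the polynomial \<open>p = \<Sum>i. a\<^sub>i X\<^sup>i\<close>, and \<open>horner V T v\<close> evaluates
  it to the vector \<open>p(T) v\<close>.
\<close>

definition horner :: "('k, 'v) module \<Rightarrow> ('v \<Rightarrow> 'v) \<Rightarrow> 'v \<Rightarrow> 'k list \<Rightarrow> 'v" where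
  "horner V T v as = foldr (\<lambda>a w. T w \<oplus>\<^bsub>V\<^esub> a \<odot>\<^bsub>V\<^esub> v) as \<zero>\<^bsub>V\<^esub>"

lemma horner_simps [simp]:
  "horner V T v [] = \<zero>\<^bsub>V\<^esub>"
  "horner V T v (a # as) = T (horner V T v as) \<oplus>\<^bsub>V\<^esub> a \<odot>\<^bsub>V\<^esub> v"
  by (simp_all add: horner_def)

lemma set_map2_subset:
  assumes "set as \<subseteq> A" "set bs \<subseteq> B" "\<And>a b. \<lbrakk>a \<in> A; b \<in> B\<rbrakk> \<Longrightarrow> f a b \<in> C"
  shows "set (map2 f as bs) \<subseteq> C"
proof
  fix c assume "c \<in> set (map2 f as bs)"
  then obtain a b where ab: "(a, b) \<in> set (zip as bs)" "c = f a b" by auto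
  then show "c \<in> C" using set_zip_leftD[OF ab(1)] set_zip_rightD[OF ab(1)] assms by blast
qed

context vspace
begin

interpretation V: left_module K V by (rule left_module)

context
  fixes T v assumes T: "T \<in> Homs K V V" and v: "v \<in> carrier V"
begin

private lemmas T_simps = Homs_closed[OF T] Homs_add[OF T] Homs_smult[OF T]
  Homs_zero[OF left_module left_module T]

lemma horner_closed: "set as \<subseteq> carrier K \<Longrightarrow> horner V T v as \<in> carrier V"
  by (induction as) (auto simp: T_simps v)

lemma horner_zeros: "horner V T v (replicate n \<zero>\<^bsub>K\<^esub>) = \<zero>\<^bsub>V\<^esub>"
  by (induction n) (auto simp: T_simps v)

lemma horner_append_zero:
  "set as \<subseteq> carrier K \<Longrightarrow> horner V T v (as @ [\<zero>\<^bsub>K\<^esub>]) = horner V T v as"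
  by (induction as) (auto simp: T_simps v)

lemma horner_lincomb:
  assumes "length as = length bs" "set as \<subseteq> carrier K" "set bs \<subseteq> carrier K" "c \<in> carrier K"
  shows "horner V T v (map2 (\<lambda>a b. a \<oplus>\<^bsub>K\<^esub> c \<otimes>\<^bsub>K\<^esub> b) as bs)
    = horner V T v as \<oplus>\<^bsub>V\<^esub> c \<odot>\<^bsub>V\<^esub> horner V T v bs"
  using assms(1-3)
proof (induction rule: list_induct2)
  case (Cons a as b bs)
  have *: "horner V T v as \<in> carrier V" "horner V T v bs \<in> carrier V"
    using Cons.prems by (auto intro: horner_closed)
  show ?case
    using Cons * assms(4) v
    by (simp add: T_simps V.smult_l_distr V.smult_r_distr V.smult_assoc M.a_ac)
qed (use assms(4) in simp)

lemma submodule_horner: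
  "Module.submodule {horner V T v as |as. set as \<subseteq> carrier K \<and> length as = n} K V"
  (is "Module.submodule ?U K V")
  unfolding V.submodule_iff
proof (intro conjI ballI)
  show "?U \<subseteq> carrier V" using horner_closed by auto
  show zero: "\<zero>\<^bsub>V\<^esub> \<in> ?U"
    by (intro CollectI exI[of _ "replicate n \<zero>\<^bsub>K\<^esub>"]) (auto simp: horner_zeros)
  have lc: "x \<oplus>\<^bsub>V\<^esub> c \<odot>\<^bsub>V\<^esub> y \<in> ?U" if xy: "x \<in> ?U" "y \<in> ?U" and c: "c \<in> carrier K" for x y c
  proof -
    from xy obtain as bs where
      *: "x = horner V T v as" "set as \<subseteq> carrier K" "length as = n"
         "y = horner V T v bs" "set bs \<subseteq> carrier K" "length bs = n" by auto
    let ?cs = "map2 (\<lambda>a b. a \<oplus>\<^bsub>K\<^esub> c \<otimes>\<^bsub>K\<^esub> b) as bs"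
    have "set ?cs \<subseteq> carrier K"
      by (rule set_map2_subset[OF *(2) *(5)]) (use c in auto)
    moreover have "x \<oplus>\<^bsub>V\<^esub> c \<odot>\<^bsub>V\<^esub> y = horner V T v ?cs" "length ?cs = n"
      using * c horner_lincomb[of as bs c] by auto
    ultimately show ?thesis by blast
  qed
  show "x \<oplus>\<^bsub>V\<^esub> y \<in> ?U" if xy: "x \<in> ?U" "y \<in> ?U" for x y
    using lc[OF that, of "\<one>\<^bsub>K\<^esub>"] that horner_closed by auto
  show "c \<odot>\<^bsub>V\<^esub> x \<in> ?U" if cx: "c \<in> carrier K" "x \<in> ?U" for c x
    using lc[OF zero that(2,1)] that horner_closed by auto
qed

text \<open>If no nonzero polynomial annihilated \<open>v\<close>, the spaces \<open>{p(T) v | deg p < n}\<close> would grow forever.\<close>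

lemma annihilating_polynomial_exists:
  assumes fd: fin_dim
  shows "\<exists>as. as \<noteq> [] \<and> set as \<subseteq> carrier K \<and> last as \<noteq> \<zero>\<^bsub>K\<^esub> \<and> horner V T v as = \<zero>\<^bsub>V\<^esub>"
proof (rule ccontr)
  assume none: "\<not> ?thesis"
  define U where "U n = {horner V T v as |as. set as \<subseteq> carrier K \<and> length as = n}" for n
  have U: "Module.submodule (U n) K V" for n unfolding U_def by (rule submodule_horner)
  have ne: "U n \<noteq> U (Suc n)" for n
  proof
    assume eq: "U n = U (Suc n)"
    let ?m = "replicate n \<zero>\<^bsub>K\<^esub> @ [\<one>\<^bsub>K\<^esub>]"
    have m: "set ?m \<subseteq> carrier K" by auto
    then have "horner V T v ?m \<in> U (Suc n)"
      unfolding U_def by (intro CollectI exI[of _ ?m]) auto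
    then have "horner V T v ?m \<in> U n" unfolding eq .
    then obtain bs where bs: "horner V T v ?m = horner V T v bs" "set bs \<subseteq> carrier K" "length bs = n"
      unfolding U_def by blast
    let ?as = "map2 (\<lambda>a b. a \<oplus>\<^bsub>K\<^esub> \<ominus>\<^bsub>K\<^esub> \<one>\<^bsub>K\<^esub> \<otimes>\<^bsub>K\<^esub> b) ?m (bs @ [\<zero>\<^bsub>K\<^esub>])"
    have "horner V T v ?as = horner V T v ?m \<oplus>\<^bsub>V\<^esub> (\<ominus>\<^bsub>K\<^esub> \<one>\<^bsub>K\<^esub>) \<odot>\<^bsub>V\<^esub> horner V T v (bs @ [\<zero>\<^bsub>K\<^esub>])"
      using bs m by (intro horner_lincomb) auto
    also have "\<dots> = \<zero>\<^bsub>V\<^esub>"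
      using bs m horner_closed[of ?m] horner_closed[OF bs(2)]
      by (simp add: horner_append_zero V.neg_one_smult M.r_neg)
    finally have "horner V T v ?as = \<zero>\<^bsub>V\<^esub>" .
    moreover have "set ?as \<subseteq> carrier K"
      by (rule set_map2_subset[OF m, of _ "carrier K"]) (use bs in auto)
    moreover have "last ?as \<noteq> \<zero>\<^bsub>K\<^esub>" "?as \<noteq> []"
      using bs by (auto simp: last_map)
    ultimately show False using none by blast
  qed
  have sub: "U n \<subseteq> U (Suc n)" for n
  proof
    fix x assume "x \<in> U n"
    then obtain as where as: "x = horner V T v as" "set as \<subseteq> carrier K" "length as = n"
      by (auto simp: U_def)
    then show "x \<in> U (Suc n)"
      unfolding U_def by (intro CollectI exI[of _ "as @ [\<zero>\<^bsub>K\<^esub>]"]) (auto simp: horner_append_zero)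
  qed
  have ge: "n \<le> vectorspace.dim K (vs (U n))" for n
  proof (induction n)
    case (Suc n)
    interpret W: vspace K "vs (U (Suc n))" by (rule vspaceI[OF vectorspace_sub[OF U]])
    have "vectorspace.dim K (vs (U n)) < vectorspace.dim K (vs (U (Suc n)))"
      using W.dim_sub_less[OF fin_dim_sub[OF fd U], of "U n"] V.submodule_sub_iff[OF U] U sub ne by auto
    then show ?case using Suc by simp
  qed simp
  show False using ge[of "Suc dim"] dim_sub_le[OF fd U, of "Suc dim"] by simp
qed

text \<open>Division of \<open>p\<close> by \<open>X - l\<close>: the quotient \<open>q\<close> has the same leading coefficient, and
  \<open>p(T) v = (T - l) q(T) v + p(l) v\<close>.\<close>

lemma synthetic_division:
  assumes l: "l \<in> carrier K" and "as \<noteq> []" "set as \<subseteq> carrier K"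
  shows "\<exists>q. set q \<subseteq> carrier K \<and> length q = length as - 1 \<and> (q \<noteq> [] \<longrightarrow> last q = last as) \<and>
    horner V T v as = (T (horner V T v q) \<oplus>\<^bsub>V\<^esub> (\<ominus>\<^bsub>K\<^esub> l) \<odot>\<^bsub>V\<^esub> horner V T v q)
      \<oplus>\<^bsub>V\<^esub> ring.eval K (rev as) l \<odot>\<^bsub>V\<^esub> v"
  using assms(2,3)
proof (induction as)
  case (Cons a as)
  then have a: "a \<in> carrier K" and as: "set as \<subseteq> carrier K" by auto
  have ev: "R.eval (rev as) l \<in> carrier K"
    using as l by (intro R.eval_in_carrier) auto
  show ?case
  proof (cases "as = []")
    case True
    then show ?thesis using a v l by (intro exI[of _ "[]"]) (simp add: T_simps)
  next
    case False
    then obtain q where q: "set q \<subseteq> carrier K" "length q = length as - 1" "q \<noteq> [] \<longrightarrow> last q = last as"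
      and eq: "horner V T v as = (T (horner V T v q) \<oplus>\<^bsub>V\<^esub> (\<ominus>\<^bsub>K\<^esub> l) \<odot>\<^bsub>V\<^esub> horner V T v q)
        \<oplus>\<^bsub>V\<^esub> R.eval (rev as) l \<odot>\<^bsub>V\<^esub> v"
      using Cons.IH as by auto
    have hq: "horner V T v q \<in> carrier V" using horner_closed[OF q(1)] .
    let ?r = "R.eval (rev as) l"
    have "R.eval (rev (a # as)) l = ?r \<otimes>\<^bsub>K\<^esub> l \<oplus>\<^bsub>K\<^esub> a"
      using R.eval_append_aux[of "rev as" a l] as a l by auto
    moreover have "?r \<odot>\<^bsub>V\<^esub> T v = (\<ominus>\<^bsub>K\<^esub> l \<odot>\<^bsub>V\<^esub> (?r \<odot>\<^bsub>V\<^esub> v) \<oplus>\<^bsub>V\<^esub> (?r \<otimes>\<^bsub>K\<^esub> l) \<odot>\<^bsub>V\<^esub> v) \<oplus>\<^bsub>V\<^esub> ?r \<odot>\<^bsub>V\<^esub> T v"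
    proof -
      have "\<ominus>\<^bsub>K\<^esub> l \<odot>\<^bsub>V\<^esub> (?r \<odot>\<^bsub>V\<^esub> v) \<oplus>\<^bsub>V\<^esub> (?r \<otimes>\<^bsub>K\<^esub> l) \<odot>\<^bsub>V\<^esub> v
        = (\<ominus>\<^bsub>K\<^esub> l \<otimes>\<^bsub>K\<^esub> ?r \<oplus>\<^bsub>K\<^esub> ?r \<otimes>\<^bsub>K\<^esub> l) \<odot>\<^bsub>V\<^esub> v"
        using l ev v by (simp add: V.smult_l_distr V.smult_assoc)
      also have "\<dots> = \<zero>\<^bsub>V\<^esub>"
        using l ev v by (simp add: R.m_comm[of _ ?r] R.r_minus R.l_neg)
      finally show ?thesis using ev v by (simp add: T_simps)
    qed
    ultimately have "horner V T v (a # as) =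
      (T (horner V T v (?r # q)) \<oplus>\<^bsub>V\<^esub> (\<ominus>\<^bsub>K\<^esub> l) \<odot>\<^bsub>V\<^esub> horner V T v (?r # q))
        \<oplus>\<^bsub>V\<^esub> R.eval (rev (a # as)) l \<odot>\<^bsub>V\<^esub> v"
      using eq hq v a l ev
      by (simp add: T_simps V.smult_l_distr V.smult_r_distr M.a_ac)
    moreover have "last (?r # q) = last (a # as)"
    proof (cases "q = []")
      case True
      then obtain b where "as = [b]" using q(2) False by (cases as) auto
      then show ?thesis using True as l by simp
    qed (use q False in auto)
    ultimately show ?thesis using q ev False by (intro exI[of _ "?r # q"]) auto
  qed
qed simp

end

text \<open>A polynomial \<open>p\<close> of least degree with \<open>p(T) v = 0\<close> has a root \<open>l\<close>. Dividing it by \<open>X - l\<close> gives a \<open>q\<close>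
  with \<open>(T - l) q(T) v = 0\<close>, and \<open>q(T) v \<noteq> 0\<close> because \<open>q\<close> has smaller degree.\<close>

lemma eigenvector_exists:
  assumes ac: "algebraically_closed K" and fd: fin_dim and ne: "carrier V \<noteq> {\<zero>\<^bsub>V\<^esub>}"
    and T: "T \<in> Homs K V V"
  shows "\<exists>l\<in>carrier K. \<exists>w\<in>carrier V. w \<noteq> \<zero>\<^bsub>V\<^esub> \<and> T w = l \<odot>\<^bsub>V\<^esub> w"
proof -
  obtain v where v: "v \<in> carrier V" "v \<noteq> \<zero>\<^bsub>V\<^esub>" using ne M.zero_closed by blast
  let ?P = "\<lambda>as. as \<noteq> [] \<and> set as \<subseteq> carrier K \<and> last as \<noteq> \<zero>\<^bsub>K\<^esub> \<and> horner V T v as = \<zero>\<^bsub>V\<^esub>"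
  obtain as where as: "?P as" and min: "\<And>bs. ?P bs \<Longrightarrow> length as \<le> length bs"
    using exists_least_iff[of "\<lambda>n. \<exists>as. ?P as \<and> length as = n"]
      annihilating_polynomial_exists[OF T v(1) fd] by (metis not_le)
  have "length as \<noteq> 1"
  proof
    assume "length as = 1"
    then obtain a where a: "as = [a]" by (cases as) auto
    then have a': "a \<in> carrier K" "a \<noteq> \<zero>\<^bsub>K\<^esub>" "a \<odot>\<^bsub>V\<^esub> v = \<zero>\<^bsub>V\<^esub>"
      using as v by (auto simp: Homs_zero[OF left_module left_module T])
    then have "v = \<zero>\<^bsub>V\<^esub>" using mult_inverse[OF a'(1) v(1) _ a'(2)] by simp
    then show False using v by simp
  qed
  then have len: "length as \<ge> 2" using as by (cases as) (auto simp: Suc_le_eq)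
  let ?p = "rev as"
  have p: "?p \<in> carrier (poly_ring K)"
    using as by (auto simp: univ_poly_carrier[symmetric] polynomial_def hd_rev)
  then have "size (R.roots ?p) = length as - 1"
    using algebraically_closed.roots_over_carrier[OF ac p] by (simp add: R.splitted_def)
  then have "R.roots ?p \<noteq> {#}" using len by auto
  then obtain l where "l \<in># R.roots ?p" by blast
  then have l: "l \<in> carrier K" "R.eval ?p l = \<zero>\<^bsub>K\<^esub>"
    using domain.roots_mem_iff_is_root[OF field.axioms(1)[OF field_axioms] p] by (auto simp: R.is_root_def)
  obtain q where q: "set q \<subseteq> carrier K" "length q = length as - 1" "q \<noteq> [] \<longrightarrow> last q = last as"
    "horner V T v as = (T (horner V T v q) \<oplus>\<^bsub>V\<^esub> (\<ominus>\<^bsub>K\<^esub> l) \<odot>\<^bsub>V\<^esub> horner V T v q)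
      \<oplus>\<^bsub>V\<^esub> R.eval (rev as) l \<odot>\<^bsub>V\<^esub> v"
    using synthetic_division[OF T v(1) l(1), of as] as by blast
  let ?w = "horner V T v q"
  have w: "?w \<in> carrier V" using horner_closed[OF T v(1) q(1)] .
  have "\<zero>\<^bsub>V\<^esub> = T ?w \<oplus>\<^bsub>V\<^esub> (\<ominus>\<^bsub>K\<^esub> l) \<odot>\<^bsub>V\<^esub> ?w"
    using q(4) as l v w Homs_closed[OF T] by simp
  then have "T ?w = \<ominus>\<^bsub>V\<^esub> ((\<ominus>\<^bsub>K\<^esub> l) \<odot>\<^bsub>V\<^esub> ?w)"
    using w l Homs_closed[OF T w] by (intro M.minus_equality[symmetric]) (auto simp: M.a_comm)
  also have "\<dots> = l \<odot>\<^bsub>V\<^esub> ?w" using w l by (simp add: smult_l_minus)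
  finally have "T ?w = l \<odot>\<^bsub>V\<^esub> ?w" .
  moreover have "?w \<noteq> \<zero>\<^bsub>V\<^esub>"
  proof
    assume "?w = \<zero>\<^bsub>V\<^esub>"
    moreover have "q \<noteq> []" using q(2) len by auto
    ultimately have "?P q" using q as by auto
    then show False using min[of q] q(2) len by auto
  qed
  ultimately show ?thesis using w l by blast
qed

end

section \<open>Modules over a finite-dimensional algebra\<close>

subsection \<open>The action of the ground field\<close>

lemma underlying_space_simps [simp]:
  "carrier (underlying_space \<Lambda> M) = carrier M"
  "\<zero>\<^bsub>underlying_space \<Lambda> M\<^esub> = \<zero>\<^bsub>M\<^esub>"
  "x \<oplus>\<^bsub>underlying_space \<Lambda> M\<^esub> y = x \<oplus>\<^bsub>M\<^esub> y"
  "c \<odot>\<^bsub>underlying_space \<Lambda> M\<^esub> x = (c \<odot>\<^bsub>\<Lambda>\<^esub> \<one>\<^bsub>\<Lambda>\<^esub>) \<odot>\<^bsub>M\<^esub> x"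
  "underlying_space \<Lambda> (M\<lparr>carrier := N\<rparr>) = (underlying_space \<Lambda> M)\<lparr>carrier := N\<rparr>"
  by (simp_all add: underlying_space_def)

lemma hom_space_simps [simp]:
  "carrier (hom_space \<Lambda> M N) = Homs \<Lambda> M N"
  "\<zero>\<^bsub>hom_space \<Lambda> M N\<^esub> = (\<lambda>x\<in>carrier M. \<zero>\<^bsub>N\<^esub>)"
  "f \<oplus>\<^bsub>hom_space \<Lambda> M N\<^esub> g = (\<lambda>x\<in>carrier M. f x \<oplus>\<^bsub>N\<^esub> g x)"
  "c \<odot>\<^bsub>hom_space \<Lambda> M N\<^esub> f = (\<lambda>x\<in>carrier M. (c \<odot>\<^bsub>\<Lambda>\<^esub> \<one>\<^bsub>\<Lambda>\<^esub>) \<odot>\<^bsub>N\<^esub> f x)"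
  by (simp_all add: hom_space_def)

text \<open>Homomorphisms form an abelian group under pointwise addition. Which ring \<open>S\<close> acts on it depends
  on further structure of the target: the ground field on \<open>Hom(M, N)\<close>, the algebra on \<open>Hom(M, \<Lambda>)\<close>.\<close>

lemma left_module_Homs:
  assumes S: "ring S" and M: "left_module R M" and N: "left_module R N"
    and H: "carrier H = Homs R M N" "\<zero>\<^bsub>H\<^esub> = (\<lambda>x\<in>carrier M. \<zero>\<^bsub>N\<^esub>)"
      "\<And>f g. f \<oplus>\<^bsub>H\<^esub> g = (\<lambda>x\<in>carrier M. f x \<oplus>\<^bsub>N\<^esub> g x)"
      "\<And>s f. s \<odot>\<^bsub>H\<^esub> f = (\<lambda>x\<in>carrier M. act s (f x))"
    and act_closed: "\<And>s y. \<lbrakk>s \<in> carrier S; y \<in> carrier N\<rbrakk> \<Longrightarrow> act s y \<in> carrier N"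
    and act_add: "\<And>s y z. \<lbrakk>s \<in> carrier S; y \<in> carrier N; z \<in> carrier N\<rbrakk> \<Longrightarrow>
          act s (y \<oplus>\<^bsub>N\<^esub> z) = act s y \<oplus>\<^bsub>N\<^esub> act s z"
    and act_commute: "\<And>s r y. \<lbrakk>s \<in> carrier S; r \<in> carrier R; y \<in> carrier N\<rbrakk> \<Longrightarrow>
          act s (r \<odot>\<^bsub>N\<^esub> y) = r \<odot>\<^bsub>N\<^esub> act s y"
    and act_add_left: "\<And>s t y. \<lbrakk>s \<in> carrier S; t \<in> carrier S; y \<in> carrier N\<rbrakk> \<Longrightarrow>
          act (s \<oplus>\<^bsub>S\<^esub> t) y = act s y \<oplus>\<^bsub>N\<^esub> act t y"
    and act_mult: "\<And>s t y. \<lbrakk>s \<in> carrier S; t \<in> carrier S; y \<in> carrier N\<rbrakk> \<Longrightarrow>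
          act (s \<otimes>\<^bsub>S\<^esub> t) y = act s (act t y)"
    and act_one: "\<And>y. y \<in> carrier N \<Longrightarrow> act \<one>\<^bsub>S\<^esub> y = y"
  shows "left_module S H"
proof -
  interpret M: left_module R M by fact
  interpret N: left_module R N by fact
  interpret S: ring S by fact
  have add_closed: "f \<oplus>\<^bsub>H\<^esub> g \<in> carrier H" if "f \<in> carrier H" "g \<in> carrier H" for f g
    using that unfolding H
    by (intro Homs_restrictI) (auto simp: HomsD N.smult_r_distr N.M.a_ac M.left_module_axioms)
  have zero_closed: "\<zero>\<^bsub>H\<^esub> \<in> carrier H"
    unfolding H by (intro Homs_restrictI) (auto simp: M.left_module_axioms)
  have smult_closed: "s \<odot>\<^bsub>H\<^esub> f \<in> carrier H" if "s \<in> carrier S" "f \<in> carrier H" for s f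
    using that unfolding H
    by (intro Homs_restrictI) (auto simp: HomsD act_closed act_add act_commute M.left_module_axioms)
  have eqI: "f = g" if "f \<in> carrier H" "g \<in> carrier H" "\<And>x. x \<in> carrier M \<Longrightarrow> f x = g x" for f g
    using that Homs_eqI[of f R M N g] by (auto simp: H(1))
  have val: "f x \<in> carrier N" if "f \<in> carrier H" "x \<in> carrier M" for f x
    using that by (auto simp: H(1) Homs_closed)
  show ?thesis
  proof (rule left_moduleI)
    fix f assume f: "f \<in> carrier H"
    show "\<exists>g\<in>carrier H. g \<oplus>\<^bsub>H\<^esub> f = \<zero>\<^bsub>H\<^esub>"
    proof
      let ?g = "\<lambda>x\<in>carrier M. (\<ominus>\<^bsub>R\<^esub> \<one>\<^bsub>R\<^esub>) \<odot>\<^bsub>N\<^esub> f x"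
      show "?g \<oplus>\<^bsub>H\<^esub> f = \<zero>\<^bsub>H\<^esub>"
        unfolding H using val[OF f] by (auto simp: N.neg_one_smult N.M.l_neg intro!: restrict_ext)
      have "(\<lambda>x\<in>carrier M. \<ominus>\<^bsub>N\<^esub> f x) \<in> Homs R M N"
      proof (intro Homs_restrictI)
        fix r x assume rx: "r \<in> carrier R" "x \<in> carrier M"
        have fH: "f \<in> Homs R M N" using f by (simp add: H(1))
        show "\<ominus>\<^bsub>N\<^esub> f (r \<odot>\<^bsub>M\<^esub> x) = r \<odot>\<^bsub>N\<^esub> \<ominus>\<^bsub>N\<^esub> f x"
          using N.M.minus_equality[of "r \<odot>\<^bsub>N\<^esub> \<ominus>\<^bsub>N\<^esub> f x" "r \<odot>\<^bsub>N\<^esub> f x"] rx val[OF f]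
          by (simp add: Homs_smult[OF fH] N.smult_closed N.M.l_neg flip: N.smult_r_distr)
      qed (use f val[OF f] in \<open>auto simp: H(1) Homs_add M.left_module_axioms N.M.minus_add\<close>)
      moreover have "?g = (\<lambda>x\<in>carrier M. \<ominus>\<^bsub>N\<^esub> f x)"
        using val[OF f] by (auto simp: N.neg_one_smult intro!: restrict_ext)
      ultimately show "?g \<in> carrier H" by (simp add: H(1))
    qed
  next
    fix f assume f: "f \<in> carrier H"
    show "\<zero>\<^bsub>H\<^esub> \<oplus>\<^bsub>H\<^esub> f = f"
      by (rule eqI[OF add_closed[OF zero_closed f] f]) (simp add: H val[OF f])
    show "\<one>\<^bsub>S\<^esub> \<odot>\<^bsub>H\<^esub> f = f"
      by (rule eqI[OF smult_closed f]) (simp_all add: H(4) f val[OF f] act_one)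
    fix g assume g: "g \<in> carrier H"
    show "f \<oplus>\<^bsub>H\<^esub> g = g \<oplus>\<^bsub>H\<^esub> f"
      unfolding H using val[OF f] val[OF g] by (auto simp: N.M.a_comm intro!: restrict_ext)
    fix h assume h: "h \<in> carrier H"
    show "f \<oplus>\<^bsub>H\<^esub> g \<oplus>\<^bsub>H\<^esub> h = f \<oplus>\<^bsub>H\<^esub> (g \<oplus>\<^bsub>H\<^esub> h)"
      unfolding H using val[OF f] val[OF g] val[OF h] by (auto simp: N.M.a_assoc intro!: restrict_ext)
  next
    fix s f assume s: "s \<in> carrier S" and f: "f \<in> carrier H"
    fix g assume g: "g \<in> carrier H"
    show "s \<odot>\<^bsub>H\<^esub> (f \<oplus>\<^bsub>H\<^esub> g) = s \<odot>\<^bsub>H\<^esub> f \<oplus>\<^bsub>H\<^esub> s \<odot>\<^bsub>H\<^esub> g"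
      unfolding H using val[OF f] val[OF g] s by (auto simp: act_add intro!: restrict_ext)
  next
    fix s t f assume s: "s \<in> carrier S" and t: "t \<in> carrier S" and f: "f \<in> carrier H"
    show "(s \<oplus>\<^bsub>S\<^esub> t) \<odot>\<^bsub>H\<^esub> f = s \<odot>\<^bsub>H\<^esub> f \<oplus>\<^bsub>H\<^esub> t \<odot>\<^bsub>H\<^esub> f"
      unfolding H using val[OF f] s t by (auto simp: act_add_left intro!: restrict_ext)
    show "(s \<otimes>\<^bsub>S\<^esub> t) \<odot>\<^bsub>H\<^esub> f = s \<odot>\<^bsub>H\<^esub> (t \<odot>\<^bsub>H\<^esub> f)"
      unfolding H using val[OF f] s t by (auto simp: act_mult intro!: restrict_ext)
  qed (use add_closed zero_closed smult_closed S.ring_axioms in auto)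
qed

context fd_algebra
begin

abbreviation scalar :: "'k \<Rightarrow> 'a" where
  "scalar c \<equiv> c \<odot>\<^bsub>\<Lambda>\<^esub> \<one>\<^bsub>\<Lambda>\<^esub>"

lemma field_K: "field K" by (rule field_axioms)

lemma ring_K: "ring K" by (rule R.ring_axioms)

lemma scalar_mult:
  assumes "c \<in> carrier K" "d \<in> carrier K"
  shows "scalar (c \<otimes>\<^bsub>K\<^esub> d) = scalar c \<otimes>\<^bsub>\<Lambda>\<^esub> scalar d"
  using assms by (simp add: smult_mult_left smult_assoc1)

lemma scalar_mult_left: "\<lbrakk>c \<in> carrier K; a \<in> carrier \<Lambda>\<rbrakk> \<Longrightarrow> scalar c \<otimes>\<^bsub>\<Lambda>\<^esub> a = c \<odot>\<^bsub>\<Lambda>\<^esub> a"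
  by (simp add: smult_mult_left)

lemma scalar_central:
  assumes "c \<in> carrier K" "a \<in> carrier \<Lambda>" shows "scalar c \<otimes>\<^bsub>\<Lambda>\<^esub> a = a \<otimes>\<^bsub>\<Lambda>\<^esub> scalar c"
  using assms by (simp add: smult_mult_left smult_mult_right)

lemma scalar_commute:
  assumes "left_module \<Lambda> N" "c \<in> carrier K" "a \<in> carrier \<Lambda>" "y \<in> carrier N"
  shows "scalar c \<odot>\<^bsub>N\<^esub> (a \<odot>\<^bsub>N\<^esub> y) = a \<odot>\<^bsub>N\<^esub> (scalar c \<odot>\<^bsub>N\<^esub> y)"
proof -
  interpret N: left_module \<Lambda> N by fact
  show ?thesis using assms(2-4) by (simp flip: N.smult_assoc add: scalar_central)
qed

lemma left_module_underlying:
  assumes "left_module \<Lambda> M" shows "left_module K (underlying_space \<Lambda> M)"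
proof -
  interpret M: left_module \<Lambda> M by fact
  show ?thesis
  proof (rule left_moduleI)
    show "\<exists>y\<in>carrier (underlying_space \<Lambda> M). y \<oplus>\<^bsub>underlying_space \<Lambda> M\<^esub> x = \<zero>\<^bsub>underlying_space \<Lambda> M\<^esub>"
      if "x \<in> carrier (underlying_space \<Lambda> M)" for x
      using that by (auto intro!: bexI[of _ "\<ominus>\<^bsub>M\<^esub> x"] M.M.l_neg)
  qed (auto simp: ring_K M.M.a_ac M.smult_closed M.smult_l_distr M.smult_r_distr M.smult_one
      scalar_mult M.smult_assoc smult_l_distr)
qed

lemma left_module_hom_space:
  assumes M: "left_module \<Lambda> M" and N: "left_module \<Lambda> N"
  shows "left_module K (hom_space \<Lambda> M N)"
proof -
  interpret N: left_module \<Lambda> N by fact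
  show ?thesis
  proof (rule left_module_Homs[OF ring_K M N, where act = "\<lambda>c y. scalar c \<odot>\<^bsub>N\<^esub> y"])
    show "scalar c \<odot>\<^bsub>N\<^esub> (a \<odot>\<^bsub>N\<^esub> y) = a \<odot>\<^bsub>N\<^esub> (scalar c \<odot>\<^bsub>N\<^esub> y)"
      if "c \<in> carrier K" "a \<in> carrier \<Lambda>" "y \<in> carrier N" for c a y
      by (rule scalar_commute[OF N that])
  qed (auto simp: N.smult_closed N.smult_r_distr N.smult_l_distr N.smult_one scalar_mult N.smult_assoc
      smult_l_distr)
qed

lemma vspace_underlying: "left_module \<Lambda> M \<Longrightarrow> vspace K (underlying_space \<Lambda> M)"
  by (simp add: vspace_def vectorspace_iff left_module_underlying field_K)

lemma vspace_hom_space: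
  "\<lbrakk>left_module \<Lambda> M; left_module \<Lambda> N\<rbrakk> \<Longrightarrow> vspace K (hom_space \<Lambda> M N)"
  by (simp add: vspace_def vectorspace_iff left_module_hom_space field_K)

lemma Homs_underlying:
  assumes "f \<in> Homs \<Lambda> M N" shows "f \<in> Homs K (underlying_space \<Lambda> M) (underlying_space \<Lambda> N)"
  by (rule HomsI) (use HomsD[OF assms] in \<open>auto simp: PiE_def\<close>)

lemma submodule_underlying:
  assumes "left_module \<Lambda> M" "Module.submodule N \<Lambda> M"
  shows "Module.submodule N K (underlying_space \<Lambda> M)"
proof -
  interpret M: left_module \<Lambda> M by fact
  interpret U: left_module K "underlying_space \<Lambda> M" by (rule left_module_underlying) fact
  show ?thesis using assms(2) by (auto simp: M.submodule_iff U.submodule_iff)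
qed

subsection \<open>Dimension of a module\<close>

abbreviation kdim :: "('a, 'x) module \<Rightarrow> nat" where
  "kdim M \<equiv> vectorspace.dim K (underlying_space \<Lambda> M)"

text \<open>If \<open>B\<close> spans \<open>\<Lambda>\<close> and \<open>S\<close> generates \<open>M\<close>, then the products \<open>b x\<close> span \<open>M\<close>; conversely, a spanning
  set generates.\<close>

lemma fin_gen_iff_fin_dim:
  assumes M: "left_module \<Lambda> M"
  shows "fin_gen \<Lambda> M \<longleftrightarrow> vectorspace.fin_dim K (underlying_space \<Lambda> M)"
proof -
  interpret M: left_module \<Lambda> M by fact
  let ?U = "underlying_space \<Lambda> M"
  interpret U: vspace K ?U by (rule vspace_underlying[OF M])
  interpret UL: left_module K ?U by (rule left_module_underlying[OF M])
  have span_sub: "Module.submodule (U.span S) K ?U" if "S \<subseteq> carrier M" for S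
    using U.span_is_subspace[of S] that by (simp add: U.subspace_iff)
  have span_min: "U.span S \<subseteq> N" if "S \<subseteq> N" "Module.submodule N K ?U" for S N
    using U.span_is_subset[OF that(1)] that(2)
    by (simp add: U.subspace_iff[symmetric] subspace_def)
  show ?thesis
  proof
    assume "fin_gen \<Lambda> M"
    then obtain S where S: "finite S" "S \<subseteq> carrier M"
      and gen: "\<And>N. Module.submodule N \<Lambda> M \<Longrightarrow> S \<subseteq> N \<Longrightarrow> N = carrier M"
      by (auto simp: fin_gen_def)
    obtain B where B: "finite B" "B \<subseteq> carrier \<Lambda>" "span B = carrier \<Lambda>"
      using finite_dimensional by (auto simp: fin_dim_def)
    interpret A: vspace K \<Lambda> by (rule vspaceI[OF vectorspace_axioms])
    interpret AL: left_module K \<Lambda> by (rule A.left_module)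
    define T where "T = (\<lambda>(b, x). b \<odot>\<^bsub>M\<^esub> x) ` (B \<times> S)"
    have T: "finite T" "T \<subseteq> carrier M" using S B by (auto simp: T_def subset_iff intro!: M.smult_closed)
    let ?N = "U.span T"
    have N: "Module.submodule ?N K ?U" using span_sub[OF T(2)] .
    note N' = N[unfolded UL.submodule_iff, simplified]
    have aS: "a \<odot>\<^bsub>M\<^esub> x \<in> ?N" if a: "a \<in> carrier \<Lambda>" and x: "x \<in> S" for a x
    proof -
      let ?C = "{a \<in> carrier \<Lambda>. a \<odot>\<^bsub>M\<^esub> x \<in> ?N}"
      have x': "x \<in> carrier M" using x S by auto
      have "(c \<odot>\<^bsub>\<Lambda>\<^esub> a) \<odot>\<^bsub>M\<^esub> x = scalar c \<odot>\<^bsub>M\<^esub> (a \<odot>\<^bsub>M\<^esub> x)" if "c \<in> carrier K" "a \<in> carrier \<Lambda>" for c a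
        using that x' M.smult_assoc[of "scalar c" a x] by (simp add: scalar_mult_left)
      then have "Module.submodule ?C K \<Lambda>"
        unfolding AL.submodule_iff using N' x' by (auto simp: M.smult_l_distr)
      moreover have "B \<subseteq> ?C"
      proof
        fix b assume b: "b \<in> B"
        then have "b \<odot>\<^bsub>M\<^esub> x \<in> T" using x by (auto simp: T_def)
        then show "b \<in> ?C" using b B U.in_own_span[of T] T by auto
      qed
      ultimately have "span B \<subseteq> ?C"
        using span_is_subset[of B ?C] by (simp add: A.subspace_iff[symmetric] subspace_def)
      then show ?thesis using a B by auto
    qed
    have act: "a \<odot>\<^bsub>M\<^esub> y \<in> ?N" if a: "a \<in> carrier \<Lambda>" and y: "y \<in> ?N" for a y
    proof -
      let ?C = "{y \<in> carrier M. a \<odot>\<^bsub>M\<^esub> y \<in> ?N}"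
      have "Module.submodule ?C K ?U"
        unfolding UL.submodule_iff
        using N' a by (auto simp: M.smult_r_distr M.smult_closed scalar_commute[OF M, symmetric])
      moreover have "T \<subseteq> ?C"
      proof
        fix t assume "t \<in> T"
        then obtain b x where t: "t = b \<odot>\<^bsub>M\<^esub> x" "b \<in> B" "x \<in> S" by (auto simp: T_def)
        then have "b \<in> carrier \<Lambda>" "x \<in> carrier M" using B S by auto
        then show "t \<in> ?C" using t a aS[of "a \<otimes>\<^bsub>\<Lambda>\<^esub> b" x] by (simp add: M.smult_assoc M.smult_closed)
      qed
      ultimately show ?thesis using span_min[of T ?C] y by auto
    qed
    have "Module.submodule ?N \<Lambda> M" unfolding M.submodule_iff using N' act by auto
    moreover have "S \<subseteq> ?N"
      using aS[of "\<one>\<^bsub>\<Lambda>\<^esub>"] S by (auto simp: M.smult_one subset_iff)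
    ultimately have "?N = carrier M" by (rule gen)
    then show "U.fin_dim" using T by (auto simp: U.fin_dim_def)
  next
    assume "U.fin_dim"
    then obtain S where S: "finite S" "S \<subseteq> carrier M" "U.span S = carrier M"
      by (auto simp: U.fin_dim_def)
    have "N = carrier M" if "Module.submodule N \<Lambda> M" "S \<subseteq> N" for N
      using span_min[OF that(2) submodule_underlying[OF M that(1)]] S that(1)
      by (auto simp: M.submodule_iff)
    then show "fin_gen \<Lambda> M" using S unfolding fin_gen_def by blast
  qed
qed

lemma fin_gen_sub:
  assumes M: "left_module \<Lambda> M" "fin_gen \<Lambda> M" and N: "Module.submodule N \<Lambda> M"
  shows "fin_gen \<Lambda> (M\<lparr>carrier := N\<rparr>)"
proof -
  interpret M: left_module \<Lambda> M by fact
  interpret U: vspace K "underlying_space \<Lambda> M" by (rule vspace_underlying[OF M(1)])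
  show ?thesis
    using U.fin_dim_sub submodule_underlying[OF M(1) N] M fin_gen_iff_fin_dim
      fin_gen_iff_fin_dim[OF M.left_module_sub[OF N]] by auto
qed

lemma kdim_sub_less:
  assumes M: "left_module \<Lambda> M" "fin_gen \<Lambda> M" and N: "Module.submodule N \<Lambda> M" "N \<noteq> carrier M"
  shows "kdim (M\<lparr>carrier := N\<rparr>) < kdim M"
proof -
  interpret U: vspace K "underlying_space \<Lambda> M" by (rule vspace_underlying[OF M(1)])
  show ?thesis
    using U.dim_sub_less submodule_underlying[OF M(1) N(1)] M fin_gen_iff_fin_dim N(2) by auto
qed

lemma kdim_sub_less':
  assumes M: "left_module \<Lambda> M" "fin_gen \<Lambda> M"
    and N: "Module.submodule N \<Lambda> M" and U: "Module.submodule U \<Lambda> M" and "N \<subset> U"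
  shows "kdim (M\<lparr>carrier := N\<rparr>) < kdim (M\<lparr>carrier := U\<rparr>)"
proof -
  interpret M: left_module \<Lambda> M by fact
  show ?thesis
    using kdim_sub_less[OF M.left_module_sub[OF U] fin_gen_sub[OF M U], of N]
      M.submodule_sub_iff[OF U] N assms(5) by auto
qed

lemma kdim_zero:
  assumes "left_module \<Lambda> M" shows "kdim (M\<lparr>carrier := {\<zero>\<^bsub>M\<^esub>}\<rparr>) = 0"
  using vspace.dim_zero_space[OF vspace_underlying[OF assms]] by simp

lemma kdim_eq_zeroD:
  assumes M: "left_module \<Lambda> M" "fin_gen \<Lambda> M" and "kdim M = 0"
  shows "carrier M = {\<zero>\<^bsub>M\<^esub>}"
  using kdim_sub_less[OF M left_module.submodule_zero[OF M(1)]] assms(3) by auto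

lemma kdim_rank_nullity:
  assumes M: "left_module \<Lambda> M" "fin_gen \<Lambda> M" and N: "left_module \<Lambda> N" and f: "f \<in> Homs \<Lambda> M N"
  shows "kdim (N\<lparr>carrier := f ` carrier M\<rparr>) + kdim (M\<lparr>carrier := a_kernel M N f\<rparr>) = kdim M"
proof -
  interpret U: vspace K "underlying_space \<Lambda> M" by (rule vspace_underlying[OF M(1)])
  interpret V: vspace K "underlying_space \<Lambda> N" by (rule vspace_underlying[OF N])
  have "a_kernel (underlying_space \<Lambda> M) (underlying_space \<Lambda> N) f = a_kernel M N f"
    by (simp add: a_kernel_def kernel_def)
  then show ?thesis
    using U.rank_nullity_Homs[OF V.vectorspace_axioms Homs_underlying[OF f]] M(2)
      fin_gen_iff_fin_dim[OF M(1)] by simp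
qed

lemma fin_gen_image:
  assumes M: "left_module \<Lambda> M" "fin_gen \<Lambda> M" and N: "left_module \<Lambda> N" and f: "f \<in> Homs \<Lambda> M N"
    and surj: "f ` carrier M = carrier N"
  shows "fin_gen \<Lambda> N"
proof -
  obtain S where S: "finite S" "S \<subseteq> carrier M"
    "\<And>U. Module.submodule U \<Lambda> M \<Longrightarrow> S \<subseteq> U \<Longrightarrow> U = carrier M"
    using M(2) by (auto simp: fin_gen_def)
  have "V = carrier N" if V: "Module.submodule V \<Lambda> N" "f ` S \<subseteq> V" for V
  proof -
    have "S \<subseteq> {x \<in> carrier M. f x \<in> V}" using S(2) V(2) by blast
    then have "{x \<in> carrier M. f x \<in> V} = carrier M"
      by (rule S(3)[OF submodule_vimage[OF M(1) N f V(1)]])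
    then have "f ` carrier M \<subseteq> V" by auto
    then show ?thesis using surj V(1) left_module.submodule_iff[OF N] by auto
  qed
  moreover have "finite (f ` S)" "f ` S \<subseteq> carrier N" using S(1,2) surj by auto
  ultimately show ?thesis unfolding fin_gen_def by blast
qed

lemma bij_of_surj:
  assumes M: "left_module \<Lambda> M" "fin_gen \<Lambda> M" and N: "left_module \<Lambda> N" and f: "f \<in> Homs \<Lambda> M N"
    and surj: "f ` carrier M = carrier N" and le: "kdim M \<le> kdim N"
  shows "bij_betw f (carrier M) (carrier N)"
proof -
  interpret M: left_module \<Lambda> M by fact
  have k: "Module.submodule (a_kernel M N f) \<Lambda> M" by (rule submodule_kernel[OF M(1) N f])
  have "kdim (M\<lparr>carrier := a_kernel M N f\<rparr>) = 0"
    using kdim_rank_nullity[OF M N f] surj le by simp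
  then have "a_kernel M N f = {\<zero>\<^bsub>M\<^esub>}"
    using kdim_eq_zeroD[OF M.left_module_sub[OF k] fin_gen_sub[OF M k]] by simp
  then show ?thesis using inj_on_iff_kernel[OF M(1) N f] surj by (simp add: bij_betw_def)
qed

lemma surj_of_inj:
  assumes M: "left_module \<Lambda> M" "fin_gen \<Lambda> M" and f: "f \<in> Homs \<Lambda> M M" and "inj_on f (carrier M)"
  shows "f ` carrier M = carrier M"
proof (rule ccontr)
  assume ne: "f ` carrier M \<noteq> carrier M"
  have "kdim (M\<lparr>carrier := f ` carrier M\<rparr>) = kdim M"
    using kdim_rank_nullity[OF M M(1) f] inj_on_iff_kernel[OF M(1,1) f] assms(4) kdim_zero[OF M(1)]
    by simp
  then show False
    using kdim_sub_less[OF M submodule_image[OF M(1,1) f left_module.submodule_carrier[OF M(1)]] ne]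
    by simp
qed

end

section \<open>Projective modules and dual bases\<close>

text \<open>The functionals \<open>g\<^sub>i\<close> are coordinates with respect to the generators \<open>b\<^sub>i\<close>, not necessarily unique
  ones. A module has a dual basis iff it is finitely generated and projective; in this form projectivity
  refers to no other module, so that it gives lifts between modules on arbitrary carrier types.\<close>

definition dual_basis ::
  "('a, 'r) ring_scheme \<Rightarrow> ('a, 'p) module \<Rightarrow> nat \<Rightarrow> (nat \<Rightarrow> 'p) \<Rightarrow> (nat \<Rightarrow> 'p \<Rightarrow> 'a) \<Rightarrow> bool" where
  "dual_basis R P m b g \<longleftrightarrow>
    (\<forall>i<m. b i \<in> carrier P \<and> g i \<in> Homs R P (regular_module R)) \<and>
    (\<forall>x\<in>carrier P. x = (\<Oplus>\<^bsub>P\<^esub>i\<in>{..<m}. g i x \<odot>\<^bsub>P\<^esub> b i))"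

lemma dual_basisD:
  assumes "dual_basis R P m b g"
  shows "i < m \<Longrightarrow> b i \<in> carrier P" "i < m \<Longrightarrow> g i \<in> Homs R P (regular_module R)"
    "x \<in> carrier P \<Longrightarrow> (\<Oplus>\<^bsub>P\<^esub>i\<in>{..<m}. g i x \<odot>\<^bsub>P\<^esub> b i) = x"
  using assms by (auto simp: dual_basis_def)

lemma Homs_finsum_smult:
  fixes m :: nat
  assumes P: "left_module R P" and M: "left_module R M"
    and g: "\<And>i. i < m \<Longrightarrow> g i \<in> Homs R P (regular_module R)"
    and y: "\<And>i. i < m \<Longrightarrow> y i \<in> carrier M"
  shows "(\<lambda>x\<in>carrier P. \<Oplus>\<^bsub>M\<^esub>i\<in>{..<m}. g i x \<odot>\<^bsub>M\<^esub> y i) \<in> Homs R P M"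
proof -
  interpret P: left_module R P by fact
  interpret M: left_module R M by fact
  have gx: "g i x \<in> carrier R" if "i < m" "x \<in> carrier P" for i x
    using Homs_closed[OF g] that by auto
  have c: "g i x \<odot>\<^bsub>M\<^esub> y i \<in> carrier M" if "i < m" "x \<in> carrier P" for i x
    using gx[OF that] y[OF that(1)] by (rule M.smult_closed)
  show ?thesis
  proof (rule Homs_restrictI)
    fix x x' assume x: "x \<in> carrier P" "x' \<in> carrier P"
    have "(\<Oplus>\<^bsub>M\<^esub>i\<in>{..<m}. g i (x \<oplus>\<^bsub>P\<^esub> x') \<odot>\<^bsub>M\<^esub> y i)
      = (\<Oplus>\<^bsub>M\<^esub>i\<in>{..<m}. g i x \<odot>\<^bsub>M\<^esub> y i \<oplus>\<^bsub>M\<^esub> g i x' \<odot>\<^bsub>M\<^esub> y i)"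
      by (rule M.M.finsum_cong')
        (use x g y gx c in \<open>auto simp: Homs_add[OF g] M.smult_l_distr\<close>)
    then show "(\<Oplus>\<^bsub>M\<^esub>i\<in>{..<m}. g i (x \<oplus>\<^bsub>P\<^esub> x') \<odot>\<^bsub>M\<^esub> y i)
      = (\<Oplus>\<^bsub>M\<^esub>i\<in>{..<m}. g i x \<odot>\<^bsub>M\<^esub> y i) \<oplus>\<^bsub>M\<^esub> (\<Oplus>\<^bsub>M\<^esub>i\<in>{..<m}. g i x' \<odot>\<^bsub>M\<^esub> y i)"
      using x c by (simp add: M.M.finsum_addf)
  next
    fix a x assume ax: "a \<in> carrier R" "x \<in> carrier P"
    have "(\<Oplus>\<^bsub>M\<^esub>i\<in>{..<m}. g i (a \<odot>\<^bsub>P\<^esub> x) \<odot>\<^bsub>M\<^esub> y i)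
      = (\<Oplus>\<^bsub>M\<^esub>i\<in>{..<m}. a \<odot>\<^bsub>M\<^esub> (g i x \<odot>\<^bsub>M\<^esub> y i))"
      by (rule M.M.finsum_cong')
        (use ax y gx c in \<open>auto simp: Homs_smult[OF g] M.smult_assoc M.smult_closed\<close>)
    also have "\<dots> = a \<odot>\<^bsub>M\<^esub> (\<Oplus>\<^bsub>M\<^esub>i\<in>{..<m}. g i x \<odot>\<^bsub>M\<^esub> y i)"
      using M.finsum_smult[of a "{..<m}" "\<lambda>i. g i x \<odot>\<^bsub>M\<^esub> y i"] ax c by auto
    finally show "(\<Oplus>\<^bsub>M\<^esub>i\<in>{..<m}. g i (a \<odot>\<^bsub>P\<^esub> x) \<odot>\<^bsub>M\<^esub> y i)
      = a \<odot>\<^bsub>M\<^esub> (\<Oplus>\<^bsub>M\<^esub>i\<in>{..<m}. g i x \<odot>\<^bsub>M\<^esub> y i)" .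
  qed (use c P in \<open>auto intro!: M.M.finsum_closed\<close>)
qed

text \<open>Choose preimages \<open>y\<^sub>i\<close> of the \<open>f(b\<^sub>i)\<close> under \<open>q\<close> and send \<open>x\<close> to \<open>\<Sum>i. g\<^sub>i(x) y\<^sub>i\<close>.\<close>

lemma dual_basis_lift:
  assumes P: "left_module R P" and M: "left_module R M" and N: "left_module R N"
    and db: "dual_basis R P m b g"
    and q: "q \<in> Homs R M N" and surj: "q ` carrier M = carrier N" and f: "f \<in> Homs R P N"
  shows "\<exists>h\<in>Homs R P M. \<forall>x\<in>carrier P. q (h x) = f x"
proof -
  interpret P: left_module R P by fact
  interpret M: left_module R M by fact
  interpret N: left_module R N by fact
  note b = dual_basisD(1)[OF db] and g = dual_basisD(2)[OF db]
  have "\<exists>y. \<forall>i<m. y i \<in> carrier M \<and> q (y i) = f (b i)"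
  proof -
    have "\<forall>i. \<exists>z. i < m \<longrightarrow> z \<in> carrier M \<and> q z = f (b i)"
      using surj Homs_closed[OF f b] by (metis imageE)
    then show ?thesis by metis
  qed
  then obtain y where y: "\<And>i. i < m \<Longrightarrow> y i \<in> carrier M" "\<And>i. i < m \<Longrightarrow> q (y i) = f (b i)"
    by blast
  have gx: "g i x \<in> carrier R" if "i < m" "x \<in> carrier P" for i x
    using Homs_closed[OF g] that by auto
  let ?h = "\<lambda>x\<in>carrier P. \<Oplus>\<^bsub>M\<^esub>i\<in>{..<m}. g i x \<odot>\<^bsub>M\<^esub> y i"
  have "q (?h x) = f x" if x: "x \<in> carrier P" for x
  proof -
    have "q (?h x) = (\<Oplus>\<^bsub>N\<^esub>i\<in>{..<m}. q (g i x \<odot>\<^bsub>M\<^esub> y i))"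
      using x gx y by (simp, subst Homs_finsum[OF M N q]) (auto simp: M.smult_closed)
    also have "\<dots> = (\<Oplus>\<^bsub>N\<^esub>i\<in>{..<m}. f (g i x \<odot>\<^bsub>P\<^esub> b i))"
      by (rule N.M.finsum_cong')
        (use x gx y b in \<open>auto simp: Homs_smult[OF q] Homs_smult[OF f] Homs_closed[OF f] N.smult_closed\<close>)
    also have "\<dots> = f (\<Oplus>\<^bsub>P\<^esub>i\<in>{..<m}. g i x \<odot>\<^bsub>P\<^esub> b i)"
      using x gx b by (subst Homs_finsum[OF P N f]) (auto simp: P.smult_closed)
    finally show ?thesis using dual_basisD(3)[OF db x] by simp
  qed
  then show ?thesis using Homs_finsum_smult[OF P M g y(1)] by (intro bexI[of _ ?h]) auto
qed

lemma dual_basis_retract: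
  assumes P: "left_module R P" and Q: "left_module R Q" and db: "dual_basis R P m b g"
    and s: "s \<in> Homs R Q P" and r: "r \<in> Homs R P Q" and rs: "\<And>x. x \<in> carrier Q \<Longrightarrow> r (s x) = x"
  shows "dual_basis R Q m (\<lambda>i. r (b i)) (\<lambda>i. compose (carrier Q) (g i) s)"
  unfolding dual_basis_def
proof (intro conjI allI impI ballI)
  interpret P: left_module R P by fact
  interpret Q: left_module R Q by fact
  note b = dual_basisD(1)[OF db] and g = dual_basisD(2)[OF db]
  show "r (b i) \<in> carrier Q" if "i < m" for i using Homs_closed[OF r b] that by auto
  show "compose (carrier Q) (g i) s \<in> Homs R Q (regular_module R)" if "i < m" for i
    using Homs_compose[OF Q s g[OF that]] .
  fix x assume x: "x \<in> carrier Q"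
  have gx: "g i (s x) \<in> carrier R" if "i < m" for i
    using Homs_closed[OF g[OF that], of "s x"] Homs_closed[OF s x] by simp
  have "x = r (\<Oplus>\<^bsub>P\<^esub>i\<in>{..<m}. g i (s x) \<odot>\<^bsub>P\<^esub> b i)"
    using rs[OF x] dual_basisD(3)[OF db Homs_closed[OF s x]] by simp
  also have "\<dots> = (\<Oplus>\<^bsub>Q\<^esub>i\<in>{..<m}. r (g i (s x) \<odot>\<^bsub>P\<^esub> b i))"
    using gx b by (subst Homs_finsum[OF P Q r]) (auto simp: P.smult_closed)
  also have "\<dots> = (\<Oplus>\<^bsub>Q\<^esub>i\<in>{..<m}. compose (carrier Q) (g i) s x \<odot>\<^bsub>Q\<^esub> r (b i))"
    by (rule Q.M.finsum_cong')
      (use x gx b in \<open>auto simp: Homs_smult[OF r] compose_def Homs_closed[OF r] Q.smult_closed\<close>)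
  finally show "x = (\<Oplus>\<^bsub>Q\<^esub>i\<in>{..<m}. compose (carrier Q) (g i) s x \<odot>\<^bsub>Q\<^esub> r (b i))" .
qed

lemma dual_basis_fin_gen:
  fixes \<Lambda> :: "('k, 'a) module"
  assumes P: "left_module \<Lambda> P" and db: "dual_basis \<Lambda> P m b g"
  shows "fin_gen \<Lambda> P"
proof -
  interpret P: left_module \<Lambda> P by fact
  have "N = carrier P" if N: "Module.submodule N \<Lambda> P" "b ` {..<m} \<subseteq> N" for N
  proof -
    have "x \<in> N" if x: "x \<in> carrier P" for x
    proof -
      have "(\<Oplus>\<^bsub>P\<^esub>i\<in>{..<m}. g i x \<odot>\<^bsub>P\<^esub> b i) \<in> N"
        by (rule P.finsum_in_submodule[OF N(1)])
          (use N Homs_closed[OF dual_basisD(2)[OF db] x] in \<open>auto simp: P.submodule_iff\<close>)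
      then show ?thesis using dual_basisD(3)[OF db x] by simp
    qed
    then show ?thesis using N by (auto simp: P.submodule_iff)
  qed
  moreover have "finite (b ` {..<m})" "b ` {..<m} \<subseteq> carrier P" using dual_basisD(1)[OF db] by auto
  ultimately show ?thesis unfolding fin_gen_def by blast
qed

lemma fg_projI:
  assumes P: "left_module \<Lambda> P" and db: "dual_basis \<Lambda> P m b g"
  shows "P \<in> fg_proj \<Lambda>"
proof -
  have "projective \<Lambda> P"
    unfolding projective_def
    by (intro allI impI, elim conjE, rule dual_basis_lift[OF P _ _ db])
  then show ?thesis using dual_basis_fin_gen[OF P db] P by (simp add: fg_proj_def)
qed

subsection \<open>Free modules\<close>

definition free_module :: "('a, 'r) ring_scheme \<Rightarrow> nat \<Rightarrow> ('a, nat \<Rightarrow> 'a) module" where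
  "free_module R m =
    \<lparr>carrier = {..<m} \<rightarrow>\<^sub>E carrier R,
     monoid.mult = (\<lambda>x y. \<lambda>i\<in>{..<m}. \<zero>\<^bsub>R\<^esub>), monoid.one = (\<lambda>i\<in>{..<m}. \<zero>\<^bsub>R\<^esub>),
     ring.zero = (\<lambda>i\<in>{..<m}. \<zero>\<^bsub>R\<^esub>), ring.add = (\<lambda>x y. \<lambda>i\<in>{..<m}. x i \<oplus>\<^bsub>R\<^esub> y i),
     module.smult = (\<lambda>a x. \<lambda>i\<in>{..<m}. a \<otimes>\<^bsub>R\<^esub> x i)\<rparr>"

lemma free_module_simps [simp]:
  "carrier (free_module R m) = {..<m} \<rightarrow>\<^sub>E carrier R"
  "\<zero>\<^bsub>free_module R m\<^esub> = (\<lambda>i\<in>{..<m}. \<zero>\<^bsub>R\<^esub>)"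
  "x \<oplus>\<^bsub>free_module R m\<^esub> y = (\<lambda>i\<in>{..<m}. x i \<oplus>\<^bsub>R\<^esub> y i)"
  "a \<odot>\<^bsub>free_module R m\<^esub> x = (\<lambda>i\<in>{..<m}. a \<otimes>\<^bsub>R\<^esub> x i)"
  by (simp_all add: free_module_def)

lemma left_module_free:
  assumes "ring R" shows "left_module R (free_module R m)"
proof -
  interpret ring R by fact
  have PiE_eqI: "x = y" if "x \<in> {..<m} \<rightarrow>\<^sub>E carrier R" "y \<in> {..<m} \<rightarrow>\<^sub>E carrier R"
    "\<And>i. i < m \<Longrightarrow> x i = y i" for x y :: "nat \<Rightarrow> 'a"
    using that by (intro PiE_ext) auto
  show ?thesis
  proof (rule left_moduleI)
    fix x assume x: "x \<in> carrier (free_module R m)"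
    then have xi: "x i \<in> carrier R" if "i < m" for i using that by auto
    show "\<exists>y\<in>carrier (free_module R m). y \<oplus>\<^bsub>free_module R m\<^esub> x = \<zero>\<^bsub>free_module R m\<^esub>"
      using xi by (intro bexI[of _ "\<lambda>i\<in>{..<m}. \<ominus>\<^bsub>R\<^esub> x i"]) (auto simp: l_neg intro!: restrict_ext)
    show "\<zero>\<^bsub>free_module R m\<^esub> \<oplus>\<^bsub>free_module R m\<^esub> x = x"
      by (rule PiE_eqI) (use x xi in auto)
    show "\<one>\<^bsub>R\<^esub> \<odot>\<^bsub>free_module R m\<^esub> x = x"
      by (rule PiE_eqI) (use x xi in auto)
  qed (auto simp: ring_axioms a_ac l_distr r_distr m_assoc PiE_iff intro!: restrict_ext)
qed

lemma free_module_proj: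
  assumes "ring R" "i < m"
  shows "(\<lambda>x\<in>carrier (free_module R m). x i) \<in> Homs R (free_module R m) (regular_module R)"
  by (rule Homs_restrictI[OF _ _ _ left_module_free[OF assms(1)]]) (use assms(2) in auto)

lemma dual_basis_free:
  assumes R: "ring R"
  shows "dual_basis R (free_module R m) m (\<lambda>j. \<lambda>i\<in>{..<m}. if i = j then \<one>\<^bsub>R\<^esub> else \<zero>\<^bsub>R\<^esub>)
    (\<lambda>i. \<lambda>x\<in>carrier (free_module R m). x i)"
  unfolding dual_basis_def
proof (intro conjI allI impI ballI)
  interpret ring R by fact
  let ?F = "free_module R m"
  let ?e = "\<lambda>j. \<lambda>i\<in>{..<m}. if i = j then \<one>\<^bsub>R\<^esub> else \<zero>\<^bsub>R\<^esub>"
  have F: "left_module R ?F" by (rule left_module_free[OF R])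
  interpret F: left_module R ?F by (rule F)
  have reg: "left_module R (regular_module R)" by (rule left_module_regular[OF R])
  show e: "?e j \<in> carrier ?F" for j by auto
  show "(\<lambda>x\<in>carrier ?F. x i) \<in> Homs R ?F (regular_module R)" if "i < m" for i
    by (rule free_module_proj[OF R that])
  fix x assume x: "x \<in> carrier ?F"
  then have xi: "x i \<in> carrier R" if "i < m" for i using that by auto
  let ?s = "\<Oplus>\<^bsub>?F\<^esub>i\<in>{..<m}. (\<lambda>x\<in>carrier ?F. x i) x \<odot>\<^bsub>?F\<^esub> ?e i"
  have summand: "(\<lambda>x\<in>carrier ?F. x i) x \<odot>\<^bsub>?F\<^esub> ?e i \<in> carrier ?F" if "i < m" for i
    using x xi that by auto
  have s: "?s \<in> carrier ?F"
    using summand by (intro F.M.finsum_closed) auto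
  have "?s j = x j" if j: "j < m" for j
  proof -
    have "?s j = (\<lambda>x\<in>carrier ?F. x j) ?s" using s by simp
    also have "\<dots> = (\<Oplus>\<^bsub>regular_module R\<^esub>i\<in>{..<m}. (\<lambda>x\<in>carrier ?F. x j)
        ((\<lambda>x\<in>carrier ?F. x i) x \<odot>\<^bsub>?F\<^esub> ?e i))"
      using summand by (intro Homs_finsum[OF F reg free_module_proj[OF R j]]) auto
    also have "\<dots> = (\<Oplus>\<^bsub>R\<^esub>i\<in>{..<m}. (\<lambda>x\<in>carrier ?F. x j)
        ((\<lambda>x\<in>carrier ?F. x i) x \<odot>\<^bsub>?F\<^esub> ?e i))"
      by (simp add: finsum_def finprod_def regular_module_def)
    also have "\<dots> = (\<Oplus>\<^bsub>R\<^esub>i\<in>{..<m}. if j = i then x i else \<zero>\<^bsub>R\<^esub>)"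
    proof (rule finsum_cong')
      fix i assume "i \<in> {..<m}"
      then show "(\<lambda>x\<in>carrier ?F. x j) ((\<lambda>x\<in>carrier ?F. x i) x \<odot>\<^bsub>?F\<^esub> ?e i)
        = (if j = i then x i else \<zero>\<^bsub>R\<^esub>)"
        using summand[of i] x xi[of i] j by (auto simp: PiE_iff)
    qed (use xi in auto)
    also have "\<dots> = x j" using add.finprod_singleton[of j "{..<m}" x] j xi by auto
    finally show ?thesis .
  qed
  then show "x = ?s" using x s by (intro PiE_ext[of x "{..<m}" _ ?s]) auto
qed

lemma fin_gen_free_cover:
  fixes \<Lambda> :: "('k, 'a) module"
  assumes M: "left_module \<Lambda> M" "fin_gen \<Lambda> M"
  shows "\<exists>m. \<exists>F\<in>Homs \<Lambda> (free_module \<Lambda> m) M. F ` carrier (free_module \<Lambda> m) = carrier M"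
proof -
  interpret M: left_module \<Lambda> M by fact
  obtain S where S: "finite S" "S \<subseteq> carrier M"
    and gen: "\<And>N. Module.submodule N \<Lambda> M \<Longrightarrow> S \<subseteq> N \<Longrightarrow> N = carrier M"
    using M(2) by (auto simp: fin_gen_def)
  obtain s where s: "bij_betw s {0..<card S} S" using ex_bij_betw_nat_finite[OF S(1)] by blast
  let ?m = "card S"
  let ?L = "free_module \<Lambda> ?m"
  have sM: "s i \<in> carrier M" if "i < ?m" for i using s S that by (auto simp: bij_betw_def)
  have L: "left_module \<Lambda> ?L" by (rule left_module_free[OF M.R.ring_axioms])
  let ?F = "\<lambda>x\<in>carrier ?L. \<Oplus>\<^bsub>M\<^esub>i\<in>{..<?m}. (\<lambda>x\<in>carrier ?L. x i) x \<odot>\<^bsub>M\<^esub> s i"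
  have F: "?F \<in> Homs \<Lambda> ?L M"
    by (rule Homs_finsum_smult[OF L M(1) free_module_proj[OF M.R.ring_axioms] sM])
  have "S \<subseteq> ?F ` carrier ?L"
  proof
    fix y assume "y \<in> S"
    then have "y \<in> s ` {0..<?m}" using s by (simp add: bij_betw_def)
    then obtain j where j: "j < ?m" "y = s j" by auto
    let ?e = "\<lambda>i\<in>{..<?m}. if i = j then \<one>\<^bsub>\<Lambda>\<^esub> else \<zero>\<^bsub>\<Lambda>\<^esub>"
    have e: "?e \<in> carrier ?L" by auto
    have "?F ?e = (\<Oplus>\<^bsub>M\<^esub>i\<in>{..<?m}. ?e i \<odot>\<^bsub>M\<^esub> s i)" using e by simp
    also have "\<dots> = (\<Oplus>\<^bsub>M\<^esub>i\<in>{..<?m}. if j = i then s i else \<zero>\<^bsub>M\<^esub>)"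
      by (rule M.M.finsum_cong') (use sM in \<open>auto simp: M.smult_one\<close>)
    also have "\<dots> = y" using M.M.add.finprod_singleton[of j "{..<?m}" s] j sM by auto
    finally show "y \<in> ?F ` carrier ?L" by (rule image_eqI[OF sym e])
  qed
  then have "?F ` carrier ?L = carrier M"
    by (intro gen submodule_image[OF L M(1) F] left_module.submodule_carrier[OF L])
  then show ?thesis using F by blast
qed

text \<open>Split a surjection from a free module onto \<open>P\<close> and transport the standard basis.\<close>

lemma fg_proj_dual_basis:
  assumes "P \<in> fg_proj \<Lambda>" shows "\<exists>m b g. dual_basis \<Lambda> P m b g"
proof -
  have P: "left_module \<Lambda> P" "fin_gen \<Lambda> P" and proj: "projective \<Lambda> P"
    using assms by (auto simp: fg_proj_def)
  interpret P: left_module \<Lambda> P by fact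
  obtain m F where F: "F \<in> Homs \<Lambda> (free_module \<Lambda> m) P" "F ` carrier (free_module \<Lambda> m) = carrier P"
    using fin_gen_free_cover[OF P] by blast
  have L: "left_module \<Lambda> (free_module \<Lambda> m)" by (rule left_module_free[OF P.R.ring_axioms])
  obtain h where h: "h \<in> Homs \<Lambda> P (free_module \<Lambda> m)" "\<forall>x\<in>carrier P. F (h x) = (\<lambda>x\<in>carrier P. x) x"
    using proj[unfolded projective_def] L P(1) F Homs_id[OF P(1)] by blast
  show ?thesis
    using dual_basis_retract[OF L P(1) dual_basis_free[OF P.R.ring_axioms] h(1) F(1)] h(2) by auto
qed

lemma fg_projD:
  assumes "P \<in> fg_proj \<Lambda>" shows "left_module \<Lambda> P" "fin_gen \<Lambda> P"
  using assms by (auto simp: fg_proj_def)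

lemma fg_proj_lift:
  assumes P: "P \<in> fg_proj \<Lambda>" and M: "left_module \<Lambda> M" and N: "left_module \<Lambda> N"
    and q: "q \<in> Homs \<Lambda> M N" and surj: "q ` carrier M = carrier N" and f: "f \<in> Homs \<Lambda> P N"
  obtains h where "h \<in> Homs \<Lambda> P M" "\<And>x. x \<in> carrier P \<Longrightarrow> q (h x) = f x"
proof -
  obtain m b g where "dual_basis \<Lambda> P m b g" using fg_proj_dual_basis[OF P] by blast
  from dual_basis_lift[OF fg_projD(1)[OF P] M N this q surj f] show thesis using that by blast
qed

subsection \<open>Direct summands\<close>

lemma (in left_module) direct_decomposition_unique:
  assumes U: "Module.submodule U R M" and V: "Module.submodule V R M" and UV: "U \<inter> V = {\<zero>\<^bsub>M\<^esub>}"
    and "u \<in> U" "u' \<in> U" "v \<in> V" "v' \<in> V" "u \<oplus>\<^bsub>M\<^esub> v = u' \<oplus>\<^bsub>M\<^esub> v'"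
  shows "u = u'" "v = v'"
proof -
  have c: "u \<in> carrier M" "u' \<in> carrier M" "v \<in> carrier M" "v' \<in> carrier M"
    using assms by (auto simp: submodule_iff)
  have "u = (u \<oplus>\<^bsub>M\<^esub> v) \<oplus>\<^bsub>M\<^esub> \<ominus>\<^bsub>M\<^esub> v" using c by (simp add: M.a_assoc M.r_neg)
  also have "\<dots> = (v' \<ominus>\<^bsub>M\<^esub> v) \<oplus>\<^bsub>M\<^esub> u'"
    unfolding assms(8) using c by (simp add: a_minus_def M.a_ac)
  finally have "u \<ominus>\<^bsub>M\<^esub> u' = ((v' \<ominus>\<^bsub>M\<^esub> v) \<oplus>\<^bsub>M\<^esub> u') \<ominus>\<^bsub>M\<^esub> u'" by simp
  also have "\<dots> = v' \<ominus>\<^bsub>M\<^esub> v"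
    using c M.minus_closed[of v' v] by (simp add: a_minus_def[of _ _ u'] M.a_assoc M.r_neg)
  finally have "u \<ominus>\<^bsub>M\<^esub> u' = v' \<ominus>\<^bsub>M\<^esub> v" .
  then have "u \<ominus>\<^bsub>M\<^esub> u' \<in> U \<inter> V"
    using submodule_minus[OF U assms(4,5)] submodule_minus[OF V assms(7,6)] by simp
  then show "u = u'" using UV c by simp
  then show "v = v'" using assms(8) c by simp
qed

lemma (in left_module) direct_projection:
  assumes U: "Module.submodule U R M" and V: "Module.submodule V R M"
    and sum: "U <+>\<^bsub>M\<^esub> V = carrier M" and UV: "U \<inter> V = {\<zero>\<^bsub>M\<^esub>}"
  obtains \<pi> where "\<pi> \<in> Homs R M (M\<lparr>carrier := U\<rparr>)"
    "\<And>u v. \<lbrakk>u \<in> U; v \<in> V\<rbrakk> \<Longrightarrow> \<pi> (u \<oplus>\<^bsub>M\<^esub> v) = u"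
proof -
  define \<pi> where "\<pi> = (\<lambda>x\<in>carrier M. THE u. u \<in> U \<and> (\<exists>v\<in>V. x = u \<oplus>\<^bsub>M\<^esub> v))"
  have UM: "U \<subseteq> carrier M" and VM: "V \<subseteq> carrier M" using U V by (auto simp: submodule_iff)
  have \<pi>: "\<pi> (u \<oplus>\<^bsub>M\<^esub> v) = u" if uv: "u \<in> U" "v \<in> V" for u v
  proof -
    have "u \<oplus>\<^bsub>M\<^esub> v \<in> carrier M" using uv UM VM by auto
    moreover have "(THE u'. u' \<in> U \<and> (\<exists>v'\<in>V. u \<oplus>\<^bsub>M\<^esub> v = u' \<oplus>\<^bsub>M\<^esub> v')) = u"
    proof (rule the_equality)
      fix u' assume "u' \<in> U \<and> (\<exists>v'\<in>V. u \<oplus>\<^bsub>M\<^esub> v = u' \<oplus>\<^bsub>M\<^esub> v')"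
      then obtain v' where "u' \<in> U" "v' \<in> V" "u \<oplus>\<^bsub>M\<^esub> v = u' \<oplus>\<^bsub>M\<^esub> v'" by blast
      then show "u' = u" using direct_decomposition_unique(1)[OF U V UV] uv by metis
    qed (use uv in blast)
    ultimately show ?thesis by (simp add: \<pi>_def)
  qed
  have dec: "\<exists>u\<in>U. \<exists>v\<in>V. x = u \<oplus>\<^bsub>M\<^esub> v" if "x \<in> carrier M" for x
    using that sum set_add_iff by blast
  note U' = U[unfolded submodule_iff] and V' = V[unfolded submodule_iff]
  have "\<pi> \<in> Homs R M (M\<lparr>carrier := U\<rparr>)"
  proof (rule HomsI)
    show "\<pi> \<in> carrier M \<rightarrow>\<^sub>E carrier (M\<lparr>carrier := U\<rparr>)"
    proof (rule PiE_I)
      fix x assume "x \<in> carrier M"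
      then obtain u v where "u \<in> U" "v \<in> V" "x = u \<oplus>\<^bsub>M\<^esub> v" using dec by blast
      then show "\<pi> x \<in> carrier (M\<lparr>carrier := U\<rparr>)" using \<pi> by simp
    qed (simp add: \<pi>_def)
  next
    fix x y assume "x \<in> carrier M" "y \<in> carrier M"
    then obtain u v u' v' where *: "u \<in> U" "v \<in> V" "x = u \<oplus>\<^bsub>M\<^esub> v" "u' \<in> U" "v' \<in> V" "y = u' \<oplus>\<^bsub>M\<^esub> v'"
      using dec by metis
    then have "x \<oplus>\<^bsub>M\<^esub> y = (u \<oplus>\<^bsub>M\<^esub> u') \<oplus>\<^bsub>M\<^esub> (v \<oplus>\<^bsub>M\<^esub> v')"
      using UM VM by (simp add: M.a_ac subset_iff)
    moreover have "\<pi> ((u \<oplus>\<^bsub>M\<^esub> u') \<oplus>\<^bsub>M\<^esub> (v \<oplus>\<^bsub>M\<^esub> v')) = u \<oplus>\<^bsub>M\<^esub> u'"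
      using * U' V' by (intro \<pi>) auto
    ultimately show "\<pi> (x \<oplus>\<^bsub>M\<^esub> y) = \<pi> x \<oplus>\<^bsub>M\<lparr>carrier := U\<rparr>\<^esub> \<pi> y"
      using * \<pi> by simp
  next
    fix a x assume a: "a \<in> carrier R" and "x \<in> carrier M"
    then obtain u v where *: "u \<in> U" "v \<in> V" "x = u \<oplus>\<^bsub>M\<^esub> v" using dec by metis
    then have "a \<odot>\<^bsub>M\<^esub> x = a \<odot>\<^bsub>M\<^esub> u \<oplus>\<^bsub>M\<^esub> a \<odot>\<^bsub>M\<^esub> v"
      using UM VM a by (simp add: smult_r_distr subset_iff)
    moreover have "\<pi> (a \<odot>\<^bsub>M\<^esub> u \<oplus>\<^bsub>M\<^esub> a \<odot>\<^bsub>M\<^esub> v) = a \<odot>\<^bsub>M\<^esub> u"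
      using * U' V' a by (intro \<pi>) auto
    ultimately show "\<pi> (a \<odot>\<^bsub>M\<^esub> x) = a \<odot>\<^bsub>M\<lparr>carrier := U\<rparr>\<^esub> \<pi> x"
      using * \<pi> by simp
  qed
  then show thesis using \<pi> that by blast
qed

lemma fg_proj_summand:
  assumes P: "P \<in> fg_proj \<Lambda>" and U: "Module.submodule U \<Lambda> P" and V: "Module.submodule V \<Lambda> P"
    and sum: "U <+>\<^bsub>P\<^esub> V = carrier P" and UV: "U \<inter> V = {\<zero>\<^bsub>P\<^esub>}"
  shows "P\<lparr>carrier := U\<rparr> \<in> fg_proj \<Lambda>"
proof -
  interpret P: left_module \<Lambda> P by (rule fg_projD(1)[OF P])
  obtain m b g where db: "dual_basis \<Lambda> P m b g" using fg_proj_dual_basis[OF P] by blast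
  obtain \<pi> where \<pi>: "\<pi> \<in> Homs \<Lambda> P (P\<lparr>carrier := U\<rparr>)"
    "\<And>u v. \<lbrakk>u \<in> U; v \<in> V\<rbrakk> \<Longrightarrow> \<pi> (u \<oplus>\<^bsub>P\<^esub> v) = u"
    using P.direct_projection[OF U V sum UV] by blast
  let ?U = "P\<lparr>carrier := U\<rparr>"
  have lU: "left_module \<Lambda> ?U" by (rule P.left_module_sub[OF U])
  have inc: "(\<lambda>x\<in>carrier ?U. x) \<in> Homs \<Lambda> ?U P"
    using Homs_sub_codomain[OF Homs_id[OF lU]] U by (simp add: P.submodule_iff)
  have "\<pi> u = u" if "u \<in> U" for u
    using \<pi>(2)[OF that, of "\<zero>\<^bsub>P\<^esub>"] that U V by (auto simp: P.submodule_iff subset_iff)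
  then show ?thesis
    using dual_basis_retract[OF P.left_module_axioms lU db inc \<pi>(1)] by (intro fg_projI[OF lU]) auto
qed

subsection \<open>Fitting's lemma and projective covers\<close>

context fd_algebra
begin

text \<open>Fitting's lemma for a set \<open>H\<close> of endomorphisms that is closed under squaring: a member with an image
  of least dimension is bijective on its image, since squaring it cannot shrink the image. In the
  applications \<open>H\<close> consists of the lifts of a given map, so that the splitting respects that map.\<close>

lemma fitting:
  assumes M: "left_module \<Lambda> M" "fin_gen \<Lambda> M"
    and H: "H \<subseteq> Homs \<Lambda> M M" "H \<noteq> {}" "\<And>h. h \<in> H \<Longrightarrow> compose (carrier M) h h \<in> H"
  obtains h where "h \<in> H" "h ` carrier M <+>\<^bsub>M\<^esub> a_kernel M M h = carrier M"
    "h ` carrier M \<inter> a_kernel M M h = {\<zero>\<^bsub>M\<^esub>}"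
proof -
  interpret M: left_module \<Lambda> M by fact
  let ?d = "\<lambda>h. kdim (M\<lparr>carrier := h ` carrier M\<rparr>)"
  obtain h where h: "h \<in> H" and min: "\<And>h'. h' \<in> H \<Longrightarrow> ?d h \<le> ?d h'"
    using H(2) ex_has_least_nat[of "\<lambda>h. h \<in> H" _ ?d] by blast
  have hH: "h \<in> Homs \<Lambda> M M" using h H by blast
  let ?I = "h ` carrier M"
  have I: "Module.submodule ?I \<Lambda> M" by (rule submodule_image[OF M(1,1) hH M.submodule_carrier])
  have IM: "?I \<subseteq> carrier M" using I by (simp add: M.submodule_iff)
  have hI: "Module.submodule (h ` ?I) \<Lambda> M" by (rule submodule_image[OF M(1,1) hH I])
  have "compose (carrier M) h h ` carrier M = h ` ?I" by (simp add: compose_def image_image)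
  then have "?d h \<le> kdim (M\<lparr>carrier := h ` ?I\<rparr>)" using min[OF H(3)[OF h]] by simp
  moreover have "h ` ?I \<subseteq> ?I" using IM by auto
  ultimately have eq: "h ` ?I = ?I" using kdim_sub_less'[OF M hI I] by fastforce
  have "x \<in> ?I <+>\<^bsub>M\<^esub> a_kernel M M h" if x: "x \<in> carrier M" for x
  proof -
    obtain y where y: "y \<in> ?I" "h x = h y" using eq x by (metis imageE image_eqI)
    then have yM: "y \<in> carrier M" using IM by auto
    have "x \<ominus>\<^bsub>M\<^esub> y \<in> a_kernel M M h"
      using x y yM Homs_closed[OF hH] by (simp add: a_kernel_iff[OF M(1,1) hH] Homs_minus[OF M(1,1) hH])
    moreover have "x = y \<oplus>\<^bsub>M\<^esub> (x \<ominus>\<^bsub>M\<^esub> y)"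
      using x yM by (simp add: a_minus_def M.M.a_comm[of x] M.M.r_neg2)
    ultimately show ?thesis using y(1) unfolding M.set_add_iff by blast
  qed
  moreover have K: "Module.submodule (a_kernel M M h) \<Lambda> M" by (rule submodule_kernel[OF M(1,1) hH])
  ultimately have sum: "?I <+>\<^bsub>M\<^esub> a_kernel M M h = carrier M"
    using M.submodule_set_add[OF I K] by (auto simp: M.submodule_iff)
  let ?MI = "M\<lparr>carrier := ?I\<rparr>"
  have lI: "left_module \<Lambda> ?MI" by (rule M.left_module_sub[OF I])
  have "restrict h ?I \<in> Homs \<Lambda> ?MI ?MI"
    using Homs_corestrict[OF lI M(1) Homs_restrict[OF M(1,1) hH I], of ?I] eq by simp
  then have "bij_betw (restrict h ?I) ?I ?I"
    using bij_of_surj[OF lI fin_gen_sub[OF M I] lI, of "restrict h ?I"] eq by simp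
  then have inj: "inj_on h ?I" by (simp add: bij_betw_def inj_on_def)
  have zI: "\<zero>\<^bsub>M\<^esub> \<in> ?I" using I by (simp add: M.submodule_iff)
  have "x = \<zero>\<^bsub>M\<^esub>" if "x \<in> ?I \<inter> a_kernel M M h" for x
    using that inj zI Homs_zero[OF M(1,1) hH] by (auto simp: a_kernel_iff[OF M(1,1) hH] inj_on_def)
  moreover have "\<zero>\<^bsub>M\<^esub> \<in> ?I \<inter> a_kernel M M h"
    using zI K by (simp add: M.submodule_iff)
  ultimately show thesis using that[OF h sum] by blast
qed

text \<open>A projective module of least dimension that maps onto \<open>M\<close> is a projective cover. Otherwise
  \<open>ker p + U = P\<close> for a proper \<open>U\<close>, hence \<open>p\<close> lifts through \<open>U\<close> to an endomorphism of \<open>P\<close> with image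
  in \<open>U\<close>; by Fitting's lemma such a lift can be chosen so that its image is a direct summand, which is
  projective, smaller and still maps onto \<open>M\<close>.\<close>

lemma projective_cover_exists:
  assumes M: "left_module \<Lambda> M" "fin_gen \<Lambda> M"
  obtains P p where "P \<in> fg_proj \<Lambda>" "p \<in> Homs \<Lambda> P M" "p ` carrier P = carrier M"
    "superfluous \<Lambda> (a_kernel P M p) P"
proof -
  let ?Q = "\<lambda>P. P \<in> fg_proj \<Lambda> \<and> (\<exists>p\<in>Homs \<Lambda> P M. p ` carrier P = carrier M)"
  obtain m F where "F \<in> Homs \<Lambda> (free_module \<Lambda> m) M" "F ` carrier (free_module \<Lambda> m) = carrier M"
    using fin_gen_free_cover[OF M] by blast
  then have "?Q (free_module \<Lambda> m)"
    using fg_projI[OF left_module_free dual_basis_free] A.ring_axioms by blast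
  from ex_has_least_nat[of ?Q, OF this, of kdim]
  obtain P where Q: "?Q P" and least: "\<forall>P'. ?Q P' \<longrightarrow> kdim P \<le> kdim P'"
    by (elim exE conjE) (rule that, auto)
  from Q obtain p where P: "P \<in> fg_proj \<Lambda>" and p: "p \<in> Homs \<Lambda> P M" and surj: "p ` carrier P = carrier M"
    by blast
  have min: "kdim P \<le> kdim P'"
    if "P' \<in> fg_proj \<Lambda>" "p' \<in> Homs \<Lambda> P' M" "p' ` carrier P' = carrier M" for P' p'
    using least that by blast
  note lP = fg_projD[OF P]
  interpret P: left_module \<Lambda> P by (rule lP(1))
  interpret M: left_module \<Lambda> M by (rule M(1))
  have "superfluous \<Lambda> (a_kernel P M p) P"
    unfolding superfluous_def
  proof (intro allI impI, elim conjE, rule ccontr)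
    fix U assume U: "Module.submodule U \<Lambda> P" and sum: "a_kernel P M p <+>\<^bsub>P\<^esub> U = carrier P"
      and ne: "U \<noteq> carrier P"
    have UP: "U \<subseteq> carrier P" using U by (simp add: P.submodule_iff)
    let ?U = "P\<lparr>carrier := U\<rparr>"
    have lU: "left_module \<Lambda> ?U" by (rule P.left_module_sub[OF U])
    have pU: "restrict p U \<in> Homs \<Lambda> ?U M" by (rule Homs_restrict[OF lP(1) M(1) p U])
    have "y \<in> p ` U" if "y \<in> carrier M" for y
    proof -
      have "y \<in> p ` carrier P" using that surj by simp
      then obtain x where x: "x \<in> carrier P" "y = p x" by (rule imageE)
      then obtain k u where ku: "k \<in> a_kernel P M p" "u \<in> U" "x = k \<oplus>\<^bsub>P\<^esub> u"
        using sum P.set_add_iff by blast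
      then have "y = p u"
        using x UP Homs_closed[OF p] by (auto simp: a_kernel_iff[OF lP(1) M(1) p] Homs_add[OF p])
      then show ?thesis using ku by blast
    qed
    then have "restrict p U ` carrier ?U = carrier M" using UP Homs_closed[OF p] by auto
    then obtain h0 where h0: "h0 \<in> Homs \<Lambda> P ?U" "\<And>x. x \<in> carrier P \<Longrightarrow> restrict p U (h0 x) = p x"
      using fg_proj_lift[OF P lU M(1) pU _ p] by blast
    define H where "H = {h \<in> Homs \<Lambda> P P. h ` carrier P \<subseteq> U \<and> (\<forall>x\<in>carrier P. p (h x) = p x)}"
    have "h0 \<in> H"
      using h0 Homs_sub_codomain[OF h0(1) UP] Homs_closed[OF h0(1)] by (fastforce simp: H_def)
    then have H: "H \<subseteq> Homs \<Lambda> P P" "H \<noteq> {}" by (auto simp: H_def)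
    have comp: "compose (carrier P) h h \<in> H" if "h \<in> H" for h
      using that Homs_compose[OF lP(1), of h P h P] Homs_closed[of h \<Lambda> P P]
      by (auto simp: H_def compose_def)
    obtain h where "h \<in> H"
      and dec: "h ` carrier P <+>\<^bsub>P\<^esub> a_kernel P P h = carrier P" "h ` carrier P \<inter> a_kernel P P h = {\<zero>\<^bsub>P\<^esub>}"
      using fitting[OF lP H comp] by metis
    then have h: "h \<in> Homs \<Lambda> P P" "h ` carrier P \<subseteq> U" "\<And>x. x \<in> carrier P \<Longrightarrow> p (h x) = p x"
      by (auto simp: H_def)
    let ?I = "h ` carrier P"
    note hH = h(1)
    have I: "Module.submodule ?I \<Lambda> P" by (rule submodule_image[OF lP(1,1) hH P.submodule_carrier])
    have "P\<lparr>carrier := ?I\<rparr> \<in> fg_proj \<Lambda>"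
      by (rule fg_proj_summand[OF P I submodule_kernel[OF lP(1,1) hH] dec])
    moreover have "restrict p ?I \<in> Homs \<Lambda> (P\<lparr>carrier := ?I\<rparr>) M"
      by (rule Homs_restrict[OF lP(1) M(1) p I])
    moreover have "restrict p ?I ` carrier (P\<lparr>carrier := ?I\<rparr>) = carrier M"
      using h surj by (auto simp: image_image)
    ultimately have "kdim P \<le> kdim (P\<lparr>carrier := ?I\<rparr>)" by (rule min)
    moreover have "?I \<noteq> carrier P" using h ne UP by blast
    ultimately show False using kdim_sub_less[OF lP I] by simp
  qed
  then show thesis using that P p surj by blast
qed

text \<open>Take a projective cover of \<open>M\<close> and then one of its kernel.\<close>

lemma min_proj_pres_exists:
  assumes M: "left_module \<Lambda> M" "fin_gen \<Lambda> M"
  shows "\<exists>P1 P0 f p. min_proj_pres \<Lambda> M P1 P0 f p"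
proof -
  obtain P0 p where P0: "P0 \<in> fg_proj \<Lambda>" and p: "p \<in> Homs \<Lambda> P0 M" "p ` carrier P0 = carrier M"
    "superfluous \<Lambda> (a_kernel P0 M p) P0"
    using projective_cover_exists[OF M] by blast
  note lP = fg_projD[OF P0]
  let ?K = "a_kernel P0 M p"
  have K: "Module.submodule ?K \<Lambda> P0" by (rule submodule_kernel[OF lP(1) M(1) p(1)])
  then have KP: "?K \<subseteq> carrier P0" by (simp add: left_module.submodule_iff[OF lP(1)])
  obtain P1 f where P1: "P1 \<in> fg_proj \<Lambda>" and f: "f \<in> Homs \<Lambda> P1 (P0\<lparr>carrier := ?K\<rparr>)"
    "f ` carrier P1 = ?K" "superfluous \<Lambda> (a_kernel P1 (P0\<lparr>carrier := ?K\<rparr>) f) P1"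
    using projective_cover_exists[OF left_module.left_module_sub[OF lP(1) K] fin_gen_sub[OF lP K]] by auto
  moreover have "a_kernel P1 (P0\<lparr>carrier := ?K\<rparr>) f = a_kernel P1 P0 f"
    by (simp add: a_kernel_def kernel_def)
  ultimately have "min_proj_pres \<Lambda> M P1 P0 f p"
    using P0 p Homs_sub_codomain[OF f(1) KP] by (simp add: min_proj_pres_def)
  then show ?thesis by blast
qed

lemma the_min_presE:
  assumes M: "left_module \<Lambda> M" "fin_gen \<Lambda> M"
  obtains P1 P0 f p where "the_min_pres \<Lambda> M = (P1, P0, f)" "min_proj_pres \<Lambda> M P1 P0 f p"
proof -
  let ?Q = "\<lambda>(P1, P0, f). \<exists>p. min_proj_pres \<Lambda> M P1 P0 f p"
  have "\<exists>x. ?Q x" using min_proj_pres_exists[OF M] by fast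
  then have "?Q (the_min_pres \<Lambda> M)" unfolding the_min_pres_def by (rule someI_ex)
  then show thesis using that by (cases "the_min_pres \<Lambda> M") auto
qed

end

section \<open>Dimensions of Hom spaces\<close>

lemma hom_space_carrier: "(hom_space \<Lambda> M N)\<lparr>carrier := Homs \<Lambda> M N\<rparr> = hom_space \<Lambda> M N"
  by (simp add: hom_space_def)

lemma Homs_smult_right:
  assumes P: "left_module R P" and M: "left_module R M"
    and g: "g \<in> Homs R P (regular_module R)" and y: "y \<in> carrier M"
  shows "(\<lambda>x\<in>carrier P. g x \<odot>\<^bsub>M\<^esub> y) \<in> Homs R P M"
proof -
  interpret M: left_module R M by fact
  show ?thesis
    by (rule Homs_restrictI)
      (use Homs_closed[OF g] y P in \<open>auto simp: Homs_add[OF g] Homs_smult[OF g] M.smult_closed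
        M.smult_l_distr M.smult_assoc\<close>)
qed

lemma direct_sum_simps [simp]:
  "carrier (direct_sum A B) = carrier A \<times> carrier B"
  "\<zero>\<^bsub>direct_sum A B\<^esub> = (\<zero>\<^bsub>A\<^esub>, \<zero>\<^bsub>B\<^esub>)"
  "x \<oplus>\<^bsub>direct_sum A B\<^esub> y = (fst x \<oplus>\<^bsub>A\<^esub> fst y, snd x \<oplus>\<^bsub>B\<^esub> snd y)"
  "a \<odot>\<^bsub>direct_sum A B\<^esub> x = (a \<odot>\<^bsub>A\<^esub> fst x, a \<odot>\<^bsub>B\<^esub> snd x)"
  by (simp_all add: direct_sum_def)

lemma left_module_direct_sum:
  assumes "left_module R A" "left_module R B" shows "left_module R (direct_sum A B)"
proof -
  interpret A: left_module R A by fact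
  interpret B: left_module R B by fact
  show ?thesis
    by (rule left_moduleI)
      (auto simp: A.M.a_ac B.M.a_ac A.smult_closed B.smult_closed A.smult_l_distr B.smult_l_distr
        A.smult_r_distr B.smult_r_distr A.smult_assoc B.smult_assoc A.smult_one B.smult_one
        A.R.ring_axioms intro!: bexI[of _ "\<ominus>\<^bsub>A\<^esub> _"] bexI[of _ "\<ominus>\<^bsub>B\<^esub> _"] A.M.l_neg B.M.l_neg)
qed

context fd_algebra
begin

lemma precompose_Homs:
  assumes M: "left_module \<Lambda> M" and M': "left_module \<Lambda> M'" and X: "left_module \<Lambda> X"
    and f: "f \<in> Homs \<Lambda> M' M"
  shows "(\<lambda>h\<in>Homs \<Lambda> M X. compose (carrier M') h f) \<in> Homs K (hom_space \<Lambda> M X) (hom_space \<Lambda> M' X)"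
proof -
  have "(\<lambda>h\<in>carrier (hom_space \<Lambda> M X). compose (carrier M') h f) \<in>
    Homs K (hom_space \<Lambda> M X) (hom_space \<Lambda> M' X)"
    by (rule Homs_restrictI[OF _ _ _ left_module_hom_space[OF M X]])
      (use Homs_compose[OF M' f] Homs_closed[OF f] in \<open>auto simp: compose_def intro!: restrict_ext\<close>)
  then show ?thesis by simp
qed

lemma postcompose_Homs:
  assumes M: "left_module \<Lambda> M" and X: "left_module \<Lambda> X" and Y: "left_module \<Lambda> Y"
    and q: "q \<in> Homs \<Lambda> X Y"
  shows "(\<lambda>h\<in>Homs \<Lambda> M X. compose (carrier M) q h) \<in> Homs K (hom_space \<Lambda> M X) (hom_space \<Lambda> M Y)"
proof -
  interpret X: left_module \<Lambda> X by fact
  have "(\<lambda>h\<in>carrier (hom_space \<Lambda> M X). compose (carrier M) q h) \<in>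
    Homs K (hom_space \<Lambda> M X) (hom_space \<Lambda> M Y)"
    by (rule Homs_restrictI[OF _ _ _ left_module_hom_space[OF M X]])
      (use Homs_compose[OF M _ q] in \<open>auto simp: compose_def Homs_closed[of _ \<Lambda> M X] Homs_add[OF q]
        Homs_smult[OF q] intro!: restrict_ext\<close>)
  then show ?thesis by simp
qed

lemma evaluation_Homs:
  assumes M: "left_module \<Lambda> M" and X: "left_module \<Lambda> X" and x: "x \<in> carrier M"
  shows "(\<lambda>h\<in>Homs \<Lambda> M X. h x) \<in> Homs K (hom_space \<Lambda> M X) (underlying_space \<Lambda> X)"
proof -
  have "(\<lambda>h\<in>carrier (hom_space \<Lambda> M X). h x) \<in> Homs K (hom_space \<Lambda> M X) (underlying_space \<Lambda> X)"
    by (rule Homs_restrictI[OF _ _ _ left_module_hom_space[OF M X]])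
      (use x in \<open>auto simp: Homs_closed[of _ \<Lambda> M X]\<close>)
  then show ?thesis by simp
qed

text \<open>Apply \<open>h\<close> to \<open>x = \<Sum>i. g\<^sub>i(x) b\<^sub>i\<close>.\<close>

lemma dual_basis_expansion:
  assumes P: "left_module \<Lambda> P" and X: "left_module \<Lambda> X" and db: "dual_basis \<Lambda> P m b g"
    and h: "h \<in> Homs \<Lambda> P X"
  shows "h = (\<Oplus>\<^bsub>hom_space \<Lambda> P X\<^esub>i\<in>{..<m}. (\<lambda>x\<in>carrier P. g i x \<odot>\<^bsub>X\<^esub> h (b i)))"
    (is "h = ?s")
proof (rule Homs_eqI[OF h])
  interpret P: left_module \<Lambda> P by fact
  interpret X: left_module \<Lambda> X by fact
  interpret V: left_module K "hom_space \<Lambda> P X" by (rule left_module_hom_space[OF P X])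
  note b = dual_basisD(1)[OF db] and g = dual_basisD(2)[OF db]
  have s: "(\<lambda>x\<in>carrier P. g i x \<odot>\<^bsub>X\<^esub> h (b i)) \<in> carrier (hom_space \<Lambda> P X)" if "i < m" for i
    using Homs_smult_right[OF P X g[OF that] Homs_closed[OF h b[OF that]]] by simp
  then have sum: "?s \<in> carrier (hom_space \<Lambda> P X)" by (intro V.M.finsum_closed) auto
  then show "?s \<in> Homs \<Lambda> P X" by simp
  fix x assume x: "x \<in> carrier P"
  have gx: "g i x \<in> carrier \<Lambda>" if "i < m" for i using Homs_closed[OF g[OF that] x] by simp
  have "?s x = (\<lambda>h\<in>Homs \<Lambda> P X. h x) ?s" using sum by simp
  also have "\<dots> = (\<Oplus>\<^bsub>underlying_space \<Lambda> X\<^esub>i\<in>{..<m}.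
      (\<lambda>h\<in>Homs \<Lambda> P X. h x) (\<lambda>x\<in>carrier P. g i x \<odot>\<^bsub>X\<^esub> h (b i)))"
    using s by (intro Homs_finsum[OF left_module_hom_space[OF P X] left_module_underlying[OF X]
        evaluation_Homs[OF P X x]]) auto
  also have "\<dots> = (\<Oplus>\<^bsub>X\<^esub>i\<in>{..<m}. (\<lambda>h\<in>Homs \<Lambda> P X. h x) (\<lambda>x\<in>carrier P. g i x \<odot>\<^bsub>X\<^esub> h (b i)))"
    by (simp add: finsum_def finprod_def underlying_space_def)
  also have "\<dots> = (\<Oplus>\<^bsub>X\<^esub>i\<in>{..<m}. h (g i x \<odot>\<^bsub>P\<^esub> b i))"
    by (rule X.M.finsum_cong')
      (use s x gx b in \<open>auto simp: Homs_smult[OF h] Homs_closed[OF h] X.smult_closed\<close>)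
  also have "\<dots> = h (\<Oplus>\<^bsub>P\<^esub>i\<in>{..<m}. g i x \<odot>\<^bsub>P\<^esub> b i)"
    using gx b by (subst Homs_finsum[OF P X h]) (auto simp: P.smult_closed)
  finally show "h x = ?s x" using dual_basisD(3)[OF db x] by simp
qed

text \<open>By the expansion along a dual basis, the maps \<open>g\<^sub>i(-) y\<close>, with \<open>y\<close> from a spanning set of \<open>X\<close>, span
  \<open>Hom(P, X)\<close>.\<close>

lemma fin_dim_hom_space:
  assumes P: "P \<in> fg_proj \<Lambda>" and X: "left_module \<Lambda> X" "fin_gen \<Lambda> X"
  shows "vectorspace.fin_dim K (hom_space \<Lambda> P X)"
proof -
  note lP = fg_projD(1)[OF P]
  interpret X: left_module \<Lambda> X by (rule X(1))
  let ?V = "hom_space \<Lambda> P X" and ?X = "underlying_space \<Lambda> X"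
  interpret V: vspace K ?V by (rule vspace_hom_space[OF lP X(1)])
  interpret VL: left_module K ?V by (rule left_module_hom_space[OF lP X(1)])
  interpret U: vspace K ?X by (rule vspace_underlying[OF X(1)])
  interpret UL: left_module K ?X by (rule left_module_underlying[OF X(1)])
  obtain m b g where db: "dual_basis \<Lambda> P m b g" using fg_proj_dual_basis[OF P] by blast
  note b = dual_basisD(1)[OF db] and g = dual_basisD(2)[OF db]
  obtain B where B: "finite B" "B \<subseteq> carrier X" "U.span B = carrier X"
    using X fin_gen_iff_fin_dim[OF X(1)] by (auto simp: U.fin_dim_def)
  define r where "r i y = (\<lambda>x\<in>carrier P. g i x \<odot>\<^bsub>X\<^esub> y)" for i y
  have r: "r i y \<in> carrier ?V" if "i < m" "y \<in> carrier X" for i y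
    using Homs_smult_right[OF lP X(1) g[OF that(1)] that(2)] by (simp add: r_def)
  define S where "S = (\<lambda>(i, y). r i y) ` ({..<m} \<times> B)"
  have S: "finite S" "S \<subseteq> carrier ?V" using B r by (auto simp: S_def simp del: hom_space_simps)
  let ?N = "V.span S"
  have N: "Module.submodule ?N K ?V"
    using V.span_is_subspace[OF S(2)] by (simp add: V.subspace_iff)
  note N' = N[unfolded VL.submodule_iff]
  have rN: "r i y \<in> ?N" if i: "i < m" and y: "y \<in> carrier X" for i y
  proof -
    let ?C = "{y \<in> carrier X. r i y \<in> ?N}"
    have gx: "g i x \<in> carrier \<Lambda>" if "x \<in> carrier P" for x using Homs_closed[OF g[OF i] that] by simp
    have "r i \<zero>\<^bsub>X\<^esub> = \<zero>\<^bsub>?V\<^esub>" using gx by (auto simp: r_def intro!: restrict_ext)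
    moreover have "r i (y \<oplus>\<^bsub>X\<^esub> z) = r i y \<oplus>\<^bsub>?V\<^esub> r i z" if "y \<in> carrier X" "z \<in> carrier X" for y z
      using gx that by (auto simp: r_def X.smult_r_distr intro!: restrict_ext)
    moreover have "r i (scalar c \<odot>\<^bsub>X\<^esub> y) = c \<odot>\<^bsub>?V\<^esub> r i y" if "c \<in> carrier K" "y \<in> carrier X" for c y
      using gx that by (auto simp: r_def scalar_commute[OF X(1), symmetric] intro!: restrict_ext)
    ultimately have "Module.submodule ?C K ?X"
      unfolding UL.submodule_iff using N' by (auto simp: X.smult_closed simp del: hom_space_simps)
    moreover have "B \<subseteq> ?C"
      using B i V.in_own_span[OF S(2)] by (auto simp: S_def)
    ultimately have "U.span B \<subseteq> ?C"
      using U.span_is_subset[of B ?C] by (simp add: U.subspace_iff[symmetric] subspace_def)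
    then show ?thesis using y B by auto
  qed
  have "h \<in> ?N" if h: "h \<in> carrier ?V" for h
  proof -
    have hH: "h \<in> Homs \<Lambda> P X" using h by simp
    have "(\<Oplus>\<^bsub>?V\<^esub>i\<in>{..<m}. r i (h (b i))) \<in> ?N"
      using rN Homs_closed[OF hH b] by (intro VL.finsum_in_submodule[OF N]) auto
    then show ?thesis using dual_basis_expansion[OF lP X(1) db hH] by (simp add: r_def)
  qed
  then have "?N = carrier ?V" using N' by blast
  then show ?thesis using S by (auto simp: V.fin_dim_def)
qed

lemma hom_dim_zero:
  assumes M: "left_module \<Lambda> M" and X: "left_module \<Lambda> X"
    and zero: "\<And>f x. \<lbrakk>f \<in> Homs \<Lambda> M X; x \<in> carrier M\<rbrakk> \<Longrightarrow> f x = \<zero>\<^bsub>X\<^esub>"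
  shows "hom_dim K \<Lambda> M X = 0"
proof -
  let ?V = "hom_space \<Lambda> M X"
  interpret V: vspace K ?V by (rule vspace_hom_space[OF M X])
  have z: "\<zero>\<^bsub>?V\<^esub> \<in> carrier ?V" by (rule left_module.submodule_zero[OF V.left_module,
        unfolded left_module.submodule_iff[OF V.left_module], THEN conjunct1, THEN subsetD]) simp
  have "f = \<zero>\<^bsub>?V\<^esub>" if "f \<in> carrier ?V" for f
    using that z zero by (intro Homs_eqI[of f \<Lambda> M X]) auto
  then have "carrier ?V = {\<zero>\<^bsub>?V\<^esub>}" using z by blast
  then have "?V = ?V\<lparr>carrier := {\<zero>\<^bsub>?V\<^esub>}\<rparr>" by (metis partial_object.surjective partial_object.update_convs(1))
  then show ?thesis using V.dim_zero_space by (simp add: hom_dim_def)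
qed

subsection \<open>Additivity in both variables\<close>

text \<open>\<open>Hom(P, -)\<close> is exact for projective \<open>P\<close>.\<close>

lemma hom_dim_quot:
  assumes P: "P \<in> fg_proj \<Lambda>" and X: "left_module \<Lambda> X" "fin_gen \<Lambda> X" and N: "Module.submodule N \<Lambda> X"
  shows "hom_dim K \<Lambda> P X = hom_dim K \<Lambda> P (X\<lparr>carrier := N\<rparr>) + hom_dim K \<Lambda> P (quot_module X N)"
proof -
  note lP = fg_projD(1)[OF P]
  interpret X: left_module \<Lambda> X by (rule X(1))
  let ?Q = "quot_module X N"
  have Q: "left_module \<Lambda> ?Q" by (rule X.left_module_quot[OF N])
  let ?V = "hom_space \<Lambda> P X" and ?W = "hom_space \<Lambda> P ?Q"
  interpret V: vspace K ?V by (rule vspace_hom_space[OF lP X(1)])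
  interpret W: vspace K ?W by (rule vspace_hom_space[OF lP Q])
  let ?\<pi> = "\<lambda>x\<in>carrier X. N +>\<^bsub>X\<^esub> x"
  have \<pi>: "?\<pi> \<in> Homs \<Lambda> X ?Q" by (rule X.quot_proj_Homs[OF N])
  have surj: "?\<pi> ` carrier X = carrier ?Q" by (simp add: X.quot_carrier[OF N])
  let ?T = "\<lambda>h\<in>Homs \<Lambda> P X. compose (carrier P) ?\<pi> h"
  have T: "?T \<in> Homs K ?V ?W" by (rule postcompose_Homs[OF lP X(1) Q \<pi>])
  have "f \<in> ?T ` carrier ?V" if "f \<in> carrier ?W" for f
  proof -
    have f: "f \<in> Homs \<Lambda> P ?Q" using that by simp
    obtain h where h: "h \<in> Homs \<Lambda> P X" "\<And>x. x \<in> carrier P \<Longrightarrow> ?\<pi> (h x) = f x"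
      using fg_proj_lift[OF P X(1) Q \<pi> surj f] by blast
    have "f = compose (carrier P) ?\<pi> h"
      using h by (intro Homs_eqI[OF f Homs_compose[OF lP h(1) \<pi>]]) (simp add: compose_def)
    then show ?thesis using h(1) by (intro image_eqI[of _ _ h]) auto
  qed
  then have im: "?T ` carrier ?V = carrier ?W" using Homs_closed[OF T] by blast
  have ker: "a_kernel ?V ?W ?T = Homs \<Lambda> P (X\<lparr>carrier := N\<rparr>)"
  proof -
    have "compose (carrier P) ?\<pi> h = \<zero>\<^bsub>?W\<^esub> \<longleftrightarrow> h ` carrier P \<subseteq> N" if h: "h \<in> Homs \<Lambda> P X" for h
    proof -
      have "compose (carrier P) ?\<pi> h = \<zero>\<^bsub>?W\<^esub> \<longleftrightarrow> (\<forall>x\<in>carrier P. N +>\<^bsub>X\<^esub> h x = \<zero>\<^bsub>?Q\<^esub>)"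
        using Homs_closed[OF h] by (auto simp: compose_def fun_eq_iff)
      then show ?thesis using Homs_closed[OF h] X.coset_eq_zero_iff[OF N] by auto
    qed
    moreover have "h \<in> Homs \<Lambda> P (X\<lparr>carrier := N\<rparr>) \<longleftrightarrow> h \<in> Homs \<Lambda> P X \<and> h ` carrier P \<subseteq> N" for h
      using Homs_corestrict[OF lP X(1), of h N] Homs_sub_codomain[where f = h and V = N and N = X]
        Homs_closed[of h \<Lambda> P "X\<lparr>carrier := N\<rparr>"] N by (auto simp: X.submodule_iff)
    ultimately show ?thesis by (auto simp: a_kernel_def kernel_def)
  qed
  have "hom_space \<Lambda> P (X\<lparr>carrier := N\<rparr>) = ?V\<lparr>carrier := Homs \<Lambda> P (X\<lparr>carrier := N\<rparr>)\<rparr>"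
    by (simp add: hom_space_def)
  then show ?thesis
    using V.rank_nullity_Homs[OF W.vectorspace_axioms T fin_dim_hom_space[OF P X]]
    unfolding im ker hom_dim_def by (simp add: hom_space_carrier)
qed

text \<open>Restriction to \<open>A\<close> maps \<open>Hom(C, X)\<close> onto \<open>Hom(A, X)\<close>, and restriction to \<open>B\<close> identifies its kernel
  with \<open>Hom(B, X)\<close>.\<close>

lemma hom_dim_direct_sum:
  assumes A: "left_module \<Lambda> A" and B: "left_module \<Lambda> B" and C: "C \<in> fg_proj \<Lambda>"
    and iso: "mod_iso \<Lambda> C (direct_sum A B)" and X: "left_module \<Lambda> X" "fin_gen \<Lambda> X"
  shows "hom_dim K \<Lambda> C X = hom_dim K \<Lambda> A X + hom_dim K \<Lambda> B X"
proof -
  note lC = fg_projD(1)[OF C]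
  interpret A: left_module \<Lambda> A by fact
  interpret B: left_module \<Lambda> B by fact
  interpret C: left_module \<Lambda> C by (rule lC)
  interpret X: left_module \<Lambda> X by (rule X(1))
  let ?D = "direct_sum A B"
  have D: "left_module \<Lambda> ?D" by (rule left_module_direct_sum[OF A B])
  obtain \<phi> where \<phi>: "\<phi> \<in> Homs \<Lambda> C ?D" "bij_betw \<phi> (carrier C) (carrier ?D)"
    using iso by (auto simp: mod_iso_def)
  obtain \<psi> where \<psi>: "\<psi> \<in> Homs \<Lambda> ?D C" and \<psi>\<phi>: "\<And>x. x \<in> carrier C \<Longrightarrow> \<psi> (\<phi> x) = x"
    and \<phi>\<psi>: "\<And>y. y \<in> carrier ?D \<Longrightarrow> \<phi> (\<psi> y) = y" and "bij_betw \<psi> (carrier ?D) (carrier C)"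
    by (rule mod_iso_inverse[OF lC D \<phi>]) (rule that)
  have pr: "fst (\<phi> x) \<in> carrier A" "snd (\<phi> x) \<in> carrier B" if "x \<in> carrier C" for x
    using Homs_closed[OF \<phi>(1) that] by auto
  define i where "i = (\<lambda>a\<in>carrier A. \<psi> (a, \<zero>\<^bsub>B\<^esub>))"
  define j where "j = (\<lambda>b\<in>carrier B. \<psi> (\<zero>\<^bsub>A\<^esub>, b))"
  have \<psi>c: "\<psi> (a, b) \<in> carrier C" if "a \<in> carrier A" "b \<in> carrier B" for a b
    using Homs_closed[OF \<psi>, of "(a, b)"] that by simp
  have i: "i \<in> Homs \<Lambda> A C"
    unfolding i_def by (rule Homs_restrictI[OF _ _ _ A])
      (auto simp: \<psi>c simp flip: Homs_add[OF \<psi>] Homs_smult[OF \<psi>])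
  have j: "j \<in> Homs \<Lambda> B C"
    unfolding j_def by (rule Homs_restrictI[OF _ _ _ B])
      (auto simp: \<psi>c simp flip: Homs_add[OF \<psi>] Homs_smult[OF \<psi>])
  have dec: "x = i (fst (\<phi> x)) \<oplus>\<^bsub>C\<^esub> j (snd (\<phi> x))" if x: "x \<in> carrier C" for x
    using pr[OF x] \<psi>\<phi>[OF x] by (simp add: i_def j_def flip: Homs_add[OF \<psi>])
  have \<phi>i: "\<phi> (i a) = (a, \<zero>\<^bsub>B\<^esub>)" if "a \<in> carrier A" for a using that \<phi>\<psi> by (simp add: i_def)
  have \<phi>j: "\<phi> (j b) = (\<zero>\<^bsub>A\<^esub>, b)" if "b \<in> carrier B" for b using that \<phi>\<psi> by (simp add: j_def)
  let ?V = "hom_space \<Lambda> C X" and ?VA = "hom_space \<Lambda> A X" and ?VB = "hom_space \<Lambda> B X"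
  interpret V: vspace K ?V by (rule vspace_hom_space[OF lC X(1)])
  interpret VA: vspace K ?VA by (rule vspace_hom_space[OF A X(1)])
  interpret VB: vspace K ?VB by (rule vspace_hom_space[OF B X(1)])
  define S where "S = (\<lambda>h\<in>Homs \<Lambda> C X. compose (carrier A) h i)"
  define T where "T = (\<lambda>h\<in>Homs \<Lambda> C X. compose (carrier B) h j)"
  have SH: "S \<in> Homs K ?V ?VA" unfolding S_def by (rule precompose_Homs[OF lC A X(1) i])
  have TH: "T \<in> Homs K ?V ?VB" unfolding T_def by (rule precompose_Homs[OF lC B X(1) j])
  have pairing: "\<exists>h\<in>Homs \<Lambda> C X. S h = u \<and> T h = v" if u: "u \<in> Homs \<Lambda> A X" and v: "v \<in> Homs \<Lambda> B X" for u v
  proof -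
    let ?h = "\<lambda>x\<in>carrier C. u (fst (\<phi> x)) \<oplus>\<^bsub>X\<^esub> v (snd (\<phi> x))"
    have uv: "u (fst (\<phi> x)) \<in> carrier X" "v (snd (\<phi> x)) \<in> carrier X" if "x \<in> carrier C" for x
      using pr[OF that] Homs_closed[OF u] Homs_closed[OF v] by auto
    have h: "?h \<in> Homs \<Lambda> C X"
      by (rule Homs_restrictI[OF _ _ _ lC])
        (simp_all add: uv Homs_add[OF \<phi>(1)] Homs_smult[OF \<phi>(1)] pr Homs_add[OF u] Homs_add[OF v]
          Homs_smult[OF u] Homs_smult[OF v] X.M.a_ac X.smult_r_distr)
    have "compose (carrier A) ?h i = u"
      using Homs_closed[OF i] Homs_closed[OF u]
      by (intro Homs_eqI[OF Homs_compose[OF A i h] u]) (simp add: compose_def \<phi>i Homs_zero[OF B X(1) v])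
    moreover have "compose (carrier B) ?h j = v"
      using Homs_closed[OF j] Homs_closed[OF v]
      by (intro Homs_eqI[OF Homs_compose[OF B j h] v]) (simp add: compose_def \<phi>j Homs_zero[OF A X(1) u])
    ultimately show ?thesis using h by (intro bexI[of _ ?h]) (auto simp: S_def T_def)
  qed
  have zA: "\<zero>\<^bsub>?VA\<^esub> \<in> Homs \<Lambda> A X" using VA.M.zero_closed by simp
  have zB: "\<zero>\<^bsub>?VB\<^esub> \<in> Homs \<Lambda> B X" using VB.M.zero_closed by simp
  have imS: "S ` carrier ?V = carrier ?VA"
  proof
    show "carrier ?VA \<subseteq> S ` carrier ?V"
    proof
      fix u assume "u \<in> carrier ?VA"
      then obtain h where "h \<in> Homs \<Lambda> C X" "S h = u" using pairing[OF _ zB] by auto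
      then show "u \<in> S ` carrier ?V" by (intro image_eqI[of _ _ h]) auto
    qed
  qed (use Homs_closed[OF SH] in blast)
  let ?N = "a_kernel ?V ?VA S"
  have N: "Module.submodule ?N K ?V" by (rule submodule_kernel[OF V.left_module VA.left_module SH])
  have N_iff: "h \<in> ?N \<longleftrightarrow> h \<in> Homs \<Lambda> C X \<and> S h = \<zero>\<^bsub>?VA\<^esub>" for h
    by (simp add: a_kernel_def kernel_def)
  interpret NV: vspace K "?V\<lparr>carrier := ?N\<rparr>" by (rule vspaceI[OF V.vectorspace_sub[OF N]])
  have NT: "restrict T ?N \<in> Homs K (?V\<lparr>carrier := ?N\<rparr>) ?VB"
    by (rule Homs_restrict[OF V.left_module VB.left_module TH N])
  have "bij_betw (restrict T ?N) ?N (carrier ?VB)"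
    unfolding bij_betw_def
  proof
    have "h = h'" if h: "h \<in> ?N" "h' \<in> ?N" and eq: "T h = T h'" for h h'
    proof -
      have hH: "h \<in> Homs \<Lambda> C X" "h' \<in> Homs \<Lambda> C X" and S0: "S h = S h'" using h by (auto simp: N_iff)
      have "h (i a) = h' (i a)" if "a \<in> carrier A" for a
        using fun_cong[OF S0, of a] hH that by (simp add: S_def compose_def)
      moreover have "h (j b) = h' (j b)" if "b \<in> carrier B" for b
        using fun_cong[OF eq, of b] hH that by (simp add: T_def compose_def)
      ultimately have "h x = h' x" if "x \<in> carrier C" for x
        using pr[OF that] Homs_closed[OF i] Homs_closed[OF j]
        by (subst (1 2) dec[OF that]) (simp add: Homs_add[OF hH(1)] Homs_add[OF hH(2)])
      then show ?thesis by (rule Homs_eqI[OF hH])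
    qed
    then show "inj_on (restrict T ?N) ?N" by (auto simp: inj_on_def)
    show "restrict T ?N ` ?N = carrier ?VB"
    proof
      show "carrier ?VB \<subseteq> restrict T ?N ` ?N"
      proof
        fix v assume "v \<in> carrier ?VB"
        then obtain h where h: "h \<in> Homs \<Lambda> C X" "S h = \<zero>\<^bsub>?VA\<^esub>" "T h = v"
          using pairing[OF zA] by auto
        then have "h \<in> ?N" by (simp add: N_iff)
        then show "v \<in> restrict T ?N ` ?N" using h(3) by (intro image_eqI[of _ _ h]) simp_all
      qed
    qed (use Homs_closed[OF NT] in auto)
  qed
  then have "VB.dim = NV.dim"
    using NV.dim_eq_bij[OF VB.vectorspace_axioms NT] V.fin_dim_sub[OF fin_dim_hom_space[OF C X] N] by simp
  then show ?thesis
    using V.rank_nullity_Homs[OF VA.vectorspace_axioms SH fin_dim_hom_space[OF C X]]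
    unfolding imS hom_dim_def by (simp add: hom_space_carrier)
qed

end

section \<open>Indecomposable projectives and composition multiplicities\<close>

subsection \<open>Maximal submodules and simple modules\<close>

lemma maximal_submoduleD:
  assumes "maximal_submodule \<Lambda> N M"
  shows "Module.submodule N \<Lambda> M" "N \<noteq> carrier M"
    "\<lbrakk>Module.submodule U \<Lambda> M; N \<subseteq> U\<rbrakk> \<Longrightarrow> U = N \<or> U = carrier M"
  using assms by (auto simp: maximal_submodule_def)

lemma simple_moduleD:
  assumes "simple_module \<Lambda> S"
  shows "left_module \<Lambda> S" "carrier S \<noteq> {\<zero>\<^bsub>S\<^esub>}"
    "Module.submodule N \<Lambda> S \<Longrightarrow> N = {\<zero>\<^bsub>S\<^esub>} \<or> N = carrier S"
  using assms by (auto simp: simple_module_def)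

lemma simple_quot:
  assumes M: "left_module \<Lambda> M" and N: "maximal_submodule \<Lambda> N M"
  shows "simple_module \<Lambda> (quot_module M N)"
proof -
  interpret M: left_module \<Lambda> M by fact
  note N' = maximal_submoduleD[OF N]
  let ?Q = "quot_module M N"
  have Q: "left_module \<Lambda> ?Q" by (rule M.left_module_quot[OF N'(1)])
  let ?\<pi> = "\<lambda>x\<in>carrier M. N +>\<^bsub>M\<^esub> x"
  have \<pi>: "?\<pi> \<in> Homs \<Lambda> M ?Q" by (rule M.quot_proj_Homs[OF N'(1)])
  have NM: "N \<subseteq> carrier M" using N'(1) by (simp add: M.submodule_iff)
  then obtain x where x: "x \<in> carrier M" "x \<notin> N" using N'(2) by blast
  have "N +>\<^bsub>M\<^esub> x \<in> carrier ?Q" "N +>\<^bsub>M\<^esub> x \<noteq> \<zero>\<^bsub>?Q\<^esub>"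
    using x M.coset_eq_zero_iff[OF N'(1)] by (auto simp: M.quot_carrier[OF N'(1)])
  then have ne: "carrier ?Q \<noteq> {\<zero>\<^bsub>?Q\<^esub>}" by blast
  have "W = {\<zero>\<^bsub>?Q\<^esub>} \<or> W = carrier ?Q" if W: "Module.submodule W \<Lambda> ?Q" for W
  proof -
    note W' = W[unfolded left_module.submodule_iff[OF Q]]
    let ?U = "{x \<in> carrier M. ?\<pi> x \<in> W}"
    have "Module.submodule ?U \<Lambda> M" by (rule submodule_vimage[OF M.left_module_axioms Q \<pi> W])
    moreover have "N \<subseteq> ?U"
    proof
      fix y assume y: "y \<in> N"
      then have "N +>\<^bsub>M\<^esub> y = \<zero>\<^bsub>?Q\<^esub>" using M.coset_eq_zero_iff[OF N'(1)] NM by blast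
      then show "y \<in> ?U" using y NM W' by auto
    qed
    ultimately consider "?U = N" | "?U = carrier M" using N'(3) by blast
    then show ?thesis
    proof cases
      case 1
      have "w = \<zero>\<^bsub>?Q\<^esub>" if "w \<in> W" for w
      proof -
        have "w \<in> (\<lambda>x. N +>\<^bsub>M\<^esub> x) ` carrier M"
          using W' that unfolding M.quot_carrier[OF N'(1)] by blast
        then obtain y where y: "y \<in> carrier M" "w = N +>\<^bsub>M\<^esub> y" by blast
        then have "y \<in> ?U" using that by simp
        then have "y \<in> N" unfolding 1 .
        then show ?thesis using y M.coset_eq_zero_iff[OF N'(1)] by simp
      qed
      then show ?thesis using W' by blast
    next
      case 2
      have "N +>\<^bsub>M\<^esub> y \<in> W" if "y \<in> carrier M" for y
      proof -
        have "y \<in> ?U" unfolding 2 by (rule that)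
        then show ?thesis using that by simp
      qed
      then have "carrier ?Q \<subseteq> W" by (auto simp: M.quot_carrier[OF N'(1)])
      then show ?thesis using W' by blast
    qed
  qed
  then show ?thesis using Q ne by (simp add: simple_module_def)
qed

lemma factor_through_surj:
  assumes M: "left_module R M" and N: "left_module R N" and X: "left_module R X"
    and p: "p \<in> Homs R M N" and surj: "p ` carrier M = carrier N" and h: "h \<in> Homs R M X"
    and ker: "\<And>x. \<lbrakk>x \<in> carrier M; p x = \<zero>\<^bsub>N\<^esub>\<rbrakk> \<Longrightarrow> h x = \<zero>\<^bsub>X\<^esub>"
  obtains k where "k \<in> Homs R N X" "\<And>x. x \<in> carrier M \<Longrightarrow> k (p x) = h x"
proof -
  interpret M: left_module R M by fact
  interpret N: left_module R N by fact
  interpret X: left_module R X by fact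
  have welldef: "h x = h y" if xy: "x \<in> carrier M" "y \<in> carrier M" "p x = p y" for x y
  proof -
    have "p (x \<ominus>\<^bsub>M\<^esub> y) = \<zero>\<^bsub>N\<^esub>" using xy Homs_closed[OF p] by (simp add: Homs_minus[OF M N p])
    then have "h (x \<ominus>\<^bsub>M\<^esub> y) = \<zero>\<^bsub>X\<^esub>" using ker xy by simp
    then show ?thesis using xy Homs_closed[OF h] by (simp add: Homs_minus[OF M X h])
  qed
  define pre where "pre s = (SOME x. x \<in> carrier M \<and> p x = s)" for s
  have pre: "pre s \<in> carrier M" "p (pre s) = s" if s: "s \<in> carrier N" for s
  proof -
    have "s \<in> p ` carrier M" using s surj by simp
    then have "\<exists>x. x \<in> carrier M \<and> p x = s" by blast
    from someI_ex[OF this] show "pre s \<in> carrier M" "p (pre s) = s" unfolding pre_def by auto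
  qed
  let ?k = "\<lambda>s\<in>carrier N. h (pre s)"
  have "?k (p x) = h x" if "x \<in> carrier M" for x
    using that pre Homs_closed[OF p] by (auto intro!: welldef)
  moreover have "?k \<in> Homs R N X"
  proof (rule Homs_restrictI[OF _ _ _ N])
    show "h (pre s) \<in> carrier X" if "s \<in> carrier N" for s using Homs_closed[OF h] pre that by blast
    fix s t assume st: "s \<in> carrier N" "t \<in> carrier N"
    have "h (pre (s \<oplus>\<^bsub>N\<^esub> t)) = h (pre s \<oplus>\<^bsub>M\<^esub> pre t)"
      using st pre by (intro welldef) (auto simp: Homs_add[OF p])
    then show "h (pre (s \<oplus>\<^bsub>N\<^esub> t)) = h (pre s) \<oplus>\<^bsub>X\<^esub> h (pre t)" using st pre by (simp add: Homs_add[OF h])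
  next
    fix a s assume as: "a \<in> carrier R" "s \<in> carrier N"
    have "h (pre (a \<odot>\<^bsub>N\<^esub> s)) = h (a \<odot>\<^bsub>M\<^esub> pre s)"
      using as pre by (intro welldef) (auto simp: Homs_smult[OF p] N.smult_closed M.smult_closed)
    then show "h (pre (a \<odot>\<^bsub>N\<^esub> s)) = a \<odot>\<^bsub>X\<^esub> h (pre s)" using as pre by (simp add: Homs_smult[OF h])
  qed
  ultimately show thesis using that by blast
qed

context
  fixes \<Lambda> :: "('k, 'a) module" and P :: "('a, 'p) module" and S :: "('a, 's) module" and f
  assumes P: "left_module \<Lambda> P" and S: "simple_module \<Lambda> S" and f: "f \<in> Homs \<Lambda> P S"
    and nonzero: "\<exists>x\<in>carrier P. f x \<noteq> \<zero>\<^bsub>S\<^esub>"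
begin

lemma hom_to_simple_surj: "f ` carrier P = carrier S"
  using simple_moduleD(3)[OF S submodule_image[OF P simple_moduleD(1)[OF S] f
        left_module.submodule_carrier[OF P]]] nonzero by blast

lemma hom_to_simple_kernel: "maximal_submodule \<Lambda> (a_kernel P S f) P"
  unfolding maximal_submodule_def
proof (intro conjI allI impI)
  note lS = simple_moduleD(1)[OF S]
  interpret P: left_module \<Lambda> P by (rule P)
  interpret S: left_module \<Lambda> S by (rule lS)
  let ?K = "a_kernel P S f"
  show "Module.submodule ?K \<Lambda> P" by (rule submodule_kernel[OF P lS f])
  show "?K \<noteq> carrier P" using nonzero by (auto simp: a_kernel_iff[OF P lS f])
  fix U assume U: "Module.submodule U \<Lambda> P \<and> ?K \<subseteq> U"
  then have UP: "U \<subseteq> carrier P" by (simp add: P.submodule_iff)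
  consider "f ` U = {\<zero>\<^bsub>S\<^esub>}" | "f ` U = carrier S"
    using simple_moduleD(3)[OF S submodule_image[OF P lS f]] U by blast
  then show "U = ?K \<or> U = carrier P"
  proof cases
    case 1
    then have "f u = \<zero>\<^bsub>S\<^esub>" if "u \<in> U" for u using that by blast
    then have "U \<subseteq> ?K" using UP by (auto simp: a_kernel_iff[OF P lS f])
    then show ?thesis using U by blast
  next
    case 2
    have "x \<in> U" if x: "x \<in> carrier P" for x
    proof -
      have "f x \<in> f ` U" using 2 Homs_closed[OF f x] by simp
      then obtain u where u: "u \<in> U" "f x = f u" by blast
      then have uP: "u \<in> carrier P" using UP by blast
      have "x \<ominus>\<^bsub>P\<^esub> u \<in> ?K"
        using x u uP Homs_closed[OF f] by (simp add: a_kernel_iff[OF P lS f] Homs_minus[OF P lS f])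
      then have "(x \<ominus>\<^bsub>P\<^esub> u) \<oplus>\<^bsub>P\<^esub> u \<in> U" using U u by (auto simp: P.submodule_iff)
      then show ?thesis using x uP by (simp add: a_minus_def P.M.a_assoc P.M.l_neg)
    qed
    then show ?thesis using UP by blast
  qed
qed

end

context fd_algebra
begin

lemma maximal_submodule_above:
  assumes M: "left_module \<Lambda> M" "fin_gen \<Lambda> M" and N: "Module.submodule N \<Lambda> M" "N \<noteq> carrier M"
  obtains U where "maximal_submodule \<Lambda> U M" "N \<subseteq> U"
proof -
  let ?P = "\<lambda>U. Module.submodule U \<Lambda> M \<and> U \<noteq> carrier M \<and> N \<subseteq> U"
  let ?d = "\<lambda>U. kdim (M\<lparr>carrier := U\<rparr>)"
  have "?P N" using N by simp
  moreover have "\<forall>U. ?P U \<longrightarrow> ?d U < Suc (kdim M)" using kdim_sub_less[OF M] less_SucI by blast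
  ultimately obtain U where U: "?P U" and max: "\<And>V. ?P V \<Longrightarrow> ?d V \<le> ?d U"
    using ex_has_greatest_nat[of ?P N ?d "Suc (kdim M)"] by blast
  have "V = U" if V: "Module.submodule V \<Lambda> M" "U \<subseteq> V" "V \<noteq> carrier M" for V
  proof (rule ccontr)
    assume "V \<noteq> U"
    then have "?d U < ?d V" using kdim_sub_less'[OF M, of U V] U V by blast
    moreover have "?d V \<le> ?d U" using max[of V] U V by blast
    ultimately show False by simp
  qed
  then have "maximal_submodule \<Lambda> U M" using U unfolding maximal_submodule_def by blast
  then show thesis using that U by blast
qed

text \<open>If \<open>U \<noteq> V\<close> were maximal in \<open>P\<close>, then \<open>V\<close> would map onto \<open>P/U\<close> and the identity of \<open>P/U\<close> would
  lift to an endomorphism of \<open>P\<close> with image in \<open>V\<close>. Fitting's lemma splits \<open>P\<close> along such a lift; being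
  indecomposable, \<open>P\<close> forces the lift to be zero (it is not, being the identity modulo \<open>U\<close>) or
  bijective (it is not, its image lying in \<open>V\<close>).\<close>

lemma maximal_submodule_unique:
  assumes P: "P \<in> fg_proj \<Lambda>" and ind: "indecomposable \<Lambda> P"
    and U: "maximal_submodule \<Lambda> U P" and V: "maximal_submodule \<Lambda> V P"
  shows "U = V"
proof (rule ccontr)
  assume UV: "U \<noteq> V"
  note lP = fg_projD[OF P]
  interpret P: left_module \<Lambda> P by (rule lP(1))
  note U' = maximal_submoduleD[OF U] and V' = maximal_submoduleD[OF V]
  have UP: "U \<subseteq> carrier P" and VP: "V \<subseteq> carrier P" using U'(1) V'(1) by (auto simp: P.submodule_iff)
  have Uz: "\<zero>\<^bsub>P\<^esub> \<in> U" and Vz: "\<zero>\<^bsub>P\<^esub> \<in> V" using U'(1) V'(1) by (auto simp: P.submodule_iff)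
  have "U \<subseteq> U <+>\<^bsub>P\<^esub> V" "V \<subseteq> U <+>\<^bsub>P\<^esub> V"
  proof -
    show "U \<subseteq> U <+>\<^bsub>P\<^esub> V"
    proof
      fix u assume u: "u \<in> U"
      then have "u = u \<oplus>\<^bsub>P\<^esub> \<zero>\<^bsub>P\<^esub>" using UP by (simp add: subset_iff)
      then show "u \<in> U <+>\<^bsub>P\<^esub> V" using u Vz unfolding P.set_add_iff by blast
    qed
    show "V \<subseteq> U <+>\<^bsub>P\<^esub> V"
    proof
      fix v assume v: "v \<in> V"
      then have "v = \<zero>\<^bsub>P\<^esub> \<oplus>\<^bsub>P\<^esub> v" using VP by (simp add: subset_iff)
      then show "v \<in> U <+>\<^bsub>P\<^esub> V" using v Uz unfolding P.set_add_iff by blast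
    qed
  qed
  then have sum: "U <+>\<^bsub>P\<^esub> V = carrier P"
    using U'(3)[OF P.submodule_set_add[OF U'(1) V'(1)]] V'(3)[OF U'(1)] U'(2) UV by blast
  let ?Q = "quot_module P U" and ?V = "P\<lparr>carrier := V\<rparr>"
  have Q: "left_module \<Lambda> ?Q" by (rule P.left_module_quot[OF U'(1)])
  have lV: "left_module \<Lambda> ?V" by (rule P.left_module_sub[OF V'(1)])
  let ?\<pi> = "\<lambda>x\<in>carrier P. U +>\<^bsub>P\<^esub> x"
  have \<pi>: "?\<pi> \<in> Homs \<Lambda> P ?Q" by (rule P.quot_proj_Homs[OF U'(1)])
  have \<pi>V: "restrict ?\<pi> V \<in> Homs \<Lambda> ?V ?Q" by (rule Homs_restrict[OF lP(1) Q \<pi> V'(1)])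
  have "restrict ?\<pi> V ` carrier ?V = carrier ?Q"
  proof
    show "carrier ?Q \<subseteq> restrict ?\<pi> V ` carrier ?V"
    proof
      fix C assume "C \<in> carrier ?Q"
      then obtain x where x: "x \<in> carrier P" "C = U +>\<^bsub>P\<^esub> x" by (auto simp: P.quot_carrier[OF U'(1)])
      obtain u v where uv: "u \<in> U" "v \<in> V" "x = u \<oplus>\<^bsub>P\<^esub> v"
        using x(1) sum P.set_add_iff by blast
      then have c: "u \<in> carrier P" "v \<in> carrier P" using UP VP by auto
      have "x \<ominus>\<^bsub>P\<^esub> v = u" using uv(3) c by (simp add: a_minus_def P.M.a_assoc P.M.r_neg)
      then have "C = U +>\<^bsub>P\<^esub> v" using x c uv(1) P.coset_eq_iff[OF U'(1), of x v] by simp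
      then show "C \<in> restrict ?\<pi> V ` carrier ?V" using uv(2) c by (intro image_eqI[of _ _ v]) auto
    qed
  qed (use Homs_closed[OF \<pi>V] in blast)
  then obtain h0 where h0: "h0 \<in> Homs \<Lambda> P ?V" "\<And>x. x \<in> carrier P \<Longrightarrow> restrict ?\<pi> V (h0 x) = ?\<pi> x"
    using fg_proj_lift[OF P lV Q \<pi>V _ \<pi>] by blast
  define H where
    "H = {h \<in> Homs \<Lambda> P P. h ` carrier P \<subseteq> V \<and> (\<forall>x\<in>carrier P. U +>\<^bsub>P\<^esub> h x = U +>\<^bsub>P\<^esub> x)}"
  have h0V: "h0 x \<in> V" if "x \<in> carrier P" for x using Homs_closed[OF h0(1) that] by simp
  have "h0 \<in> H"
    using h0(2) h0V VP Homs_sub_codomain[OF h0(1) VP] by (auto simp: H_def subset_iff)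
  then have H: "H \<subseteq> Homs \<Lambda> P P" "H \<noteq> {}" by (auto simp: H_def)
  have comp: "compose (carrier P) h h \<in> H" if "h \<in> H" for h
    using that Homs_compose[OF lP(1), of h P h P] Homs_closed[of h \<Lambda> P P]
    by (auto simp: H_def compose_def)
  obtain h where "h \<in> H"
    and dec: "h ` carrier P <+>\<^bsub>P\<^esub> a_kernel P P h = carrier P" "h ` carrier P \<inter> a_kernel P P h = {\<zero>\<^bsub>P\<^esub>}"
    using fitting[OF lP H comp] by metis
  then have h: "h \<in> Homs \<Lambda> P P" "h ` carrier P \<subseteq> V" "\<And>x. x \<in> carrier P \<Longrightarrow> U +>\<^bsub>P\<^esub> h x = U +>\<^bsub>P\<^esub> x"
    by (auto simp: H_def)
  have "Module.submodule (h ` carrier P) \<Lambda> P" "Module.submodule (a_kernel P P h) \<Lambda> P"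
    using submodule_image[OF lP(1,1) h(1) P.submodule_carrier] submodule_kernel[OF lP(1,1) h(1)] by auto
  then consider "h ` carrier P = {\<zero>\<^bsub>P\<^esub>}" | "a_kernel P P h = {\<zero>\<^bsub>P\<^esub>}"
    using ind dec unfolding indecomposable_def by blast
  then show False
  proof cases
    case 1
    have "x \<in> U" if x: "x \<in> carrier P" for x
    proof -
      have "h x = \<zero>\<^bsub>P\<^esub>" using 1 x by blast
      then have "U +>\<^bsub>P\<^esub> x = \<zero>\<^bsub>?Q\<^esub>" using h(3)[OF x] P.quot_zero[OF U'(1)] by simp
      then show ?thesis using P.coset_eq_zero_iff[OF U'(1) x] by simp
    qed
    then show False using U'(2) UP by blast
  next
    case 2
    then have "h ` carrier P = carrier P"
      using surj_of_inj[OF lP h(1)] inj_on_iff_kernel[OF lP(1,1) h(1)] by simp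
    then show False using h(2) V'(2) VP by blast
  qed
qed

text \<open>The radical is the intersection of the maximal submodules, of which there is exactly one.\<close>

lemma mod_rad_maximal:
  assumes P: "P \<in> fg_proj \<Lambda>" and ind: "indecomposable \<Lambda> P"
  shows "maximal_submodule \<Lambda> N P \<longleftrightarrow> N = mod_rad \<Lambda> P"
proof -
  note lP = fg_projD[OF P]
  interpret P: left_module \<Lambda> P by (rule lP(1))
  have "{\<zero>\<^bsub>P\<^esub>} \<noteq> carrier P" using ind by (auto simp: indecomposable_def)
  then obtain U where U: "maximal_submodule \<Lambda> U P"
    using maximal_submodule_above[OF lP P.submodule_zero] by blast
  have "{N. maximal_submodule \<Lambda> N P} = {U}"
    using maximal_submodule_unique[OF P ind] U by blast
  moreover have "U \<subseteq> carrier P" using maximal_submoduleD(1)[OF U] by (simp add: P.submodule_iff)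
  ultimately have "mod_rad \<Lambda> P = U" by (auto simp: mod_rad_def)
  then show ?thesis using U maximal_submodule_unique[OF P ind U] by blast
qed

lemma mod_rad_submodule:
  assumes "P \<in> fg_proj \<Lambda>" "indecomposable \<Lambda> P"
  shows "Module.submodule (mod_rad \<Lambda> P) \<Lambda> P"
  using mod_rad_maximal[OF assms, of "mod_rad \<Lambda> P"] by (auto intro: maximal_submoduleD(1))

lemma simple_mod_top:
  assumes "P \<in> fg_proj \<Lambda>" "indecomposable \<Lambda> P" shows "simple_module \<Lambda> (mod_top \<Lambda> P)"
  unfolding mod_top_def
  using simple_quot[OF fg_projD(1)[OF assms(1)]] mod_rad_maximal[OF assms] by blast

subsection \<open>Homomorphisms from an indecomposable projective to a simple module\<close>

text \<open>Schur's lemma: all nonzero maps \<open>P \<rightarrow> S\<close> have the same kernel, so two of them differ by an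
  endomorphism of \<open>S\<close>; subtracting an eigenvalue leaves a map with a larger kernel, which vanishes.\<close>

lemma hom_to_simple_scalar:
  assumes ac: "algebraically_closed K"
    and P: "P \<in> fg_proj \<Lambda>" and ind: "indecomposable \<Lambda> P" and S: "simple_module \<Lambda> S"
    and f: "f \<in> Homs \<Lambda> P S" "\<exists>x\<in>carrier P. f x \<noteq> \<zero>\<^bsub>S\<^esub>" and g: "g \<in> Homs \<Lambda> P S"
  shows "\<exists>c\<in>carrier K. \<forall>x\<in>carrier P. g x = scalar c \<odot>\<^bsub>S\<^esub> f x"
proof -
  note lP = fg_projD[OF P] and lS = simple_moduleD(1)[OF S]
  interpret P: left_module \<Lambda> P by (rule lP(1))
  interpret S: left_module \<Lambda> S by (rule lS)
  have surj: "f ` carrier P = carrier S" by (rule hom_to_simple_surj[OF lP(1) S f])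
  have kernel: "a_kernel P S h = mod_rad \<Lambda> P" if "h \<in> Homs \<Lambda> P S" "\<exists>x\<in>carrier P. h x \<noteq> \<zero>\<^bsub>S\<^esub>" for h
    using hom_to_simple_kernel[OF lP(1) S that] mod_rad_maximal[OF P ind] by blast
  have ker: "g x = \<zero>\<^bsub>S\<^esub>" if x: "x \<in> carrier P" "f x = \<zero>\<^bsub>S\<^esub>" for x
  proof (rule ccontr)
    assume "g x \<noteq> \<zero>\<^bsub>S\<^esub>"
    then have "a_kernel P S g = a_kernel P S f" using kernel[OF f] kernel[OF g] x by blast
    then show False
      using x \<open>g x \<noteq> \<zero>\<^bsub>S\<^esub>\<close> a_kernel_iff[OF lP(1) lS f(1), of x] a_kernel_iff[OF lP(1) lS g, of x] by simp
  qed
  obtain \<alpha> where \<alpha>H: "\<alpha> \<in> Homs \<Lambda> S S" and \<alpha>: "\<And>x. x \<in> carrier P \<Longrightarrow> \<alpha> (f x) = g x"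
    using factor_through_surj[OF lP(1) lS lS f(1) surj g ker] by blast
  have \<alpha>K: "\<alpha> \<in> Homs K (underlying_space \<Lambda> S) (underlying_space \<Lambda> S)"
    by (rule Homs_underlying[OF \<alpha>H])
  interpret U: vspace K "underlying_space \<Lambda> S" by (rule vspace_underlying[OF lS])
  have "fin_gen \<Lambda> S" by (rule fin_gen_image[OF lP lS f(1) surj])
  then have "U.fin_dim" using fin_gen_iff_fin_dim[OF lS] by simp
  then obtain c s where c: "c \<in> carrier K" and s: "s \<in> carrier S" "s \<noteq> \<zero>\<^bsub>S\<^esub>" "\<alpha> s = scalar c \<odot>\<^bsub>S\<^esub> s"
    using U.eigenvector_exists[OF ac _ _ \<alpha>K] simple_moduleD(2)[OF S] by auto
  have "s \<in> f ` carrier P" using s surj by simp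
  then obtain r where r: "r \<in> carrier P" "f r = s" by blast
  let ?h = "\<lambda>x\<in>carrier P. g x \<oplus>\<^bsub>S\<^esub> scalar (\<ominus>\<^bsub>K\<^esub> c) \<odot>\<^bsub>S\<^esub> f x"
  have fx: "f x \<in> carrier S" "g x \<in> carrier S" if "x \<in> carrier P" for x
    using that Homs_closed[OF f(1)] Homs_closed[OF g] by auto
  have cs: "scalar c \<odot>\<^bsub>S\<^esub> y \<oplus>\<^bsub>S\<^esub> scalar (\<ominus>\<^bsub>K\<^esub> c) \<odot>\<^bsub>S\<^esub> y = \<zero>\<^bsub>S\<^esub>" if y: "y \<in> carrier S" for y
  proof -
    have "scalar c \<odot>\<^bsub>S\<^esub> y \<oplus>\<^bsub>S\<^esub> scalar (\<ominus>\<^bsub>K\<^esub> c) \<odot>\<^bsub>S\<^esub> y = (scalar c \<oplus>\<^bsub>\<Lambda>\<^esub> scalar (\<ominus>\<^bsub>K\<^esub> c)) \<odot>\<^bsub>S\<^esub> y"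
      using c y by (simp add: S.smult_l_distr)
    also have "scalar c \<oplus>\<^bsub>\<Lambda>\<^esub> scalar (\<ominus>\<^bsub>K\<^esub> c) = (c \<oplus>\<^bsub>K\<^esub> \<ominus>\<^bsub>K\<^esub> c) \<odot>\<^bsub>\<Lambda>\<^esub> \<one>\<^bsub>\<Lambda>\<^esub>"
      using c by (simp add: smult_l_distr del: R.r_neg)
    finally show ?thesis using c y by (simp add: R.r_neg)
  qed
  have h: "?h \<in> Homs \<Lambda> P S"
    by (rule Homs_restrictI[OF _ _ _ lP(1)])
      (use fx c in \<open>auto simp: Homs_add[OF f(1)] Homs_add[OF g] Homs_smult[OF f(1)] Homs_smult[OF g]
        S.smult_closed S.smult_r_distr S.M.a_ac scalar_commute[OF lS]\<close>)
  have "?h x = \<zero>\<^bsub>S\<^esub>" if x: "x \<in> carrier P" for x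
  proof (rule ccontr)
    assume "?h x \<noteq> \<zero>\<^bsub>S\<^esub>"
    then have eq: "a_kernel P S ?h = a_kernel P S f" using kernel[OF f] kernel[OF h] x by blast
    have "g r = scalar c \<odot>\<^bsub>S\<^esub> s" using s \<alpha>[OF r(1)] r by simp
    then have "?h r = \<zero>\<^bsub>S\<^esub>" using r cs[OF s(1)] by simp
    then have "r \<in> a_kernel P S ?h" using r a_kernel_iff[OF lP(1) lS h] by simp
    then have "f r = \<zero>\<^bsub>S\<^esub>" using eq a_kernel_iff[OF lP(1) lS f(1)] by simp
    then show False using r s by simp
  qed
  then have "g x = scalar c \<odot>\<^bsub>S\<^esub> f x" if x: "x \<in> carrier P" for x
  proof -
    have "g x \<oplus>\<^bsub>S\<^esub> scalar (\<ominus>\<^bsub>K\<^esub> c) \<odot>\<^bsub>S\<^esub> f x = scalar c \<odot>\<^bsub>S\<^esub> f x \<oplus>\<^bsub>S\<^esub> scalar (\<ominus>\<^bsub>K\<^esub> c) \<odot>\<^bsub>S\<^esub> f x"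
      using \<open>\<And>x. x \<in> carrier P \<Longrightarrow> ?h x = \<zero>\<^bsub>S\<^esub>\<close>[OF x] x cs[OF fx(1)[OF x]] by simp
    then show ?thesis using fx[OF x] c by (simp add: S.smult_closed)
  qed
  then show ?thesis using c by blast
qed

text \<open>A nonzero map \<open>P \<rightarrow> S\<close> is onto with kernel \<open>rad P\<close>, which forces \<open>S\<close> to be the top of \<open>P\<close>; in that
  case all maps are multiples of one.\<close>

lemma hom_dim_simple:
  assumes ac: "algebraically_closed K"
    and P: "P \<in> fg_proj \<Lambda>" and ind: "indecomposable \<Lambda> P" and S: "simple_module \<Lambda> S"
  shows "hom_dim K \<Lambda> P S = (if mod_iso \<Lambda> S (mod_top \<Lambda> P) then 1 else 0)"
proof -
  note lP = fg_projD[OF P] and lS = simple_moduleD(1)[OF S]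
  interpret P: left_module \<Lambda> P by (rule lP(1))
  interpret S: left_module \<Lambda> S by (rule lS)
  have T: "simple_module \<Lambda> (mod_top \<Lambda> P)" by (rule simple_mod_top[OF P ind])
  note lT = simple_moduleD(1)[OF T]
  interpret T: left_module \<Lambda> "mod_top \<Lambda> P" by (rule lT)
  note rad' = mod_rad_submodule[OF P ind]
  show ?thesis
  proof (cases "\<exists>f\<in>Homs \<Lambda> P S. \<exists>x\<in>carrier P. f x \<noteq> \<zero>\<^bsub>S\<^esub>")
    case True
    then obtain f where f: "f \<in> Homs \<Lambda> P S" "\<exists>x\<in>carrier P. f x \<noteq> \<zero>\<^bsub>S\<^esub>" by blast
    have "a_kernel P S f = mod_rad \<Lambda> P"
      using hom_to_simple_kernel[OF lP(1) S f] mod_rad_maximal[OF P ind] by blast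
    then have iso: "mod_iso \<Lambda> S (mod_top \<Lambda> P)"
      using mod_iso_quot_kernel[OF lP(1) lS f(1) hom_to_simple_surj[OF lP(1) S f]] by (simp add: mod_top_def)
    let ?V = "hom_space \<Lambda> P S"
    interpret V: vspace K ?V by (rule vspace_hom_space[OF lP(1) lS])
    have fV: "f \<in> carrier ?V" using f by simp
    have "g \<in> V.span {f}" if "g \<in> carrier ?V" for g
    proof -
      have g: "g \<in> Homs \<Lambda> P S" using that by simp
      then obtain c where c: "c \<in> carrier K" "\<forall>x\<in>carrier P. g x = scalar c \<odot>\<^bsub>S\<^esub> f x"
        using hom_to_simple_scalar[OF ac P ind S f] by blast
      have "g = c \<odot>\<^bsub>?V\<^esub> f"
        using c V.smult_closed[OF c(1) fV] by (intro Homs_eqI[OF g, of "c \<odot>\<^bsub>?V\<^esub> f"]) auto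
      moreover have "Module.submodule (V.span {f}) K ?V"
        using V.span_is_subspace[of "{f}"] fV by (simp add: V.subspace_iff)
      moreover have "f \<in> V.span {f}" using V.in_own_span[of "{f}"] fV by blast
      ultimately show ?thesis
        using c(1) unfolding left_module.submodule_iff[OF V.left_module] by simp
    qed
    moreover have "V.span {f} \<subseteq> carrier ?V" using V.span_is_subset2[of "{f}"] fV by blast
    ultimately have "V.span {f} = carrier ?V" by blast
    moreover have "f \<noteq> \<zero>\<^bsub>?V\<^esub>" using f(2) by auto
    ultimately show ?thesis using V.dim1I[of f] fV iso by (simp add: hom_dim_def)
  next
    case False
    have "\<not> mod_iso \<Lambda> S (mod_top \<Lambda> P)"
    proof
      assume "mod_iso \<Lambda> S (mod_top \<Lambda> P)"
      then obtain \<theta> where \<theta>: "\<theta> \<in> Homs \<Lambda> S (mod_top \<Lambda> P)" "bij_betw \<theta> (carrier S) (carrier (mod_top \<Lambda> P))"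
        by (auto simp: mod_iso_def)
      obtain \<eta> where \<eta>: "\<eta> \<in> Homs \<Lambda> (mod_top \<Lambda> P) S" and \<theta>\<eta>: "\<And>y. y \<in> carrier (mod_top \<Lambda> P) \<Longrightarrow> \<theta> (\<eta> y) = y"
        using mod_iso_inverse[OF lS lT \<theta>] by metis
      let ?\<pi> = "\<lambda>x\<in>carrier P. mod_rad \<Lambda> P +>\<^bsub>P\<^esub> x"
      have \<pi>: "?\<pi> \<in> Homs \<Lambda> P (mod_top \<Lambda> P)"
        unfolding mod_top_def by (rule P.quot_proj_Homs[OF rad'])
      have "\<eta> y = \<zero>\<^bsub>S\<^esub>" if "y \<in> carrier (mod_top \<Lambda> P)" for y
      proof -
        have "y \<in> (\<lambda>x. mod_rad \<Lambda> P +>\<^bsub>P\<^esub> x) ` carrier P"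
          using that by (simp add: mod_top_def P.quot_carrier[OF rad'])
        then obtain x where "x \<in> carrier P" "y = ?\<pi> x" by auto
        then show ?thesis using False Homs_compose[OF lP(1) \<pi> \<eta>] by (auto simp: compose_def)
      qed
      then have "y = \<zero>\<^bsub>mod_top \<Lambda> P\<^esub>" if "y \<in> carrier (mod_top \<Lambda> P)" for y
        using \<theta>\<eta>[OF that] that Homs_zero[OF lS lT \<theta>(1)] by simp
      moreover have "\<zero>\<^bsub>mod_top \<Lambda> P\<^esub> \<in> carrier (mod_top \<Lambda> P)" by (rule T.M.zero_closed)
      ultimately show False using simple_moduleD(2)[OF T] by blast
    qed
    then show ?thesis using hom_dim_zero[OF lP(1) lS] False by auto
  qed
qed

subsection \<open>Composition multiplicities\<close>

lemma composition_series_exists: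
  assumes M: "left_module \<Lambda> M" "fin_gen \<Lambda> M"
  shows "\<exists>l F. composition_series \<Lambda> M l F"
proof -
  interpret M: left_module \<Lambda> M by (rule M(1))
  have "\<exists>l F. F 0 = {\<zero>\<^bsub>M\<^esub>} \<and> F l = N \<and> (\<forall>j\<le>l. Module.submodule (F j) \<Lambda> M) \<and>
      (\<forall>j<l. F j \<subseteq> F (Suc j) \<and> simple_module \<Lambda> (composition_factor M F j))"
    if "Module.submodule N \<Lambda> M" for N
    using that
  proof (induction "kdim (M\<lparr>carrier := N\<rparr>)" arbitrary: N rule: less_induct)
    case less
    show ?case
    proof (cases "N = {\<zero>\<^bsub>M\<^esub>}")
      case True
      then show ?thesis using less.prems by (intro exI[of _ 0] exI[of _ "\<lambda>_. N"]) auto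
    next
      case False
      let ?N = "M\<lparr>carrier := N\<rparr>"
      have lN: "left_module \<Lambda> ?N" by (rule M.left_module_sub[OF less.prems])
      have fN: "fin_gen \<Lambda> ?N" by (rule fin_gen_sub[OF M less.prems])
      obtain U where U: "maximal_submodule \<Lambda> U ?N"
        using maximal_submodule_above[OF lN fN left_module.submodule_zero[OF lN]] False by auto
      have UM: "Module.submodule U \<Lambda> M" "U \<subseteq> N"
        using maximal_submoduleD(1)[OF U] M.submodule_sub_iff[OF less.prems] by auto
      have "kdim (M\<lparr>carrier := U\<rparr>) < kdim ?N"
        using kdim_sub_less'[OF M UM(1) less.prems] UM(2) maximal_submoduleD(2)[OF U] by auto
      from less.hyps[OF this UM(1)] obtain l F where F: "F 0 = {\<zero>\<^bsub>M\<^esub>}" "F l = U" "\<forall>j\<le>l. Module.submodule (F j) \<Lambda> M"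
        "\<forall>j<l. F j \<subseteq> F (Suc j) \<and> simple_module \<Lambda> (composition_factor M F j)"
        by (elim exE conjE) (rule that)
      let ?F = "F(Suc l := N)"
      have "simple_module \<Lambda> (composition_factor M ?F l)"
        using simple_quot[OF lN U] F(2) by (simp add: composition_factor_def)
      then have "\<forall>j<Suc l. ?F j \<subseteq> ?F (Suc j) \<and> simple_module \<Lambda> (composition_factor M ?F j)"
        using F UM(2) by (auto simp: less_Suc_eq composition_factor_def)
      then show ?thesis using F less.prems by (intro exI[of _ "Suc l"] exI[of _ ?F]) (auto simp: le_Suc_eq)
    qed
  qed
  from this[OF M.submodule_carrier] show ?thesis unfolding composition_series_def by blast
qed

text \<open>Since \<open>Hom(P, -)\<close> is exact and counts the top of \<open>P\<close> among the simple modules, its dimension at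
  \<open>M\<close> is the number of composition factors isomorphic to that top, for every composition series.\<close>

lemma hom_dim_composition_series:
  assumes ac: "algebraically_closed K" and P: "P \<in> fg_proj \<Lambda>" and ind: "indecomposable \<Lambda> P"
    and M: "left_module \<Lambda> M" "fin_gen \<Lambda> M" and F: "composition_series \<Lambda> M l F"
  shows "hom_dim K \<Lambda> P M = card {j. j < l \<and> mod_iso \<Lambda> (composition_factor M F j) (mod_top \<Lambda> P)}"
proof -
  interpret M: left_module \<Lambda> M by (rule M(1))
  note lP = fg_projD(1)[OF P]
  have F0: "F 0 = {\<zero>\<^bsub>M\<^esub>}" and Fl: "F l = carrier M" and sub: "\<And>j. j \<le> l \<Longrightarrow> Module.submodule (F j) \<Lambda> M"
    and inc: "\<And>j. j < l \<Longrightarrow> F j \<subseteq> F (Suc j)"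
    and simple: "\<And>j. j < l \<Longrightarrow> simple_module \<Lambda> (composition_factor M F j)"
    using F by (auto simp: composition_series_def)
  let ?iso = "\<lambda>j. mod_iso \<Lambda> (composition_factor M F j) (mod_top \<Lambda> P)"
  have "hom_dim K \<Lambda> P (M\<lparr>carrier := F j\<rparr>) = card {i. i < j \<and> ?iso i}" if "j \<le> l" for j
    using that
  proof (induction j)
    case 0
    have "f x = \<zero>\<^bsub>M\<^esub>" if "f \<in> Homs \<Lambda> P (M\<lparr>carrier := F 0\<rparr>)" "x \<in> carrier P" for f x
      using Homs_closed[OF that] F0 by simp
    then show ?case
      using hom_dim_zero[OF lP M.left_module_sub[OF sub[OF 0]]] by simp
  next
    case (Suc j)
    let ?X = "M\<lparr>carrier := F (Suc j)\<rparr>"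
    have "Module.submodule (F j) \<Lambda> ?X"
      using Suc.prems sub inc by (simp add: M.submodule_sub_iff)
    then have "hom_dim K \<Lambda> P ?X = hom_dim K \<Lambda> P (M\<lparr>carrier := F j\<rparr>)
        + hom_dim K \<Lambda> P (composition_factor M F j)"
      using hom_dim_quot[OF P M.left_module_sub[OF sub[OF Suc.prems]] fin_gen_sub[OF M sub[OF Suc.prems]]]
      by (simp add: composition_factor_def)
    also have "\<dots> = card {i. i < j \<and> ?iso i} + (if ?iso j then 1 else 0)"
      using Suc hom_dim_simple[OF ac P ind simple[of j]] by simp
    also have "\<dots> = card {i. i < Suc j \<and> ?iso i}"
    proof -
      have "{i. i < Suc j \<and> ?iso i} = {i. i < j \<and> ?iso i} \<union> (if ?iso j then {j} else {})"
        by (auto simp: less_Suc_eq)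
      then show ?thesis by auto
    qed
    finally show ?case .
  qed
  from this[of l] show ?thesis by (simp add: Fl)
qed

lemma comp_mult_eq_hom_dim:
  assumes "algebraically_closed K" and "P \<in> fg_proj \<Lambda>" and "indecomposable \<Lambda> P"
    and "left_module \<Lambda> M" "fin_gen \<Lambda> M"
  shows "comp_mult \<Lambda> M (mod_top \<Lambda> P) = hom_dim K \<Lambda> P M"
  unfolding comp_mult_def
proof (rule the_equality)
  show "\<exists>l F. composition_series \<Lambda> M l F \<and>
      hom_dim K \<Lambda> P M = card {j. j < l \<and> mod_iso \<Lambda> (composition_factor M F j) (mod_top \<Lambda> P)}"
    using composition_series_exists[OF assms(4,5)] hom_dim_composition_series[OF assms] by blast
qed (use hom_dim_composition_series[OF assms] in auto)

subsection \<open>An indecomposable projective is determined by its top\<close>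

text \<open>Lift the isomorphism of the tops along \<open>Q \<rightarrow> top Q\<close>. If the lift were not onto, its image would lie in
  the only maximal submodule \<open>rad Q\<close>, and the isomorphism would be zero.\<close>

lemma surj_of_mod_top_iso:
  assumes P: "P \<in> fg_proj \<Lambda>" "indecomposable \<Lambda> P" and Q: "Q \<in> fg_proj \<Lambda>" "indecomposable \<Lambda> Q"
    and iso: "mod_iso \<Lambda> (mod_top \<Lambda> P) (mod_top \<Lambda> Q)"
  obtains h where "h \<in> Homs \<Lambda> P Q" "h ` carrier P = carrier Q"
proof -
  note lP = fg_projD[OF P(1)] and lQ = fg_projD[OF Q(1)]
  interpret P: left_module \<Lambda> P by (rule lP(1))
  interpret Q: left_module \<Lambda> Q by (rule lQ(1))
  interpret TQ: left_module \<Lambda> "mod_top \<Lambda> Q" by (rule simple_moduleD(1)[OF simple_mod_top[OF Q]])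
  let ?rP = "mod_rad \<Lambda> P" and ?rQ = "mod_rad \<Lambda> Q"
  note rP = mod_rad_submodule[OF P] and rQ = mod_rad_submodule[OF Q]
  note TP = simple_moduleD(1)[OF simple_mod_top[OF P]] and TQ = simple_moduleD(1)[OF simple_mod_top[OF Q]]
  let ?\<pi> = "\<lambda>x\<in>carrier P. ?rP +>\<^bsub>P\<^esub> x" and ?\<rho> = "\<lambda>x\<in>carrier Q. ?rQ +>\<^bsub>Q\<^esub> x"
  have \<pi>: "?\<pi> \<in> Homs \<Lambda> P (mod_top \<Lambda> P)" unfolding mod_top_def by (rule P.quot_proj_Homs[OF rP])
  have \<rho>: "?\<rho> \<in> Homs \<Lambda> Q (mod_top \<Lambda> Q)" unfolding mod_top_def by (rule Q.quot_proj_Homs[OF rQ])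
  have \<rho>surj: "?\<rho> ` carrier Q = carrier (mod_top \<Lambda> Q)" by (simp add: mod_top_def Q.quot_carrier[OF rQ])
  have \<pi>surj: "?\<pi> ` carrier P = carrier (mod_top \<Lambda> P)" by (simp add: mod_top_def P.quot_carrier[OF rP])
  obtain \<theta> where \<theta>: "\<theta> \<in> Homs \<Lambda> (mod_top \<Lambda> P) (mod_top \<Lambda> Q)"
    "\<theta> ` carrier (mod_top \<Lambda> P) = carrier (mod_top \<Lambda> Q)"
    using iso by (auto simp: mod_iso_def bij_betw_def)
  let ?f = "compose (carrier P) \<theta> ?\<pi>"
  have f: "?f \<in> Homs \<Lambda> P (mod_top \<Lambda> Q)" by (rule Homs_compose[OF lP(1) \<pi> \<theta>(1)])
  have fsurj: "?f ` carrier P = carrier (mod_top \<Lambda> Q)"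
    unfolding \<theta>(2)[symmetric] \<pi>surj[symmetric] by (auto simp: compose_def)
  obtain h where h: "h \<in> Homs \<Lambda> P Q" "\<And>x. x \<in> carrier P \<Longrightarrow> ?\<rho> (h x) = ?f x"
    using fg_proj_lift[OF P(1) lQ(1) TQ \<rho> \<rho>surj f] by blast
  have "h ` carrier P = carrier Q"
  proof (rule ccontr)
    assume ne: "h ` carrier P \<noteq> carrier Q"
    obtain U where U: "maximal_submodule \<Lambda> U Q" "h ` carrier P \<subseteq> U"
      using maximal_submodule_above[OF lQ submodule_image[OF lP(1) lQ(1) h(1) P.submodule_carrier] ne] by blast
    then have "U = ?rQ" using mod_rad_maximal[OF Q] by blast
    then have "?f x = \<zero>\<^bsub>mod_top \<Lambda> Q\<^esub>" if "x \<in> carrier P" for x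
      using h(2)[OF that] U(2) that Homs_closed[OF h(1) that] Q.coset_eq_zero_iff[OF rQ, of "h x"]
      by (auto simp: mod_top_def)
    then have "carrier (mod_top \<Lambda> Q) \<subseteq> {\<zero>\<^bsub>mod_top \<Lambda> Q\<^esub>}" unfolding fsurj[symmetric] by blast
    moreover have "\<zero>\<^bsub>mod_top \<Lambda> Q\<^esub> \<in> carrier (mod_top \<Lambda> Q)" by (rule TQ.M.zero_closed)
    ultimately show False using simple_moduleD(2)[OF simple_mod_top[OF Q]] by blast
  qed
  then show thesis using that h(1) by blast
qed

text \<open>The surjections \<open>P \<rightarrow> Q\<close> and \<open>Q \<rightarrow> P\<close> force equal dimensions.\<close>

lemma mod_iso_of_mod_top_iso:
  assumes P: "P \<in> fg_proj \<Lambda>" "indecomposable \<Lambda> P" and Q: "Q \<in> fg_proj \<Lambda>" "indecomposable \<Lambda> Q"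
    and iso: "mod_iso \<Lambda> (mod_top \<Lambda> P) (mod_top \<Lambda> Q)"
  shows "mod_iso \<Lambda> P Q"
proof -
  note lP = fg_projD[OF P(1)] and lQ = fg_projD[OF Q(1)]
  note TP = simple_moduleD(1)[OF simple_mod_top[OF P]] and TQ = simple_moduleD(1)[OF simple_mod_top[OF Q]]
  obtain h where h: "h \<in> Homs \<Lambda> P Q" "h ` carrier P = carrier Q"
    using surj_of_mod_top_iso[OF P Q iso] by blast
  obtain h' where h': "h' \<in> Homs \<Lambda> Q P" "h' ` carrier Q = carrier P"
    using surj_of_mod_top_iso[OF Q P mod_iso_sym[OF TP TQ iso]] by blast
  have "kdim P \<le> kdim Q"
    using kdim_rank_nullity[OF lQ lP(1) h'(1)] h'(2) by simp
  then show ?thesis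
    using bij_of_surj[OF lP lQ(1) h] h(1) unfolding mod_iso_def by blast
qed

end

section \<open>The Grothendieck group and g-vectors\<close>

lemma K0_relations_subgroup: "subgroup (K0_relations \<Lambda>) (free_Abelian_group (fg_proj \<Lambda>))"
  unfolding K0_relations_def
proof (rule group.generate_is_subgroup[OF group_free_Abelian_group], rule subsetI)
  fix x assume "x \<in> {frag_of C - frag_of A - frag_of B | A B C.
      A \<in> fg_proj \<Lambda> \<and> B \<in> fg_proj \<Lambda> \<and> C \<in> fg_proj \<Lambda> \<and> mod_iso \<Lambda> C (direct_sum A B)}"
  then obtain A B C where "x = frag_of C - frag_of A - frag_of B"
    and "A \<in> fg_proj \<Lambda>" "B \<in> fg_proj \<Lambda>" "C \<in> fg_proj \<Lambda>" by blast
  then show "x \<in> carrier (free_Abelian_group (fg_proj \<Lambda>))"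
    using keys_diff[of "frag_of C - frag_of A" "frag_of B"] keys_diff[of "frag_of C" "frag_of A"] by auto
qed

lemma K0_relations_closed:
  assumes "c \<in> K0_relations \<Lambda>" "d \<in> K0_relations \<Lambda>"
  shows "c + d \<in> K0_relations \<Lambda>" "- c \<in> K0_relations \<Lambda>" "c - d \<in> K0_relations \<Lambda>"
proof -
  note s = K0_relations_subgroup[of \<Lambda>]
  have k: "Poly_Mapping.keys x \<subseteq> fg_proj \<Lambda>" if "x \<in> K0_relations \<Lambda>" for x
    using subgroup.mem_carrier[OF s that] by simp
  show "c + d \<in> K0_relations \<Lambda>" using subgroup.m_closed[OF s assms] by simp
  have neg: "- x \<in> K0_relations \<Lambda>" if "x \<in> K0_relations \<Lambda>" for x
    using subgroup.m_inv_closed[OF s that] k[OF that] by simp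
  show "- c \<in> K0_relations \<Lambda>" by (rule neg[OF assms(1)])
  show "c - d \<in> K0_relations \<Lambda>" using subgroup.m_closed[OF s assms(1) neg[OF assms(2)]] by simp
qed

lemma K0_relations_zero: "0 \<in> K0_relations \<Lambda>"
  using subgroup.one_closed[OF K0_relations_subgroup[of \<Lambda>]] by simp

lemma K0_relations_direct_sum:
  assumes "C \<in> fg_proj \<Lambda>" "A \<in> fg_proj \<Lambda>" "B \<in> fg_proj \<Lambda>" "mod_iso \<Lambda> C (direct_sum A B)"
  shows "frag_of C - frag_of A - frag_of B \<in> K0_relations \<Lambda>"
  unfolding K0_relations_def by (rule generate.incl) (use assms in blast)

lemma K0_coset_eq_iff:
  assumes "Poly_Mapping.keys c \<subseteq> fg_proj \<Lambda>" "Poly_Mapping.keys d \<subseteq> fg_proj \<Lambda>"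
  shows "K0_relations \<Lambda> #>\<^bsub>free_Abelian_group (fg_proj \<Lambda>)\<^esub> c = K0_relations \<Lambda> #>\<^bsub>free_Abelian_group (fg_proj \<Lambda>)\<^esub> d
    \<longleftrightarrow> c - d \<in> K0_relations \<Lambda>"
proof -
  have coset: "x \<in> K0_relations \<Lambda> #>\<^bsub>free_Abelian_group (fg_proj \<Lambda>)\<^esub> y \<longleftrightarrow> x - y \<in> K0_relations \<Lambda>" for x y
    by (auto simp: r_coset_def intro!: bexI[of _ "x - y"])
  show ?thesis
  proof
    assume "K0_relations \<Lambda> #>\<^bsub>free_Abelian_group (fg_proj \<Lambda>)\<^esub> c
      = K0_relations \<Lambda> #>\<^bsub>free_Abelian_group (fg_proj \<Lambda>)\<^esub> d"
    then show "c - d \<in> K0_relations \<Lambda>" using coset[of c c] coset[of c d] K0_relations_zero[of \<Lambda>] by simp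
  next
    assume cd: "c - d \<in> K0_relations \<Lambda>"
    have "x - c \<in> K0_relations \<Lambda> \<longleftrightarrow> x - d \<in> K0_relations \<Lambda>" for x
      using K0_relations_closed(1)[OF _ cd, of "x - c"] K0_relations_closed(3)[OF _ cd, of "x - d"] by auto
    then show "K0_relations \<Lambda> #>\<^bsub>free_Abelian_group (fg_proj \<Lambda>)\<^esub> c
      = K0_relations \<Lambda> #>\<^bsub>free_Abelian_group (fg_proj \<Lambda>)\<^esub> d"
      using coset by blast
  qed
qed

text \<open>Expressions in \<open>K\<^sub>0\<close> are computed in the free abelian group.\<close>

lemma K0_coset_group_hom:
  "group_hom (free_Abelian_group (fg_proj \<Lambda>)) (K0_proj \<Lambda>)
    (\<lambda>c. K0_relations \<Lambda> #>\<^bsub>free_Abelian_group (fg_proj \<Lambda>)\<^esub> c)"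
proof -
  interpret G: comm_group "free_Abelian_group (fg_proj \<Lambda>)" by (rule abelian_free_Abelian_group)
  interpret N: normal "K0_relations \<Lambda>" "free_Abelian_group (fg_proj \<Lambda>)"
    using K0_relations_subgroup G.subgroup_imp_normal by blast
  show ?thesis
    unfolding K0_proj_def
    by (intro group_hom.intro group_hom_axioms.intro N.r_coset_hom_Mod N.factorgroup_is_group) auto
qed

lemma K0_comm_group: "comm_group (K0_proj \<Lambda>)"
  unfolding K0_proj_def
  by (rule comm_group.abelian_FactGroup[OF abelian_free_Abelian_group K0_relations_subgroup])

lemma K0_finprod:
  fixes P :: "nat \<Rightarrow> 'a fg_univ"
  assumes "finite I" "\<And>i. i \<in> I \<Longrightarrow> P i \<in> fg_proj \<Lambda>"
  shows "finprod (K0_proj \<Lambda>) (\<lambda>i. K0_class \<Lambda> (P i) [^]\<^bsub>K0_proj \<Lambda>\<^esub> (g i :: int)) I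
    = K0_relations \<Lambda> #>\<^bsub>free_Abelian_group (fg_proj \<Lambda>)\<^esub> (\<Sum>i\<in>I. frag_cmul (g i) (frag_of (P i)))
    \<and> Poly_Mapping.keys (\<Sum>i\<in>I. frag_cmul (g i) (frag_of (P i))) \<subseteq> fg_proj \<Lambda>"
  using assms
proof (induction I rule: finite_induct)
  case empty
  interpret h: group_hom "free_Abelian_group (fg_proj \<Lambda>)" "K0_proj \<Lambda>"
    "\<lambda>c. K0_relations \<Lambda> #>\<^bsub>free_Abelian_group (fg_proj \<Lambda>)\<^esub> c" by (rule K0_coset_group_hom)
  interpret Q: comm_group "K0_proj \<Lambda>" by (rule K0_comm_group)
  show ?case using h.hom_one Q.finprod_empty by simp
next
  case (insert i I)
  let ?G = "free_Abelian_group (fg_proj \<Lambda>)"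
  let ?h = "\<lambda>c. K0_relations \<Lambda> #>\<^bsub>?G\<^esub> c"
  interpret h: group_hom ?G "K0_proj \<Lambda>" ?h by (rule K0_coset_group_hom)
  interpret Q: comm_group "K0_proj \<Lambda>" by (rule K0_comm_group)
  let ?s = "\<Sum>i\<in>I. frag_cmul (g i) (frag_of (P i))"
  have s: "Poly_Mapping.keys ?s \<subseteq> fg_proj \<Lambda>" using insert by simp
  have Pi: "frag_of (P i) \<in> carrier ?G" using insert by simp
  have k: "Poly_Mapping.keys (frag_cmul (g i) (frag_of (P i))) \<subseteq> fg_proj \<Lambda>"
    using insert.prems keys_cmul by (metis insertI1 keys_frag_of order_trans singletonD subsetI)
  have pow: "K0_class \<Lambda> (P j) [^]\<^bsub>K0_proj \<Lambda>\<^esub> g j = ?h (frag_cmul (g j) (frag_of (P j)))"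
    if "j \<in> insert i I" for j
    using h.hom_int_pow[of "frag_of (P j)" "g j"] insert.prems[OF that] by (simp add: K0_class_def)
  have closed: "?h c \<in> carrier (K0_proj \<Lambda>)" if "Poly_Mapping.keys c \<subseteq> fg_proj \<Lambda>" for c
    using h.hom_closed[of c] that by simp
  have cl: "K0_class \<Lambda> (P j) [^]\<^bsub>K0_proj \<Lambda>\<^esub> g j \<in> carrier (K0_proj \<Lambda>)" if "j \<in> insert i I" for j
    using closed[of "frag_of (P j)"] insert.prems[OF that] by (intro h.H.int_pow_closed) (simp add: K0_class_def)
  have "finprod (K0_proj \<Lambda>) (\<lambda>i. K0_class \<Lambda> (P i) [^]\<^bsub>K0_proj \<Lambda>\<^esub> g i) (insert i I)
    = K0_class \<Lambda> (P i) [^]\<^bsub>K0_proj \<Lambda>\<^esub> g i \<otimes>\<^bsub>K0_proj \<Lambda>\<^esub>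
      finprod (K0_proj \<Lambda>) (\<lambda>i. K0_class \<Lambda> (P i) [^]\<^bsub>K0_proj \<Lambda>\<^esub> g i) I"
    using insert.hyps cl by (intro Q.finprod_insert) auto
  also have "\<dots> = ?h (frag_cmul (g i) (frag_of (P i))) \<otimes>\<^bsub>K0_proj \<Lambda>\<^esub> ?h ?s"
    using insert pow by simp
  also have "\<dots> = ?h (frag_cmul (g i) (frag_of (P i)) + ?s)"
    using h.hom_mult[of "frag_cmul (g i) (frag_of (P i))" ?s] k s by simp
  finally have "finprod (K0_proj \<Lambda>) (\<lambda>i. K0_class \<Lambda> (P i) [^]\<^bsub>K0_proj \<Lambda>\<^esub> g i) (insert i I)
    = ?h (frag_cmul (g i) (frag_of (P i)) + ?s)" .
  moreover have "Poly_Mapping.keys (frag_cmul (g i) (frag_of (P i)) + ?s) \<subseteq> fg_proj \<Lambda>"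
    using keys_add[of "frag_cmul (g i) (frag_of (P i))" ?s] k s by blast
  ultimately show ?case using insert.hyps by simp
qed

lemma mod_iso_direct_sum:
  assumes M: "left_module R M" and U: "Module.submodule U R M" and V: "Module.submodule V R M"
    and sum: "U <+>\<^bsub>M\<^esub> V = carrier M" and UV: "U \<inter> V = {\<zero>\<^bsub>M\<^esub>}"
  shows "mod_iso R M (direct_sum (M\<lparr>carrier := U\<rparr>) (M\<lparr>carrier := V\<rparr>))"
proof -
  interpret M: left_module R M by fact
  let ?D = "direct_sum (M\<lparr>carrier := U\<rparr>) (M\<lparr>carrier := V\<rparr>)"
  have D: "left_module R ?D"
    by (rule left_module_direct_sum[OF M.left_module_sub[OF U] M.left_module_sub[OF V]])
  have UM: "U \<subseteq> carrier M" and VM: "V \<subseteq> carrier M" using U V by (auto simp: M.submodule_iff)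
  let ?f = "\<lambda>x\<in>carrier ?D. fst x \<oplus>\<^bsub>M\<^esub> snd x"
  have "?f \<in> Homs R ?D M"
    by (rule Homs_restrictI[OF _ _ _ D])
      (use UM VM in \<open>auto simp: subset_iff M.M.a_ac M.smult_r_distr\<close>)
  moreover have "bij_betw ?f (carrier ?D) (carrier M)"
    unfolding bij_betw_def
  proof
    show "inj_on ?f (carrier ?D)"
      using M.direct_decomposition_unique[OF U V UV] by (auto simp: inj_on_def)
    show "?f ` carrier ?D = carrier M"
    proof
      show "carrier M \<subseteq> ?f ` carrier ?D"
      proof
        fix x assume "x \<in> carrier M"
        then obtain u v where "u \<in> U" "v \<in> V" "x = u \<oplus>\<^bsub>M\<^esub> v" using sum M.set_add_iff by blast
        then show "x \<in> ?f ` carrier ?D" by (intro image_eqI[of _ _ "(u, v)"]) auto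
      qed
    qed (use UM VM in \<open>auto simp: subset_iff\<close>)
  qed
  ultimately show ?thesis using mod_iso_sym[OF D M] unfolding mod_iso_def by blast
qed

text \<open>\<open>0 \<cong> 0 \<oplus> 0\<close> gives \<open>[0] = [0] + [0]\<close>.\<close>

lemma K0_relations_zero_module:
  assumes Z: "Z \<in> fg_proj \<Lambda>" and zero: "carrier Z = {\<zero>\<^bsub>Z\<^esub>}"
  shows "frag_of Z \<in> K0_relations \<Lambda>"
proof -
  note lZ = fg_projD(1)[OF Z]
  interpret Z: left_module \<Lambda> Z by (rule lZ)
  have "(\<lambda>x\<in>carrier Z. (x, x)) \<in> Homs \<Lambda> Z (direct_sum Z Z)"
    by (rule Homs_restrictI[OF _ _ _ lZ]) auto
  moreover have "bij_betw (\<lambda>x\<in>carrier Z. (x, x)) (carrier Z) (carrier (direct_sum Z Z))"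
    using zero by (auto simp: bij_betw_def)
  ultimately have "mod_iso \<Lambda> Z (direct_sum Z Z)" unfolding mod_iso_def by blast
  from K0_relations_direct_sum[OF Z Z Z this] show ?thesis using K0_relations_closed(2) by fastforce
qed

text \<open>The relations mention isomorphism only together with direct sums, so \<open>P \<cong> Q\<close> is used in the form
  \<open>P \<cong> Q \<oplus> 0\<close>.\<close>

lemma K0_relations_iso:
  assumes P: "P \<in> fg_proj \<Lambda>" and Q: "Q \<in> fg_proj \<Lambda>" and iso: "mod_iso \<Lambda> P Q"
  shows "frag_of P - frag_of Q \<in> K0_relations \<Lambda>"
proof -
  note lP = fg_projD(1)[OF P] and lQ = fg_projD(1)[OF Q]
  interpret P: left_module \<Lambda> P by (rule lP)
  interpret Q: left_module \<Lambda> Q by (rule lQ)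
  let ?Z = "Q\<lparr>carrier := {\<zero>\<^bsub>Q\<^esub>}\<rparr>"
  have "{\<zero>\<^bsub>Q\<^esub>} <+>\<^bsub>Q\<^esub> carrier Q = carrier Q"
    by (auto simp: set_eq_iff Q.set_add_iff)
  then have Z: "?Z \<in> fg_proj \<Lambda>"
    using fg_proj_summand[OF Q Q.submodule_zero Q.submodule_carrier] by auto
  obtain \<theta> where \<theta>: "\<theta> \<in> Homs \<Lambda> P Q" "bij_betw \<theta> (carrier P) (carrier Q)"
    using iso by (auto simp: mod_iso_def)
  let ?f = "\<lambda>x\<in>carrier P. (\<theta> x, \<zero>\<^bsub>Q\<^esub>)"
  have "?f \<in> Homs \<Lambda> P (direct_sum Q ?Z)"
    by (rule Homs_restrictI[OF _ _ _ lP]) (auto simp: HomsD[OF \<theta>(1)])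
  moreover have "bij_betw ?f (carrier P) (carrier (direct_sum Q ?Z))"
    using \<theta>(2) by (auto simp: bij_betw_def inj_on_def)
  ultimately have "mod_iso \<Lambda> P (direct_sum Q ?Z)" unfolding mod_iso_def by blast
  from K0_relations_direct_sum[OF P Q Z this] K0_relations_zero_module[OF Z]
  have "(frag_of P - frag_of Q - frag_of ?Z) + frag_of ?Z \<in> K0_relations \<Lambda>"
    by (intro K0_relations_closed(1)) simp_all
  then show ?thesis by simp
qed

lemma indec_proj_repsD:
  assumes "indec_proj_reps \<Lambda> n P"
  shows "i \<in> {1..n} \<Longrightarrow> P i \<in> fg_proj \<Lambda>"
    and "i \<in> {1..n} \<Longrightarrow> indecomposable \<Lambda> (P i)"
    and "\<lbrakk>i \<in> {1..n}; j \<in> {1..n}; mod_iso \<Lambda> (P i) (P j)\<rbrakk> \<Longrightarrow> i = j"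
    and "\<lbrakk>Q \<in> fg_proj \<Lambda>; indecomposable \<Lambda> Q\<rbrakk> \<Longrightarrow> \<exists>i\<in>{1..n}. mod_iso \<Lambda> Q (P i)"
  using assms unfolding indec_proj_reps_def by (blast, blast, blast, blast)

context fd_algebra
begin

text \<open>The linear extension of \<open>P \<mapsto> dim Hom(P, X)\<close>. As \<^const>\<open>frag_extend\<close> takes values in free abelian groups,
  the one on a single generator stands for the integers.\<close>

definition hom_char :: "('a, 'x) module \<Rightarrow> ('a fg_univ \<Rightarrow>\<^sub>0 int) \<Rightarrow> int" where
  "hom_char X c =
    poly_mapping.lookup (frag_extend (\<lambda>P. frag_cmul (int (hom_dim K \<Lambda> P X)) (frag_of ())) c) ()"

lemma hom_char_simps:
  "hom_char X (frag_of P) = int (hom_dim K \<Lambda> P X)"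
  "hom_char X 0 = 0"
  "hom_char X (c + d) = hom_char X c + hom_char X d"
  "hom_char X (c - d) = hom_char X c - hom_char X d"
  "hom_char X (- c) = - hom_char X c"
  "hom_char X (frag_cmul k c) = k * hom_char X c"
  by (simp_all add: hom_char_def frag_extend_add frag_extend_diff frag_extend_minus frag_extend_cmul
      lookup_add lookup_minus)

lemma hom_char_sum: "hom_char X (sum c I) = (\<Sum>i\<in>I. hom_char X (c i))"
  by (induction I rule: infinite_finite_induct) (auto simp: hom_char_simps)

text \<open>\<open>dim Hom(-, X)\<close> is additive on direct sums, so it vanishes on the relations and is a function on
  \<open>K\<^sub>0\<close>.\<close>

lemma hom_char_relations:
  assumes X: "left_module \<Lambda> X" "fin_gen \<Lambda> X" and c: "c \<in> K0_relations \<Lambda>"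
  shows "hom_char X c = 0"
proof -
  let ?S = "{frag_of C - frag_of A - frag_of B | A B C.
        A \<in> fg_proj \<Lambda> \<and> B \<in> fg_proj \<Lambda> \<and> C \<in> fg_proj \<Lambda> \<and> mod_iso \<Lambda> C (direct_sum A B)}"
  have gen: "hom_char X s = 0 \<and> Poly_Mapping.keys s \<subseteq> fg_proj \<Lambda>" if "s \<in> ?S" for s
  proof -
    have "\<exists>A B C. s = frag_of C - frag_of A - frag_of B \<and> A \<in> fg_proj \<Lambda> \<and> B \<in> fg_proj \<Lambda> \<and>
        C \<in> fg_proj \<Lambda> \<and> mod_iso \<Lambda> C (direct_sum A B)"
      using that unfolding mem_Collect_eq .
    then obtain A B C where s: "s = frag_of C - frag_of A - frag_of B"
      and ABC: "A \<in> fg_proj \<Lambda>" "B \<in> fg_proj \<Lambda>" "C \<in> fg_proj \<Lambda>" "mod_iso \<Lambda> C (direct_sum A B)"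
      by blast
    have "hom_char X s = 0"
      using hom_dim_direct_sum[OF fg_projD(1)[OF ABC(1)] fg_projD(1)[OF ABC(2)] ABC(3,4) X]
      by (simp add: s hom_char_simps)
    moreover have "Poly_Mapping.keys s \<subseteq> fg_proj \<Lambda>"
      using keys_diff[of "frag_of C - frag_of A" "frag_of B"] keys_diff[of "frag_of C" "frag_of A"] ABC
      by (auto simp: s)
    ultimately show ?thesis by blast
  qed
  have "c \<in> generate (free_Abelian_group (fg_proj \<Lambda>)) ?S" using c by (simp add: K0_relations_def)
  then show ?thesis
  proof (induction rule: generate.induct)
    case (inv s)
    then show ?case using gen by (simp add: hom_char_simps)
  qed (use gen in \<open>auto simp: hom_char_simps\<close>)
qed

text \<open>The functions \<open>dim Hom(-, S(j))\<close> are the coordinates for the classes of the \<open>P(i)\<close>.\<close>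

lemma hom_dim_indecomposable_top:
  assumes "algebraically_closed K" and reps: "indec_proj_reps \<Lambda> n P"
    and i: "i \<in> {1..n}" and j: "j \<in> {1..n}"
  shows "hom_dim K \<Lambda> (P i) (mod_top \<Lambda> (P j)) = (if i = j then 1 else 0)"
proof -
  note P = indec_proj_repsD(1,2)[OF reps i] indec_proj_repsD(1,2)[OF reps j]
  have T: "simple_module \<Lambda> (mod_top \<Lambda> (P j))" by (rule simple_mod_top[OF P(3,4)])
  have "mod_iso \<Lambda> (mod_top \<Lambda> (P j)) (mod_top \<Lambda> (P i)) \<longleftrightarrow> i = j"
  proof
    assume "mod_iso \<Lambda> (mod_top \<Lambda> (P j)) (mod_top \<Lambda> (P i))"
    then have "mod_iso \<Lambda> (P j) (P i)" by (rule mod_iso_of_mod_top_iso[OF P(3,4) P(1,2)])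
    then show "i = j" using indec_proj_repsD(3)[OF reps j i] by simp
  next
    assume "i = j"
    then show "mod_iso \<Lambda> (mod_top \<Lambda> (P j)) (mod_top \<Lambda> (P i))"
      using Homs_id[OF simple_moduleD(1)[OF T]] unfolding mod_iso_def
      by (intro bexI[of _ "\<lambda>x\<in>carrier (mod_top \<Lambda> (P j)). x"]) (auto simp: bij_betw_def inj_on_def)
  qed
  then show ?thesis using hom_dim_simple[OF assms(1) P(1,2) T] by simp
qed

text \<open>Krull--Schmidt existence: split off direct summands until everything is indecomposable.\<close>

lemma K0_decomposition:
  assumes reps: "indec_proj_reps \<Lambda> n P" and Q: "Q \<in> fg_proj \<Lambda>"
  shows "\<exists>c. frag_of Q - (\<Sum>i=1..n. frag_cmul (c i) (frag_of (P i))) \<in> K0_relations \<Lambda>"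
  using Q
proof (induction "kdim Q" arbitrary: Q rule: less_induct)
  case less
  note Q = less.prems and lQ = fg_projD[OF less.prems]
  interpret Q: left_module \<Lambda> Q by (rule lQ(1))
  consider "carrier Q = {\<zero>\<^bsub>Q\<^esub>}" | "indecomposable \<Lambda> Q"
    | "carrier Q \<noteq> {\<zero>\<^bsub>Q\<^esub>}" "\<not> indecomposable \<Lambda> Q" by blast
  then show ?case
  proof cases
    case 1
    then show ?thesis using K0_relations_zero_module[OF Q] by (intro exI[of _ "\<lambda>_. 0"]) simp
  next
    case 2
    then obtain j where j: "j \<in> {1..n}" "mod_iso \<Lambda> Q (P j)"
      using indec_proj_repsD(4)[OF reps Q] by blast
    then have "frag_of Q - frag_of (P j) \<in> K0_relations \<Lambda>"
      using K0_relations_iso[OF Q indec_proj_repsD(1)[OF reps]] by blast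
    moreover have "(\<Sum>i=1..n. frag_cmul (if i = j then 1 else 0) (frag_of (P i))) = frag_of (P j)"
    proof -
      have "(\<Sum>i=1..n. frag_cmul (if i = j then 1 else 0) (frag_of (P i)))
        = (\<Sum>i=1..n. if i = j then frag_of (P i) else 0)"
        by (intro sum.cong) auto
      then show ?thesis using j by simp
    qed
    ultimately show ?thesis by (intro exI[of _ "\<lambda>i. if i = j then 1 else 0"]) simp
  next
    case 3
    then obtain U V where U: "Module.submodule U \<Lambda> Q" and V: "Module.submodule V \<Lambda> Q"
      and sum: "U <+>\<^bsub>Q\<^esub> V = carrier Q" and UV: "U \<inter> V = {\<zero>\<^bsub>Q\<^esub>}"
      and ne: "U \<noteq> {\<zero>\<^bsub>Q\<^esub>}" "V \<noteq> {\<zero>\<^bsub>Q\<^esub>}"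
      unfolding indecomposable_def by blast
    have UQ: "U \<subseteq> carrier Q" and VQ: "V \<subseteq> carrier Q" using U V by (auto simp: Q.submodule_iff)
    have "U \<noteq> carrier Q" using UV ne(2) VQ by blast
    moreover have "V \<noteq> carrier Q" using UV ne(1) UQ by blast
    ultimately have less': "kdim (Q\<lparr>carrier := U\<rparr>) < kdim Q" "kdim (Q\<lparr>carrier := V\<rparr>) < kdim Q"
      using kdim_sub_less[OF lQ] U V by auto
    have "V <+>\<^bsub>Q\<^esub> U = carrier Q"
    proof -
      have comm: "v \<oplus>\<^bsub>Q\<^esub> u = u \<oplus>\<^bsub>Q\<^esub> v" if "u \<in> U" "v \<in> V" for u v
        using that UQ VQ Q.M.a_comm by blast
      have "x \<in> V <+>\<^bsub>Q\<^esub> U \<longleftrightarrow> x \<in> U <+>\<^bsub>Q\<^esub> V" for x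
        unfolding Q.set_add_iff using comm by metis
      then show ?thesis using sum by blast
    qed
    then have proj: "Q\<lparr>carrier := U\<rparr> \<in> fg_proj \<Lambda>" "Q\<lparr>carrier := V\<rparr> \<in> fg_proj \<Lambda>"
      using fg_proj_summand[OF Q U V sum UV] fg_proj_summand[OF Q V U] UV by (auto simp: Int_commute)
    obtain c d where
      c: "frag_of (Q\<lparr>carrier := U\<rparr>) - (\<Sum>i=1..n. frag_cmul (c i) (frag_of (P i))) \<in> K0_relations \<Lambda>" and
      d: "frag_of (Q\<lparr>carrier := V\<rparr>) - (\<Sum>i=1..n. frag_cmul (d i) (frag_of (P i))) \<in> K0_relations \<Lambda>"
      using less.hyps less' proj by blast
    have "frag_of Q - frag_of (Q\<lparr>carrier := U\<rparr>) - frag_of (Q\<lparr>carrier := V\<rparr>) \<in> K0_relations \<Lambda>"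
      by (rule K0_relations_direct_sum[OF Q proj mod_iso_direct_sum[OF lQ(1) U V sum UV]])
    from K0_relations_closed(1)[OF K0_relations_closed(1)[OF this c] d]
    have "frag_of Q - (\<Sum>i=1..n. frag_cmul (c i + d i) (frag_of (P i))) \<in> K0_relations \<Lambda>"
      by (simp add: frag_cmul_distrib sum.distrib algebra_simps)
    then show ?thesis by (rule exI[of _ "\<lambda>i. c i + d i"])
  qed
qed

text \<open>The g-vector exists by decomposition; it is unique because the additive functions
  \<open>dim Hom(-, S(j))\<close> read off its coordinates.\<close>

lemma g_vector_relation:
  assumes ac: "algebraically_closed K" and reps: "indec_proj_reps \<Lambda> n P"
    and pres: "the_min_pres \<Lambda> M = (P1, P0, f)" and P1: "P1 \<in> fg_proj \<Lambda>" and P0: "P0 \<in> fg_proj \<Lambda>"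
  shows "frag_of P0 - frag_of P1 - (\<Sum>i=1..n. frag_cmul (g_vector \<Lambda> n P M i) (frag_of (P i)))
    \<in> K0_relations \<Lambda>"
proof -
  note P = indec_proj_repsD(1)[OF reps]
  let ?G = "free_Abelian_group (fg_proj \<Lambda>)"
  let ?h = "\<lambda>c. K0_relations \<Lambda> #>\<^bsub>?G\<^esub> c"
  interpret h: group_hom ?G "K0_proj \<Lambda>" ?h by (rule K0_coset_group_hom)
  let ?c = "frag_of P0 - frag_of P1"
  let ?s = "\<lambda>g. \<Sum>i=1..n. frag_cmul (g i) (frag_of (P i))"
  have kc: "Poly_Mapping.keys ?c \<subseteq> fg_proj \<Lambda>" using keys_diff[of "frag_of P0" "frag_of P1"] P0 P1 by auto
  have ks: "Poly_Mapping.keys (?s g) \<subseteq> fg_proj \<Lambda>" for g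
    using K0_finprod[of "{1..n}" P \<Lambda> g] P by blast
  have lhs: "K0_class \<Lambda> P0 \<otimes>\<^bsub>K0_proj \<Lambda>\<^esub> inv\<^bsub>K0_proj \<Lambda>\<^esub> K0_class \<Lambda> P1 = ?h ?c"
    using h.hom_mult[of "frag_of P0" "- frag_of P1"] h.hom_inv[of "frag_of P1"] P0 P1
    by (simp add: K0_class_def)
  define Q where "Q g \<longleftrightarrow> (\<forall>i. i \<notin> {1..n} \<longrightarrow> g i = 0) \<and> ?c - ?s g \<in> K0_relations \<Lambda>" for g :: "nat \<Rightarrow> int"
  have eq: "((\<forall>i. i \<notin> {1..n} \<longrightarrow> g i = 0) \<and>
        K0_class \<Lambda> P0 \<otimes>\<^bsub>K0_proj \<Lambda>\<^esub> inv\<^bsub>K0_proj \<Lambda>\<^esub> K0_class \<Lambda> P1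
          = finprod (K0_proj \<Lambda>) (\<lambda>i. K0_class \<Lambda> (P i) [^]\<^bsub>K0_proj \<Lambda>\<^esub> g i) {1..n}) \<longleftrightarrow> Q g" for g
    using K0_finprod[of "{1..n}" P \<Lambda> g] P K0_coset_eq_iff[OF kc ks[of g]] unfolding Q_def lhs by simp
  have "\<exists>!g. Q g"
  proof (rule ex_ex1I)
    obtain c d where c: "frag_of P0 - ?s c \<in> K0_relations \<Lambda>" and d: "frag_of P1 - ?s d \<in> K0_relations \<Lambda>"
      using K0_decomposition[OF reps P0] K0_decomposition[OF reps P1] by blast
    let ?g = "\<lambda>i. if i \<in> {1..n} then c i - d i else 0"
    have "?s ?g = (\<Sum>i=1..n. frag_cmul (c i) (frag_of (P i)) - frag_cmul (d i) (frag_of (P i)))"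
      by (intro sum.cong) (auto simp: frag_cmul_diff_distrib)
    then have "?c - ?s ?g = (frag_of P0 - ?s c) - (frag_of P1 - ?s d)"
      by (simp add: sum_subtractf)
    then have "?c - ?s ?g \<in> K0_relations \<Lambda>"
        using K0_relations_closed(3)[OF c d] by (simp only:)
      then have "Q ?g" unfolding Q_def by (intro conjI) simp_all
    then show "\<exists>g. Q g" by blast
  next
    fix g g' assume gg: "Q g" "Q g'"
    have "g j = g' j" for j
    proof (cases "j \<in> {1..n}")
      case True
      let ?T = "mod_top \<Lambda> (P j)"
      note ind = indec_proj_repsD(2)[OF reps True]
      note lP = fg_projD[OF P[OF True]]
      interpret Pj: left_module \<Lambda> "P j" by (rule lP(1))
      have T: "left_module \<Lambda> ?T" by (rule simple_moduleD(1)[OF simple_mod_top[OF P[OF True] ind]])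
      note rad = mod_rad_submodule[OF P[OF True] ind]
      have fT: "fin_gen \<Lambda> ?T"
        using fin_gen_image[OF lP Pj.left_module_quot[OF rad] Pj.quot_proj_Homs[OF rad]]
        by (simp add: mod_top_def Pj.quot_carrier[OF rad])
      have coord: "hom_char ?T (?s g) = g j" for g
      proof -
        have "hom_char ?T (?s g) = (\<Sum>i=1..n. g i * int (hom_dim K \<Lambda> (P i) ?T))"
          by (simp add: hom_char_sum hom_char_simps)
        also have "\<dots> = (\<Sum>i=1..n. if i = j then g i else 0)"
          using hom_dim_indecomposable_top[OF ac reps _ True] by (intro sum.cong) auto
        finally show ?thesis using True by simp
      qed
      have "hom_char ?T (?c - ?s g) = 0" "hom_char ?T (?c - ?s g') = 0"
        using gg hom_char_relations[OF T fT] by (auto simp: Q_def)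
      then show ?thesis unfolding hom_char_simps(4) coord by linarith
    qed (use gg in \<open>auto simp: Q_def\<close>)
    then show "g = g'" by blast
  qed
  then have "Q (THE g. Q g)" by (rule theI')
  moreover have "g_vector \<Lambda> n P M = (THE g. Q g)"
    unfolding g_vector_def pres prod.case eq ..
  ultimately show ?thesis by (simp add: Q_def)
qed

text \<open>Evaluate the additive function \<open>dim Hom(-, X)\<close> at \<open>P0 - P1 = \<Sum>i. g\<^sub>i P(i)\<close>; its value at \<open>P(i)\<close> is
  the composition multiplicity \<open>c\<^sub>i\<close>.\<close>

lemma hom_dim_g_vector:
  assumes ac: "algebraically_closed K" and reps: "indec_proj_reps \<Lambda> n P"
    and pres: "the_min_pres \<Lambda> M = (P1, P0, f)" and P1: "P1 \<in> fg_proj \<Lambda>" and P0: "P0 \<in> fg_proj \<Lambda>"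
    and X: "left_module \<Lambda> X" "fin_gen \<Lambda> X"
  shows "int (hom_dim K \<Lambda> P0 X) - int (hom_dim K \<Lambda> P1 X) = vec_dot n (g_vector \<Lambda> n P M) (dim_vector \<Lambda> P X)"
proof -
  have "dim_vector \<Lambda> P X i = int (hom_dim K \<Lambda> (P i) X)" if "i \<in> {1..n}" for i
    using comp_mult_eq_hom_dim[OF ac indec_proj_repsD(1,2)[OF reps that] X]
    by (simp add: dim_vector_def)
  then have "vec_dot n (g_vector \<Lambda> n P M) (dim_vector \<Lambda> P X)
    = (\<Sum>i=1..n. g_vector \<Lambda> n P M i * int (hom_dim K \<Lambda> (P i) X))"
    by (simp add: vec_dot_def)
  then show ?thesis
    using hom_char_relations[OF X g_vector_relation[OF ac reps pres P1 P0]]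
    by (simp add: hom_char_simps hom_char_sum)
qed

end

section \<open>Homomorphisms into the Auslander--Reiten translate\<close>

lemma opp_algebra_simps [simp]:
  "carrier (opp_algebra \<Lambda>) = carrier \<Lambda>" "\<zero>\<^bsub>opp_algebra \<Lambda>\<^esub> = \<zero>\<^bsub>\<Lambda>\<^esub>" "\<one>\<^bsub>opp_algebra \<Lambda>\<^esub> = \<one>\<^bsub>\<Lambda>\<^esub>"
  "x \<oplus>\<^bsub>opp_algebra \<Lambda>\<^esub> y = x \<oplus>\<^bsub>\<Lambda>\<^esub> y" "x \<otimes>\<^bsub>opp_algebra \<Lambda>\<^esub> y = y \<otimes>\<^bsub>\<Lambda>\<^esub> x"
  "c \<odot>\<^bsub>opp_algebra \<Lambda>\<^esub> x = c \<odot>\<^bsub>\<Lambda>\<^esub> x"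
  by (simp_all add: opp_algebra_def)

lemma ring_opp_algebra:
  assumes "ring \<Lambda>" shows "ring (opp_algebra \<Lambda>)"
proof -
  interpret ring \<Lambda> by fact
  show ?thesis
    by (rule ringI)
      (auto simp: m_assoc l_distr r_distr a_ac
        intro!: abelian_groupI monoidI bexI[of _ "\<ominus>\<^bsub>\<Lambda>\<^esub> _"] l_neg)
qed

lemma algebra_dual_simps [simp]:
  "carrier (algebra_dual \<Lambda> M) = Homs \<Lambda> M (regular_module \<Lambda>)"
  "\<zero>\<^bsub>algebra_dual \<Lambda> M\<^esub> = (\<lambda>x\<in>carrier M. \<zero>\<^bsub>\<Lambda>\<^esub>)"
  "g \<oplus>\<^bsub>algebra_dual \<Lambda> M\<^esub> h = (\<lambda>x\<in>carrier M. g x \<oplus>\<^bsub>\<Lambda>\<^esub> h x)"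
  "a \<odot>\<^bsub>algebra_dual \<Lambda> M\<^esub> g = (\<lambda>x\<in>carrier M. g x \<otimes>\<^bsub>\<Lambda>\<^esub> a)"
  by (simp_all add: algebra_dual_def)

lemma left_module_algebra_dual:
  fixes \<Lambda> :: "('k, 'a) module"
  assumes M: "left_module \<Lambda> M" shows "left_module (opp_algebra \<Lambda>) (algebra_dual \<Lambda> M)"
proof -
  interpret M: left_module \<Lambda> M by fact
  show ?thesis
    by (rule left_module_Homs[OF ring_opp_algebra[OF M.R.ring_axioms] M left_module_regular[OF M.R.ring_axioms],
          where act = "\<lambda>a y. y \<otimes>\<^bsub>\<Lambda>\<^esub> a"])
      (auto simp: M.R.l_distr M.R.r_distr M.R.m_assoc)
qed

lemma precompose_algebra_dual:
  fixes \<Lambda> :: "('k, 'a) module"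
  assumes M: "left_module \<Lambda> M" and N: "left_module \<Lambda> N" and f: "f \<in> Homs \<Lambda> N M"
  shows "(\<lambda>g\<in>carrier (algebra_dual \<Lambda> M). compose (carrier N) g f)
    \<in> Homs (opp_algebra \<Lambda>) (algebra_dual \<Lambda> M) (algebra_dual \<Lambda> N)"
  by (rule Homs_restrictI[OF _ _ _ left_module_algebra_dual[OF M]])
    (use Homs_compose[OF N f] Homs_closed[OF f] in \<open>auto simp: compose_def intro!: restrict_ext\<close>)

lemma k_dual_simps [simp]:
  "carrier (k_dual K \<Lambda> M) = Homs K (underlying_space \<Lambda> M) (regular_module K)"
  "\<zero>\<^bsub>k_dual K \<Lambda> M\<^esub> = (\<lambda>x\<in>carrier M. \<zero>\<^bsub>K\<^esub>)"
  "\<phi> \<oplus>\<^bsub>k_dual K \<Lambda> M\<^esub> \<psi> = (\<lambda>x\<in>carrier M. \<phi> x \<oplus>\<^bsub>K\<^esub> \<psi> x)"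
  "a \<odot>\<^bsub>k_dual K \<Lambda> M\<^esub> \<phi> = (\<lambda>x\<in>carrier M. \<phi> (a \<odot>\<^bsub>M\<^esub> x))"
  by (simp_all add: k_dual_def)

context fd_algebra
begin

text \<open>\<open>Hom(Y, X)\<close> is the kernel of \<open>Hom(P0, X) \<rightarrow> Hom(P1, X)\<close>, because \<open>Y\<close> is the cokernel of
  \<open>P1 \<rightarrow> P0\<close>.\<close>

lemma hom_dim_presentation:
  assumes Y: "left_module \<Lambda> Y" and X: "left_module \<Lambda> X" "fin_gen \<Lambda> X"
    and P0: "P0 \<in> fg_proj \<Lambda>" and P1: "left_module \<Lambda> P1" and f: "f \<in> Homs \<Lambda> P1 P0"
    and p: "p \<in> Homs \<Lambda> P0 Y" "p ` carrier P0 = carrier Y" and exact: "f ` carrier P1 = a_kernel P0 Y p"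
  shows "vectorspace.dim K ((hom_space \<Lambda> P1 X)\<lparr>carrier :=
      (\<lambda>h\<in>Homs \<Lambda> P0 X. compose (carrier P1) h f) ` Homs \<Lambda> P0 X\<rparr>) + hom_dim K \<Lambda> Y X = hom_dim K \<Lambda> P0 X"
proof -
  note lP0 = fg_projD(1)[OF P0]
  let ?V0 = "hom_space \<Lambda> P0 X" and ?V1 = "hom_space \<Lambda> P1 X" and ?VY = "hom_space \<Lambda> Y X"
  interpret V0: vspace K ?V0 by (rule vspace_hom_space[OF lP0 X(1)])
  interpret V1: vspace K ?V1 by (rule vspace_hom_space[OF P1 X(1)])
  interpret VY: vspace K ?VY by (rule vspace_hom_space[OF Y X(1)])
  define T where "T = (\<lambda>h\<in>Homs \<Lambda> P0 X. compose (carrier P1) h f)"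
  have T: "T \<in> Homs K ?V0 ?V1" unfolding T_def by (rule precompose_Homs[OF lP0 P1 X(1) f])
  let ?N = "a_kernel ?V0 ?V1 T"
  have N: "Module.submodule ?N K ?V0" by (rule submodule_kernel[OF V0.left_module V1.left_module T])
  have N_iff: "h \<in> ?N \<longleftrightarrow> h \<in> Homs \<Lambda> P0 X \<and> (\<forall>x\<in>carrier P1. h (f x) = \<zero>\<^bsub>X\<^esub>)" for h
    by (auto simp: a_kernel_def kernel_def T_def compose_def fun_eq_iff)
  define S where "S = (\<lambda>k\<in>Homs \<Lambda> Y X. compose (carrier P0) k p)"
  have S: "S \<in> Homs K ?VY ?V0" unfolding S_def by (rule precompose_Homs[OF Y lP0 X(1) p(1)])
  have pf: "p (f x) = \<zero>\<^bsub>Y\<^esub>" if "x \<in> carrier P1" for x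
    using exact that a_kernel_iff[OF lP0 Y p(1)] by blast
  have im: "S ` carrier ?VY = ?N"
  proof
    show "S ` carrier ?VY \<subseteq> ?N"
    proof
      fix h assume "h \<in> S ` carrier ?VY"
      then obtain k where k: "k \<in> Homs \<Lambda> Y X" "h = compose (carrier P0) k p" by (auto simp: S_def)
      then show "h \<in> ?N"
        using Homs_compose[OF lP0 p(1) k(1)] Homs_closed[OF f] pf Homs_zero[OF Y X(1) k(1)]
        by (simp add: N_iff compose_def)
    qed
    show "?N \<subseteq> S ` carrier ?VY"
    proof
      fix h assume "h \<in> ?N"
      then have h: "h \<in> Homs \<Lambda> P0 X" "\<And>x. x \<in> carrier P1 \<Longrightarrow> h (f x) = \<zero>\<^bsub>X\<^esub>" by (auto simp: N_iff)
      have "h x = \<zero>\<^bsub>X\<^esub>" if "x \<in> carrier P0" "p x = \<zero>\<^bsub>Y\<^esub>" for x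
      proof -
        have "x \<in> f ` carrier P1" using that by (simp add: exact a_kernel_iff[OF lP0 Y p(1)])
        then show ?thesis using h(2) by blast
      qed
      then obtain k where k: "k \<in> Homs \<Lambda> Y X" "\<And>x. x \<in> carrier P0 \<Longrightarrow> k (p x) = h x"
        using factor_through_surj[OF lP0 Y X(1) p h(1)] by blast
      have "h = compose (carrier P0) k p"
        using k(2) by (intro Homs_eqI[OF h(1) Homs_compose[OF lP0 p(1) k(1)]]) (simp add: compose_def)
      then show "h \<in> S ` carrier ?VY" using k(1) by (intro image_eqI[of _ _ k]) (auto simp: S_def)
    qed
  qed
  have inj: "inj_on S (carrier ?VY)"
  proof (rule inj_onI)
    fix k k' assume "k \<in> carrier ?VY" "k' \<in> carrier ?VY" and eq: "S k = S k'"
    then have k: "k \<in> Homs \<Lambda> Y X" "k' \<in> Homs \<Lambda> Y X" by auto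
    have *: "k (p x) = k' (p x)" if "x \<in> carrier P0" for x
      using fun_cong[OF eq, of x] k that by (simp add: S_def compose_def)
    have "k y = k' y" if "y \<in> p ` carrier P0" for y using that * by auto
    then show "k = k'" unfolding p(2) by (rule Homs_eqI[OF k])
  qed
  interpret NV: vspace K "?V0\<lparr>carrier := ?N\<rparr>" by (rule vspaceI[OF V0.vectorspace_sub[OF N]])
  have SN: "S \<in> Homs K ?VY (?V0\<lparr>carrier := ?N\<rparr>)"
    using Homs_corestrict[OF VY.left_module V0.left_module S, of ?N] im by simp
  have "bij_betw S (carrier ?VY) (carrier (?V0\<lparr>carrier := ?N\<rparr>))" using inj im by (simp add: bij_betw_def)
  then obtain R where "R \<in> Homs K (?V0\<lparr>carrier := ?N\<rparr>) ?VY"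
    "bij_betw R (carrier (?V0\<lparr>carrier := ?N\<rparr>)) (carrier ?VY)"
    using mod_iso_inverse[OF VY.left_module NV.left_module SN] by metis
  then have "VY.dim = NV.dim"
    using NV.dim_eq_bij[OF VY.vectorspace_axioms] V0.fin_dim_sub[OF fin_dim_hom_space[OF P0 X] N] by blast
  then show ?thesis
    using V0.rank_nullity_Homs[OF V1.vectorspace_axioms T fin_dim_hom_space[OF P0 X]]
    by (simp add: hom_dim_def T_def)
qed

context
  fixes X :: "('a, 'x) module" and P0 P1 :: "'a fg_univ" and f :: "(nat \<Rightarrow> 'a) \<Rightarrow> nat \<Rightarrow> 'a"
  assumes X: "left_module \<Lambda> X" "fin_gen \<Lambda> X"
    and P0: "P0 \<in> fg_proj \<Lambda>" and P1: "P1 \<in> fg_proj \<Lambda>" and f: "f \<in> Homs \<Lambda> P1 P0"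
begin

text \<open>\<open>W\<close> is the image of \<open>Hom(P0, X)\<close> in \<open>Hom(P1, X)\<close>. The right module \<open>Q\<close>, the cokernel of the map
  between the algebra duals of \<open>P0\<close> and \<open>P1\<close>, is \<open>Tr Y\<close> if \<open>f\<close> is the minimal presentation of \<open>Y\<close>.\<close>

private abbreviation (input) "opp \<equiv> opp_algebra \<Lambda>"
private abbreviation (input) "V0 \<equiv> hom_space \<Lambda> P0 X"
private abbreviation (input) "V1 \<equiv> hom_space \<Lambda> P1 X"
private abbreviation (input) "A1 \<equiv> algebra_dual \<Lambda> P1"
private abbreviation (input) "W \<equiv> (\<lambda>h\<in>Homs \<Lambda> P0 X. compose (carrier P1) h f) ` Homs \<Lambda> P0 X"
private abbreviation (input) "N \<equiv> (\<lambda>g. compose (carrier P1) g f) ` carrier (algebra_dual \<Lambda> P0)"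
private abbreviation (input) "Q \<equiv> quot_module A1 N"

private lemmas lP0 = fg_projD(1)[OF P0] and lP1 = fg_projD(1)[OF P1]

interpretation X: left_module \<Lambda> X by (rule X(1))
interpretation P1: left_module \<Lambda> P1 by (rule lP1)
interpretation V0: vspace K V0 by (rule vspace_hom_space[OF lP0 X(1)])
interpretation V1: vspace K V1 by (rule vspace_hom_space[OF lP1 X(1)])
interpretation A1: left_module opp A1 by (rule left_module_algebra_dual[OF lP1])
interpretation VL: left_module K V1 by (rule left_module_hom_space[OF lP1 X(1)])

private lemma T: "(\<lambda>h\<in>Homs \<Lambda> P0 X. compose (carrier P1) h f) \<in> Homs K V0 V1"
  by (rule precompose_Homs[OF lP0 lP1 X(1) f])

private lemma W_sub: "Module.submodule W K V1"
  using submodule_image[OF V0.left_module V1.left_module T left_module.submodule_carrier[OF V0.left_module]]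
  by simp

private lemma N_sub: "Module.submodule N opp A1"
proof -
  have "Module.submodule ((\<lambda>g\<in>carrier (algebra_dual \<Lambda> P0). compose (carrier P1) g f)
      ` carrier (algebra_dual \<Lambda> P0)) opp A1"
    by (rule submodule_image[OF left_module_algebra_dual[OF lP0] left_module_algebra_dual[OF lP1]
          precompose_algebra_dual[OF lP0 lP1 f] left_module.submodule_carrier[OF left_module_algebra_dual[OF lP0]]])
  then show ?thesis by simp
qed

interpretation Q: left_module opp Q by (rule A1.left_module_quot[OF N_sub])

private abbreviation (input) pair :: "((nat \<Rightarrow> 'a) \<Rightarrow> 'a) \<Rightarrow> 'x \<Rightarrow> (nat \<Rightarrow> 'a) \<Rightarrow> 'x" where
  "pair g x \<equiv> (\<lambda>p\<in>carrier P1. g p \<odot>\<^bsub>X\<^esub> x)"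

private abbreviation (input) cls :: "((nat \<Rightarrow> 'a) \<Rightarrow> 'a) \<Rightarrow> ((nat \<Rightarrow> 'a) \<Rightarrow> 'a) set" where
  "cls g \<equiv> N +>\<^bsub>A1\<^esub> g"

private lemma A1_closed: "\<lbrakk>g \<in> carrier A1; p \<in> carrier P1\<rbrakk> \<Longrightarrow> g p \<in> carrier \<Lambda>"
  using Homs_closed[of g \<Lambda> P1 "regular_module \<Lambda>" p] by simp

private lemma pair_closed: "\<lbrakk>g \<in> carrier A1; x \<in> carrier X\<rbrakk> \<Longrightarrow> pair g x \<in> carrier V1"
  using Homs_smult_right[OF lP1 X(1), of g x] by simp

private lemma pair_add_left:
  assumes "g \<in> carrier A1" "g' \<in> carrier A1" "x \<in> carrier X"
  shows "pair (g \<oplus>\<^bsub>A1\<^esub> g') x = pair g x \<oplus>\<^bsub>V1\<^esub> pair g' x"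
  using assms A1_closed[OF assms(1)] A1_closed[OF assms(2)]
  by (auto simp: X.smult_l_distr intro!: restrict_ext)

private lemma pair_add_right:
  assumes "g \<in> carrier A1" "x \<in> carrier X" "y \<in> carrier X"
  shows "pair g (x \<oplus>\<^bsub>X\<^esub> y) = pair g x \<oplus>\<^bsub>V1\<^esub> pair g y"
  using assms A1_closed[OF assms(1)] by (auto simp: X.smult_r_distr intro!: restrict_ext)

private lemma pair_balanced:
  assumes "g \<in> carrier A1" "a \<in> carrier \<Lambda>" "x \<in> carrier X"
  shows "pair (a \<odot>\<^bsub>A1\<^esub> g) x = pair g (a \<odot>\<^bsub>X\<^esub> x)"
  using assms A1_closed[OF assms(1)] by (auto simp: X.smult_assoc intro!: restrict_ext)

private lemma pair_scalar:
  assumes "g \<in> carrier A1" "c \<in> carrier K" "x \<in> carrier X"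
  shows "pair g (scalar c \<odot>\<^bsub>X\<^esub> x) = c \<odot>\<^bsub>V1\<^esub> pair g x"
  using assms A1_closed[OF assms(1)] by (auto simp: scalar_commute[OF X(1), symmetric] intro!: restrict_ext)

private lemma pair_precompose:
  assumes "g \<in> carrier (algebra_dual \<Lambda> P0)" "x \<in> carrier X"
  shows "pair (compose (carrier P1) g f) x = compose (carrier P1) (\<lambda>p\<in>carrier P0. g p \<odot>\<^bsub>X\<^esub> x) f"
  using Homs_closed[OF f] by (auto simp: compose_def intro!: restrict_ext)

text \<open>A functional \<open>\<phi>\<close> on \<open>Hom(P1, X)\<close> that kills the image of \<open>Hom(P0, X)\<close> induces the pairing
  \<open>(x, g) \<mapsto> \<phi> (g(-) x)\<close> of \<open>X\<close> with \<open>Tr Y\<close>, that is, a homomorphism \<open>\<Theta> \<phi>\<close> from \<open>X\<close> to \<open>D Tr Y\<close>. As the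
  elements of \<open>Tr Y\<close> are cosets, the pairing is defined on chosen representatives.\<close>

private definition rep :: "((nat \<Rightarrow> 'a) \<Rightarrow> 'a) set \<Rightarrow> (nat \<Rightarrow> 'a) \<Rightarrow> 'a" where
  "rep C = (SOME g. g \<in> carrier A1 \<and> C = cls g)"

private definition \<Theta> :: "(((nat \<Rightarrow> 'a) \<Rightarrow> 'x) \<Rightarrow> 'k) \<Rightarrow> 'x \<Rightarrow> ((nat \<Rightarrow> 'a) \<Rightarrow> 'a) set \<Rightarrow> 'k" where
  "\<Theta> \<phi> = (\<lambda>x\<in>carrier X. \<lambda>C\<in>carrier Q. \<phi> (pair (rep C) x))"

private lemma rep:
  assumes "g \<in> carrier A1" shows "rep (cls g) \<in> carrier A1" "cls (rep (cls g)) = cls g"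
proof -
  have "\<exists>g'. g' \<in> carrier A1 \<and> cls g = cls g'" using assms by blast
  from someI_ex[OF this] show "rep (cls g) \<in> carrier A1" "cls (rep (cls g)) = cls g"
    unfolding rep_def by simp_all
qed

private lemma Q_cls: "C \<in> carrier Q \<Longrightarrow> \<exists>g\<in>carrier A1. C = cls g"
  unfolding A1.quot_carrier[OF N_sub] by blast

private lemma cls_Q: "g \<in> carrier A1 \<Longrightarrow> cls g \<in> carrier Q"
  unfolding A1.quot_carrier[OF N_sub] by blast

text \<open>Two representatives of a class differ by some \<open>g0 f\<close>, and \<open>g0(f(-)) x\<close> comes from \<open>Hom(P0, X)\<close>, where
  \<open>\<phi>\<close> vanishes.\<close>

private lemma \<Theta>_cls:
  assumes \<phi>: "\<phi> \<in> carrier (annihilator K V1 W)" and g: "g \<in> carrier A1" and x: "x \<in> carrier X"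
  shows "\<Theta> \<phi> x (cls g) = \<phi> (pair g x)"
proof -
  have \<phi>H: "\<phi> \<in> Homs K V1 (regular_module K)" and \<phi>W: "\<And>w. w \<in> W \<Longrightarrow> \<phi> w = \<zero>\<^bsub>K\<^esub>"
    using \<phi> by auto
  let ?r = "rep (cls g)"
  note r = rep[OF g]
  have "?r \<ominus>\<^bsub>A1\<^esub> g \<in> N" using r A1.coset_eq_iff[OF N_sub r(1) g] by simp
  then obtain g0 where g0: "g0 \<in> carrier (algebra_dual \<Lambda> P0)" "?r \<ominus>\<^bsub>A1\<^esub> g = compose (carrier P1) g0 f"
    by blast
  have d: "?r \<ominus>\<^bsub>A1\<^esub> g \<in> carrier A1" using r(1) g by (rule A1.M.minus_closed)
  have "?r = (?r \<ominus>\<^bsub>A1\<^esub> g) \<oplus>\<^bsub>A1\<^esub> g"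
    using r(1) g by (simp add: a_minus_def A1.M.a_assoc A1.M.l_neg del: algebra_dual_simps)
  then have "pair ?r x = pair (?r \<ominus>\<^bsub>A1\<^esub> g) x \<oplus>\<^bsub>V1\<^esub> pair g x"
    using pair_add_left[OF d g x] by simp
  then have "\<phi> (pair ?r x) = \<phi> (pair (?r \<ominus>\<^bsub>A1\<^esub> g) x) \<oplus>\<^bsub>K\<^esub> \<phi> (pair g x)"
    using Homs_add[OF \<phi>H pair_closed[OF d x] pair_closed[OF g x]] by simp
  moreover have "\<phi> (pair (?r \<ominus>\<^bsub>A1\<^esub> g) x) = \<zero>\<^bsub>K\<^esub>"
  proof (rule \<phi>W)
    have "(\<lambda>p\<in>carrier P0. g0 p \<odot>\<^bsub>X\<^esub> x) \<in> Homs \<Lambda> P0 X"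
      using Homs_smult_right[OF lP0 X(1) _ x, of g0] g0(1) by simp
    then show "pair (?r \<ominus>\<^bsub>A1\<^esub> g) x \<in> W"
      unfolding g0(2) pair_precompose[OF g0(1) x] by (intro image_eqI[of _ _ "\<lambda>p\<in>carrier P0. g0 p \<odot>\<^bsub>X\<^esub> x"]) auto
  qed
  moreover have "\<phi> (pair g x) \<in> carrier K" using Homs_closed[OF \<phi>H pair_closed[OF g x]] by simp
  ultimately show ?thesis using x cls_Q[OF g] by (simp add: \<Theta>_def)
qed

private lemma underlying_Q_smult:
  "\<lbrakk>c \<in> carrier K; g \<in> carrier A1\<rbrakk> \<Longrightarrow> c \<odot>\<^bsub>underlying_space opp Q\<^esub> cls g = cls (scalar c \<odot>\<^bsub>A1\<^esub> g)"
  using A1.quot_smult[OF N_sub, of "scalar c" g] by simp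

private lemma \<Theta>_Homs:
  assumes \<phi>: "\<phi> \<in> carrier (annihilator K V1 W)"
  shows "\<Theta> \<phi> \<in> Homs \<Lambda> X (k_dual K opp Q)"
proof -
  have \<phi>H: "\<phi> \<in> Homs K V1 (regular_module K)" using \<phi> by simp
  note val = \<Theta>_cls[OF \<phi>]
  have ext: "\<Theta> \<phi> x \<in> extensional (carrier Q)" if "x \<in> carrier X" for x using that by (simp add: \<Theta>_def)
  have k: "\<phi> (pair g x) \<in> carrier K" if "g \<in> carrier A1" "x \<in> carrier X" for g x
    using Homs_closed[OF \<phi>H pair_closed[OF that]] by simp
  show ?thesis
  proof (rule HomsI)
    show "\<Theta> \<phi> \<in> carrier X \<rightarrow>\<^sub>E carrier (k_dual K opp Q)"
    proof (rule PiE_I)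
      fix x assume x: "x \<in> carrier X"
      have "\<Theta> \<phi> x \<in> Homs K (underlying_space opp Q) (regular_module K)"
      proof (rule HomsI)
        show "\<Theta> \<phi> x \<in> carrier (underlying_space opp Q) \<rightarrow>\<^sub>E carrier (regular_module K)"
        proof (rule PiE_I)
          fix C assume "C \<in> carrier (underlying_space opp Q)"
          then obtain g where "g \<in> carrier A1" "C = cls g" using Q_cls by auto
          then show "\<Theta> \<phi> x C \<in> carrier (regular_module K)" using val k x by simp
        next
          fix C assume "C \<notin> carrier (underlying_space opp Q)"
          then show "\<Theta> \<phi> x C = undefined" using x by (simp add: \<Theta>_def)
        qed
      next
        fix C D assume "C \<in> carrier (underlying_space opp Q)" "D \<in> carrier (underlying_space opp Q)"
        then obtain g g' where g: "g \<in> carrier A1" "g' \<in> carrier A1" "C = cls g" "D = cls g'"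
          using Q_cls by (metis underlying_space_simps(1))
        have "C \<oplus>\<^bsub>Q\<^esub> D = cls (g \<oplus>\<^bsub>A1\<^esub> g')" using g A1.quot_add[OF N_sub] by simp
        moreover have "\<Theta> \<phi> x (cls (g \<oplus>\<^bsub>A1\<^esub> g')) = \<phi> (pair (g \<oplus>\<^bsub>A1\<^esub> g') x)"
          by (rule val[OF A1.M.a_closed[OF g(1,2)] x])
        ultimately show "\<Theta> \<phi> x (C \<oplus>\<^bsub>underlying_space opp Q\<^esub> D) = \<Theta> \<phi> x C \<oplus>\<^bsub>regular_module K\<^esub> \<Theta> \<phi> x D"
          using pair_add_left[OF g(1,2) x] Homs_add[OF \<phi>H pair_closed[OF g(1) x] pair_closed[OF g(2) x]]
            g(3,4) val[OF g(1) x] val[OF g(2) x] by simp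
      next
        fix c C assume c: "c \<in> carrier K" and "C \<in> carrier (underlying_space opp Q)"
        then obtain g where g: "g \<in> carrier A1" "C = cls g" using Q_cls by auto
        have "\<Theta> \<phi> x (cls (scalar c \<odot>\<^bsub>A1\<^esub> g)) = \<phi> (pair (scalar c \<odot>\<^bsub>A1\<^esub> g) x)"
          using c by (intro val[OF A1.smult_closed[OF _ g(1)] x]) simp
        then show "\<Theta> \<phi> x (c \<odot>\<^bsub>underlying_space opp Q\<^esub> C) = c \<odot>\<^bsub>regular_module K\<^esub> \<Theta> \<phi> x C"
          unfolding g(2) underlying_Q_smult[OF c g(1)]
          using pair_balanced[OF g(1) _ x, of "scalar c"] pair_scalar[OF g(1) c x] c
            Homs_smult[OF \<phi>H c pair_closed[OF g(1) x]] val[OF g(1) x] by simp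
      qed
      then show "\<Theta> \<phi> x \<in> carrier (k_dual K opp Q)" by simp
    qed (simp add: \<Theta>_def)
  next
    fix x y assume xy: "x \<in> carrier X" "y \<in> carrier X"
    show "\<Theta> \<phi> (x \<oplus>\<^bsub>X\<^esub> y) = \<Theta> \<phi> x \<oplus>\<^bsub>k_dual K opp Q\<^esub> \<Theta> \<phi> y"
    proof (rule extensionalityI[of _ "carrier Q"])
      fix C assume C: "C \<in> carrier Q"
      then obtain g where g: "g \<in> carrier A1" "C = cls g" using Q_cls by blast
      show "\<Theta> \<phi> (x \<oplus>\<^bsub>X\<^esub> y) C = (\<Theta> \<phi> x \<oplus>\<^bsub>k_dual K opp Q\<^esub> \<Theta> \<phi> y) C"
        using C g xy val[OF g(1)] pair_add_right[OF g(1) xy]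
          Homs_add[OF \<phi>H pair_closed[OF g(1) xy(1)] pair_closed[OF g(1) xy(2)]] by simp
    qed (use xy ext[of "x \<oplus>\<^bsub>X\<^esub> y"] in simp_all)
  next
    fix a x assume ax: "a \<in> carrier \<Lambda>" "x \<in> carrier X"
    have axX: "a \<odot>\<^bsub>X\<^esub> x \<in> carrier X" using ax by (rule X.smult_closed)
    show "\<Theta> \<phi> (a \<odot>\<^bsub>X\<^esub> x) = a \<odot>\<^bsub>k_dual K opp Q\<^esub> \<Theta> \<phi> x"
    proof (rule extensionalityI[of _ "carrier Q"])
      fix C assume C: "C \<in> carrier Q"
      then obtain g where g: "g \<in> carrier A1" "C = cls g" using Q_cls by blast
      have "a \<odot>\<^bsub>Q\<^esub> cls g = cls (a \<odot>\<^bsub>A1\<^esub> g)" using A1.quot_smult[OF N_sub, of a g] ax g by simp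
      moreover have "\<Theta> \<phi> x (cls (a \<odot>\<^bsub>A1\<^esub> g)) = \<phi> (pair (a \<odot>\<^bsub>A1\<^esub> g) x)"
        using ax by (intro val[OF A1.smult_closed[OF _ g(1)]]) simp_all
      ultimately show "\<Theta> \<phi> (a \<odot>\<^bsub>X\<^esub> x) C = (a \<odot>\<^bsub>k_dual K opp Q\<^esub> \<Theta> \<phi> x) C"
        using C g val[OF g(1) axX] pair_balanced[OF g(1) ax] by simp
    qed (use ext[OF axX] in simp_all)
  qed
qed

text \<open>By the expansion along a dual basis of \<open>P1\<close>, a functional on \<open>Hom(P1, X)\<close> is determined by its values
  on the maps \<open>g(-) x\<close>.\<close>

private lemma \<Theta>_inj:
  assumes \<phi>: "\<phi> \<in> carrier (annihilator K V1 W)" and \<psi>: "\<psi> \<in> carrier (annihilator K V1 W)"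
    and eq: "\<Theta> \<phi> = \<Theta> \<psi>"
  shows "\<phi> = \<psi>"
proof (rule Homs_eqI[of \<phi> K V1 "regular_module K" \<psi>])
  show \<phi>H: "\<phi> \<in> Homs K V1 (regular_module K)" and \<psi>H: "\<psi> \<in> Homs K V1 (regular_module K)"
    using \<phi> \<psi> by auto
  obtain m b g where db: "dual_basis \<Lambda> P1 m b g" using fg_proj_dual_basis[OF P1] by blast
  fix h assume "h \<in> carrier V1"
  then have h: "h \<in> Homs \<Lambda> P1 X" by simp
  have g: "g i \<in> carrier A1" "h (b i) \<in> carrier X" if "i < m" for i
    using dual_basisD[OF db] that Homs_closed[OF h] by auto
  have pr: "pair (g i) (h (b i)) \<in> carrier V1" if "i < m" for i using pair_closed g that by blast
  have reg: "left_module K (regular_module K)" by (rule left_module_regular[OF ring_K])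
  interpret reg: left_module K "regular_module K" by (rule reg)
  have expand: "\<chi> h = (\<Oplus>\<^bsub>regular_module K\<^esub>i\<in>{..<m}. \<chi> (pair (g i) (h (b i))))"
    if \<chi>: "\<chi> \<in> Homs K V1 (regular_module K)" for \<chi>
    using Homs_finsum[OF V1.left_module reg \<chi>, of "{..<m}" "\<lambda>i. pair (g i) (h (b i))"]
      dual_basis_expansion[OF lP1 X(1) db h] pr by simp
  have "\<phi> (pair (g i) (h (b i))) = \<psi> (pair (g i) (h (b i)))" if "i < m" for i
    using \<Theta>_cls[OF \<phi> g(1)[OF that] g(2)[OF that]] \<Theta>_cls[OF \<psi> g(1)[OF that] g(2)[OF that]] eq by simp
  then have "(\<Oplus>\<^bsub>regular_module K\<^esub>i\<in>{..<m}. \<phi> (pair (g i) (h (b i))))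
    = (\<Oplus>\<^bsub>regular_module K\<^esub>i\<in>{..<m}. \<psi> (pair (g i) (h (b i))))"
    using Homs_closed[OF \<psi>H pr] by (intro reg.M.finsum_cong') auto
  then show "\<phi> h = \<psi> h" using expand[OF \<phi>H] expand[OF \<psi>H] by simp
qed

text \<open>A dual basis \<open>(b\<^sub>i, g\<^sub>i)\<close> of \<open>P1\<close> leaves only the choice \<open>\<phi>(h) = \<Sum>i. F(h(b\<^sub>i))(g\<^sub>i)\<close>; the
  expansion along a dual basis of \<open>P0\<close> shows that this \<open>\<phi>\<close> vanishes on the image of \<open>Hom(P0, X)\<close>.\<close>

private lemma \<Theta>_surj:
  assumes F: "F \<in> Homs \<Lambda> X (k_dual K opp Q)"
  shows "\<exists>\<phi>\<in>carrier (annihilator K V1 W). \<Theta> \<phi> = F"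
proof -
  obtain m b g where db: "dual_basis \<Lambda> P1 m b g" using fg_proj_dual_basis[OF P1] by blast
  obtain m0 b0 g0 where db0: "dual_basis \<Lambda> P0 m0 b0 g0" using fg_proj_dual_basis[OF P0] by blast
  have reg: "left_module K (regular_module K)" by (rule left_module_regular[OF ring_K])
  interpret reg: left_module K "regular_module K" by (rule reg)
  have g: "g i \<in> carrier A1" and b: "b i \<in> carrier P1" if "i < m" for i
    using dual_basisD[OF db] that by auto
  have UQ: "left_module K (underlying_space opp Q)"
  proof (rule left_module_image[OF left_module_hom_space[OF lP1 left_module_regular[OF A.ring_axioms]],
        where T = cls])
    show "cls ` carrier (hom_space \<Lambda> P1 (regular_module \<Lambda>)) = carrier (underlying_space opp Q)"
      using A1.quot_carrier[OF N_sub] by simp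
    show "cls \<zero>\<^bsub>hom_space \<Lambda> P1 (regular_module \<Lambda>)\<^esub> = \<zero>\<^bsub>underlying_space opp Q\<^esub>"
      using A1.quot_zero[OF N_sub] by simp
    show "cls (u \<oplus>\<^bsub>hom_space \<Lambda> P1 (regular_module \<Lambda>)\<^esub> v) = cls u \<oplus>\<^bsub>underlying_space opp Q\<^esub> cls v"
      if "u \<in> carrier (hom_space \<Lambda> P1 (regular_module \<Lambda>))" "v \<in> carrier (hom_space \<Lambda> P1 (regular_module \<Lambda>))" for u v
      using A1.quot_add[OF N_sub, of u v] that by simp
    show "cls (c \<odot>\<^bsub>hom_space \<Lambda> P1 (regular_module \<Lambda>)\<^esub> u) = c \<odot>\<^bsub>underlying_space opp Q\<^esub> cls u"
      if c: "c \<in> carrier K" and u: "u \<in> carrier (hom_space \<Lambda> P1 (regular_module \<Lambda>))" for c u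
    proof -
      have uA: "u \<in> carrier A1" using u by simp
      have "c \<odot>\<^bsub>hom_space \<Lambda> P1 (regular_module \<Lambda>)\<^esub> u = scalar c \<odot>\<^bsub>A1\<^esub> u"
        using A1_closed[OF uA] c by (auto simp: scalar_central intro!: restrict_ext)
      then show ?thesis using underlying_Q_smult[OF c uA] by simp
    qed
  qed
  have Fx: "F x \<in> Homs K (underlying_space opp Q) (regular_module K)" if "x \<in> carrier X" for x
    using Homs_closed[OF F that] by simp
  have Fk: "F x (cls u) \<in> carrier K" if "x \<in> carrier X" "u \<in> carrier A1" for x u
    using Homs_closed[OF Fx[OF that(1)], of "cls u"] cls_Q[OF that(2)] by simp
  have Fadd: "F (x \<oplus>\<^bsub>X\<^esub> y) (cls u) = F x (cls u) \<oplus>\<^bsub>K\<^esub> F y (cls u)"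
    if "x \<in> carrier X" "y \<in> carrier X" "u \<in> carrier A1" for x y u
    using Homs_add[OF F that(1,2)] cls_Q[OF that(3)] by simp
  have Fbal: "F (a \<odot>\<^bsub>X\<^esub> x) (cls u) = F x (cls (a \<odot>\<^bsub>A1\<^esub> u))"
    if "a \<in> carrier \<Lambda>" "x \<in> carrier X" "u \<in> carrier A1" for a x u
    using Homs_smult[OF F that(1,2)] cls_Q[OF that(3)] A1.quot_smult[OF N_sub, of a u] that by simp
  have Fscal: "F (scalar c \<odot>\<^bsub>X\<^esub> x) (cls u) = c \<otimes>\<^bsub>K\<^esub> F x (cls u)"
    if "c \<in> carrier K" "x \<in> carrier X" "u \<in> carrier A1" for c x u
    using Fbal[of "scalar c" x u] underlying_Q_smult[OF that(1,3)] that
      Homs_smult[OF Fx[OF that(2)] that(1), of "cls u"] cls_Q[OF that(3)] by simp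
  define \<phi> where "\<phi> = (\<lambda>h\<in>carrier V1. \<Oplus>\<^bsub>regular_module K\<^esub>i\<in>{..<m}. F (h (b i)) (cls (g i)))"
  have summand: "F (h (b i)) (cls (g i)) \<in> carrier (regular_module K)" if "h \<in> carrier V1" "i < m" for h i
    using Fk[OF _ g[OF that(2)]] Homs_closed[OF _ b[OF that(2)], of h \<Lambda> X] that by simp
  have \<phi>H: "\<phi> \<in> Homs K V1 (regular_module K)"
    unfolding \<phi>_def
  proof (rule Homs_restrictI[OF _ _ _ V1.left_module])
    show "(\<Oplus>\<^bsub>regular_module K\<^esub>i\<in>{..<m}. F (h (b i)) (cls (g i))) \<in> carrier (regular_module K)"
      if "h \<in> carrier V1" for h
      using summand[OF that] by (intro reg.M.finsum_closed) auto
  next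
    fix h k assume hk: "h \<in> carrier V1" "k \<in> carrier V1"
    have "(\<Oplus>\<^bsub>regular_module K\<^esub>i\<in>{..<m}. F ((h \<oplus>\<^bsub>V1\<^esub> k) (b i)) (cls (g i)))
      = (\<Oplus>\<^bsub>regular_module K\<^esub>i\<in>{..<m}. F (h (b i)) (cls (g i)) \<oplus>\<^bsub>regular_module K\<^esub> F (k (b i)) (cls (g i)))"
    proof (rule reg.M.finsum_cong')
      fix i assume "i \<in> {..<m}"
      then have i: "i < m" by simp
      show "F ((h \<oplus>\<^bsub>V1\<^esub> k) (b i)) (cls (g i))
        = F (h (b i)) (cls (g i)) \<oplus>\<^bsub>regular_module K\<^esub> F (k (b i)) (cls (g i))"
        using hk b[OF i] Fadd[OF _ _ g[OF i]] Homs_closed[of h \<Lambda> P1 X] Homs_closed[of k \<Lambda> P1 X] by simp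
    qed (use summand[OF hk(1)] summand[OF hk(2)] in auto)
    also have "\<dots> = (\<Oplus>\<^bsub>regular_module K\<^esub>i\<in>{..<m}. F (h (b i)) (cls (g i))) \<oplus>\<^bsub>regular_module K\<^esub>
        (\<Oplus>\<^bsub>regular_module K\<^esub>i\<in>{..<m}. F (k (b i)) (cls (g i)))"
      using summand[OF hk(1)] summand[OF hk(2)] by (intro reg.M.finsum_addf) auto
    finally show "(\<Oplus>\<^bsub>regular_module K\<^esub>i\<in>{..<m}. F ((h \<oplus>\<^bsub>V1\<^esub> k) (b i)) (cls (g i)))
      = (\<Oplus>\<^bsub>regular_module K\<^esub>i\<in>{..<m}. F (h (b i)) (cls (g i))) \<oplus>\<^bsub>regular_module K\<^esub>
        (\<Oplus>\<^bsub>regular_module K\<^esub>i\<in>{..<m}. F (k (b i)) (cls (g i)))" .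
  next
    fix c h assume ch: "c \<in> carrier K" "h \<in> carrier V1"
    have "(\<Oplus>\<^bsub>regular_module K\<^esub>i\<in>{..<m}. F ((c \<odot>\<^bsub>V1\<^esub> h) (b i)) (cls (g i)))
      = (\<Oplus>\<^bsub>regular_module K\<^esub>i\<in>{..<m}. c \<odot>\<^bsub>regular_module K\<^esub> F (h (b i)) (cls (g i)))"
    proof (rule reg.M.finsum_cong')
      fix i assume "i \<in> {..<m}"
      then have i: "i < m" by simp
      show "F ((c \<odot>\<^bsub>V1\<^esub> h) (b i)) (cls (g i)) = c \<odot>\<^bsub>regular_module K\<^esub> F (h (b i)) (cls (g i))"
        using ch b[OF i] Fscal[OF ch(1) _ g[OF i]] Homs_closed[of h \<Lambda> P1 X] by simp
    qed (use summand[OF ch(2)] ch(1) in auto)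
    also have "\<dots> = c \<odot>\<^bsub>regular_module K\<^esub> (\<Oplus>\<^bsub>regular_module K\<^esub>i\<in>{..<m}. F (h (b i)) (cls (g i)))"
      using summand[OF ch(2)] by (intro reg.finsum_smult[OF ch(1)]) auto
    finally show "(\<Oplus>\<^bsub>regular_module K\<^esub>i\<in>{..<m}. F ((c \<odot>\<^bsub>V1\<^esub> h) (b i)) (cls (g i)))
      = c \<odot>\<^bsub>regular_module K\<^esub> (\<Oplus>\<^bsub>regular_module K\<^esub>i\<in>{..<m}. F (h (b i)) (cls (g i)))" .
  qed
  have \<phi>pair: "\<phi> (pair u x) = F x (cls u)" if u: "u \<in> carrier A1" and x: "x \<in> carrier X" for u x
  proof -
    have ub: "u (b i) \<in> carrier \<Lambda>" if "i < m" for i using A1_closed[OF u b[OF that]] .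
    have gu: "u (b i) \<odot>\<^bsub>A1\<^esub> g i \<in> carrier A1" if "i < m" for i
      using A1.smult_closed[of "u (b i)" "g i"] ub[OF that] g[OF that] by simp
    have "\<phi> (pair u x) = (\<Oplus>\<^bsub>regular_module K\<^esub>i\<in>{..<m}. F (pair u x (b i)) (cls (g i)))"
      using pair_closed[OF u x] by (simp add: \<phi>_def)
    also have "\<dots> = (\<Oplus>\<^bsub>regular_module K\<^esub>i\<in>{..<m}. F x (cls (u (b i) \<odot>\<^bsub>A1\<^esub> g i)))"
    proof (rule reg.M.finsum_cong')
      fix i assume "i \<in> {..<m}"
      then have i: "i < m" by simp
      show "F (pair u x (b i)) (cls (g i)) = F x (cls (u (b i) \<odot>\<^bsub>A1\<^esub> g i))"
        using b[OF i] Fbal[OF ub[OF i] x g[OF i]] by simp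
    qed (use Fk[OF x] gu in \<open>auto simp del: algebra_dual_simps\<close>)
    also have "\<dots> = F x (\<Oplus>\<^bsub>underlying_space opp Q\<^esub>i\<in>{..<m}. cls (u (b i) \<odot>\<^bsub>A1\<^esub> g i))"
      using gu cls_Q by (intro Homs_finsum[OF UQ reg Fx[OF x], symmetric]) (simp del: algebra_dual_simps)
    also have "(\<Oplus>\<^bsub>underlying_space opp Q\<^esub>i\<in>{..<m}. cls (u (b i) \<odot>\<^bsub>A1\<^esub> g i))
      = (\<Oplus>\<^bsub>Q\<^esub>i\<in>{..<m}. cls (u (b i) \<odot>\<^bsub>A1\<^esub> g i))"
      by (simp add: finsum_def finprod_def underlying_space_def)
    also have "\<dots> = (\<Oplus>\<^bsub>Q\<^esub>i\<in>{..<m}. (\<lambda>v\<in>carrier A1. cls v) (u (b i) \<odot>\<^bsub>A1\<^esub> g i))"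
      using gu cls_Q by (intro Q.M.finsum_cong') (auto simp del: algebra_dual_simps)
    also have "\<dots> = (\<lambda>v\<in>carrier A1. cls v) (\<Oplus>\<^bsub>A1\<^esub>i\<in>{..<m}. u (b i) \<odot>\<^bsub>A1\<^esub> g i)"
      using gu by (intro Homs_finsum[OF A1.left_module_axioms Q.left_module_axioms A1.quot_proj_Homs[OF N_sub], symmetric])
        (simp del: algebra_dual_simps)
    also have "(\<Oplus>\<^bsub>A1\<^esub>i\<in>{..<m}. u (b i) \<odot>\<^bsub>A1\<^esub> g i)
      = (\<Oplus>\<^bsub>hom_space \<Lambda> P1 (regular_module \<Lambda>)\<^esub>i\<in>{..<m}. (\<lambda>p\<in>carrier P1. g i p \<odot>\<^bsub>regular_module \<Lambda>\<^esub> u (b i)))"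
      by (simp add: finsum_def finprod_def hom_space_def algebra_dual_def regular_module_def)
    also have "\<dots> = u"
      using dual_basis_expansion[OF lP1 left_module_regular[OF A.ring_axioms] db, of u] u by simp
    finally show ?thesis unfolding restrict_apply'[OF u] .
  qed
  have "\<phi> w = \<zero>\<^bsub>K\<^esub>" if w: "w \<in> W" for w
  proof -
    define T where "T = (\<lambda>h\<in>Homs \<Lambda> P0 X. compose (carrier P1) h f)"
    have TH: "T \<in> Homs K V0 V1" unfolding T_def by (rule T)
    obtain h where h: "h \<in> Homs \<Lambda> P0 X" "w = T h" using w by (auto simp: T_def)
    define s where "s j = (\<lambda>p\<in>carrier P0. g0 j p \<odot>\<^bsub>X\<^esub> h (b0 j))" for j
    have x: "h (b0 j) \<in> carrier X" and g0: "g0 j \<in> carrier (algebra_dual \<Lambda> P0)" if "j < m0" for j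
      using dual_basisD[OF db0] that Homs_closed[OF h(1)] by auto
    have s: "s j \<in> carrier V0" if "j < m0" for j
      using Homs_smult_right[OF lP0 X(1) _ x[OF that], of "g0 j"] g0[OF that] by (simp add: s_def)
    have comp: "compose (carrier P1) (g0 j) f \<in> N" "compose (carrier P1) (g0 j) f \<in> carrier A1" if "j < m0" for j
    proof -
      show "compose (carrier P1) (g0 j) f \<in> N" using g0[OF that] by (rule imageI)
      moreover have "N \<subseteq> carrier A1" using N_sub by (simp only: A1.submodule_iff)
      ultimately show "compose (carrier P1) (g0 j) f \<in> carrier A1" by (rule subsetD[rotated])
    qed
    have "\<phi> (T (s j)) = \<zero>\<^bsub>K\<^esub>" if j: "j < m0" for j
    proof -
      have "T (s j) = pair (compose (carrier P1) (g0 j) f) (h (b0 j))"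
        using s[OF j] pair_precompose[OF g0[OF j] x[OF j]] by (simp add: T_def s_def)
      then have "\<phi> (T (s j)) = F (h (b0 j)) (cls (compose (carrier P1) (g0 j) f))"
        using \<phi>pair[OF comp(2)[OF j] x[OF j]] by simp
      also have "cls (compose (carrier P1) (g0 j) f) = \<zero>\<^bsub>underlying_space opp Q\<^esub>"
        using A1.coset_eq_zero_iff[OF N_sub comp(2)[OF j]] comp(1)[OF j] by simp
      finally show ?thesis using Homs_zero[OF UQ reg Fx[OF x[OF j]]] by simp
    qed
    moreover have "\<phi> w = (\<Oplus>\<^bsub>regular_module K\<^esub>j\<in>{..<m0}. \<phi> (T (s j)))"
    proof -
      have "w = T (\<Oplus>\<^bsub>V0\<^esub>j\<in>{..<m0}. s j)"
        using dual_basis_expansion[OF lP0 X(1) db0 h(1)] h(2) by (simp add: s_def)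
      also have "\<dots> = (\<Oplus>\<^bsub>V1\<^esub>j\<in>{..<m0}. T (s j))"
        using s by (intro Homs_finsum[OF V0.left_module V1.left_module TH]) simp
      finally show ?thesis
        using Homs_finsum[OF V1.left_module reg \<phi>H, of "{..<m0}" "\<lambda>j. T (s j)"] Homs_closed[OF TH s] by simp
    qed
    moreover have "(\<Oplus>\<^bsub>regular_module K\<^esub>j\<in>{..<m0}. \<phi> (T (s j))) = (\<Oplus>\<^bsub>regular_module K\<^esub>j\<in>{..<m0}. \<zero>\<^bsub>regular_module K\<^esub>)"
      using calculation(1) by (intro reg.M.finsum_cong') auto
    ultimately show ?thesis by simp
  qed
  then have \<phi>A: "\<phi> \<in> carrier (annihilator K V1 W)" using \<phi>H by simp
  moreover have "\<Theta> \<phi> = F"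
  proof (rule Homs_eqI[OF \<Theta>_Homs[OF \<phi>A] F])
    fix x assume x: "x \<in> carrier X"
    show "\<Theta> \<phi> x = F x"
    proof (rule extensionalityI[of _ "carrier Q"])
      fix C assume "C \<in> carrier Q"
      then obtain u where u: "u \<in> carrier A1" "C = cls u" using Q_cls by blast
      then show "\<Theta> \<phi> x C = F x C" using \<Theta>_cls[OF \<phi>A u(1) x] \<phi>pair[OF u(1) x] by simp
    next
      show "\<Theta> \<phi> x \<in> extensional (carrier Q)" using x by (simp add: \<Theta>_def)
      show "F x \<in> extensional (carrier Q)" using Homs_extensional[OF Fx[OF x]] by simp
    qed
  qed
  ultimately show ?thesis by blast
qed

text \<open>\<open>\<Theta>\<close> identifies \<open>Hom(X, D Tr Y)\<close> with the annihilator of \<open>W\<close>.\<close>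

lemma hom_dim_dual_cokernel:
  "hom_dim K \<Lambda> X (k_dual K opp Q) + vectorspace.dim K (V1\<lparr>carrier := W\<rparr>) = hom_dim K \<Lambda> P1 X"
proof -
  let ?A = "annihilator K V1 W" and ?H = "hom_space \<Lambda> X (k_dual K opp Q)"
  have ann: "vectorspace K ?A" "vectorspace.fin_dim K ?A"
    "vectorspace.dim K ?A + vectorspace.dim K (V1\<lparr>carrier := W\<rparr>) = V1.dim"
    using V1.annihilator_dim[OF fin_dim_hom_space[OF P1 X] W_sub] by auto
  interpret A': vspace K ?A by (rule vspaceI[OF ann(1)])
  have val: "\<phi> (pair (rep C) x) \<in> carrier K \<and> pair (rep C) x \<in> carrier V1"
    if "\<phi> \<in> carrier ?A" "C \<in> carrier Q" "x \<in> carrier X" for \<phi> C x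
  proof -
    have "pair (rep C) x \<in> carrier V1" using Q_cls[OF that(2)] rep(1) pair_closed that(3) by blast
    then show ?thesis using that(1) Homs_closed[of \<phi> K V1 "regular_module K"] by simp
  qed
  have add: "\<Theta> (\<phi> \<oplus>\<^bsub>?A\<^esub> \<psi>) = \<Theta> \<phi> \<oplus>\<^bsub>?H\<^esub> \<Theta> \<psi>" if "\<phi> \<in> carrier ?A" "\<psi> \<in> carrier ?A" for \<phi> \<psi>
    using val[OF that(1)] val[OF that(2)] by (auto simp: \<Theta>_def intro!: restrict_ext)
  have zero: "\<Theta> \<zero>\<^bsub>?A\<^esub> = \<zero>\<^bsub>?H\<^esub>"
    using val[OF A'.M.zero_closed] by (auto simp: \<Theta>_def intro!: restrict_ext)
  have smult: "\<Theta> (c \<odot>\<^bsub>?A\<^esub> \<phi>) = c \<odot>\<^bsub>?H\<^esub> \<Theta> \<phi>" if c: "c \<in> carrier K" and \<phi>: "\<phi> \<in> carrier ?A" for c \<phi>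
  proof -
    have *: "(c \<odot>\<^bsub>?A\<^esub> \<phi>) (pair (rep C) x) = \<Theta> \<phi> x (scalar c \<odot>\<^bsub>Q\<^esub> C)" if C: "C \<in> carrier Q" and x: "x \<in> carrier X" for C x
    proof -
      have "\<Theta> \<phi> x \<in> Homs K (underlying_space opp Q) (regular_module K)"
        using Homs_closed[OF \<Theta>_Homs[OF \<phi>] x] by simp
      from Homs_smult[OF this c, of C] show ?thesis using val[OF \<phi> C x] C x by (simp add: \<Theta>_def)
    qed
    have "\<Theta> (c \<odot>\<^bsub>?A\<^esub> \<phi>) = (\<lambda>x\<in>carrier X. \<lambda>C\<in>carrier Q. \<Theta> \<phi> x (scalar c \<odot>\<^bsub>Q\<^esub> C))"
      unfolding \<Theta>_def[of "c \<odot>\<^bsub>?A\<^esub> \<phi>"] by (intro restrict_ext *)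
    then show ?thesis by simp
  qed
  have im: "\<Theta> ` carrier ?A = carrier ?H" using \<Theta>_Homs \<Theta>_surj by fastforce
  have "left_module K ?H" by (rule left_module_image[where T = \<Theta>, OF A'.left_module im zero add smult])
  then have H: "vectorspace K ?H" by (simp add: vectorspace_iff field_K)
  have "restrict \<Theta> (carrier ?A) \<in> Homs K ?A ?H"
    using \<Theta>_Homs add smult A'.left_module by (intro Homs_restrictI) (auto simp del: annihilator_simps)
  moreover have "bij_betw (restrict \<Theta> (carrier ?A)) (carrier ?A) (carrier ?H)"
    using im \<Theta>_inj by (auto simp: bij_betw_def inj_on_def simp del: annihilator_simps)
  ultimately have "vectorspace.dim K ?H = A'.dim" using A'.dim_eq_bij[OF H _ _ ann(2)] by blast
  then show ?thesis using ann(3) by (simp add: hom_dim_def)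
qed

end

text \<open>Eliminate the dimension of the image of \<open>Hom(P0, X)\<close> in \<open>Hom(P1, X)\<close> from the formulas for
  \<open>dim Hom(X, D Tr Y)\<close> and \<open>dim Hom(Y, X)\<close>: what remains is \<open>dim Hom(P0, X) - dim Hom(P1, X)\<close>, which the
  g-vector computes.\<close>

lemma E_prime_formula:
  assumes ac: "algebraically_closed K" and reps: "indec_proj_reps \<Lambda> n P"
    and X: "left_module \<Lambda> X" "fin_gen \<Lambda> X" and Y: "left_module \<Lambda> Y" "fin_gen \<Lambda> Y"
  shows "int (E_prime K \<Lambda> X Y)
    = int (hom_dim K \<Lambda> Y X) - vec_dot n (g_vector \<Lambda> n P Y) (dim_vector \<Lambda> P X)"
proof -
  obtain P1 P0 f p where pres: "the_min_pres \<Lambda> Y = (P1, P0, f)" and min: "min_proj_pres \<Lambda> Y P1 P0 f p"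
    using the_min_presE[OF Y] by blast
  have P: "P1 \<in> fg_proj \<Lambda>" "P0 \<in> fg_proj \<Lambda>" and f: "f \<in> Homs \<Lambda> P1 P0" and p: "p \<in> Homs \<Lambda> P0 Y"
    "p ` carrier P0 = carrier Y" and exact: "f ` carrier P1 = a_kernel P0 Y p"
    using min by (auto simp: min_proj_pres_def)
  have "E_prime K \<Lambda> X Y = hom_dim K \<Lambda> X (k_dual K (opp_algebra \<Lambda>)
      (quot_module (algebra_dual \<Lambda> P1) ((\<lambda>g. compose (carrier P1) g f) ` carrier (algebra_dual \<Lambda> P0))))"
    by (simp add: E_prime_def ar_translate_def transpose_module_def pres)
  then show ?thesis
    using hom_dim_dual_cokernel[OF X P(2,1) f] hom_dim_presentation[OF Y(1) X P(2) fg_projD(1)[OF P(1)] f p exact]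
      hom_dim_g_vector[OF ac reps pres P X] by linarith
qed

end

theorem proposition5p3:
  fixes K :: "'k ring" and \<Lambda> :: "('k, 'a) module"
    and X :: "('a, 'x) module" and Y :: "('a, 'y) module"
    and n :: nat and P :: "nat \<Rightarrow> 'a fg_univ"
  assumes "algebraically_closed K"
    and "fd_algebra K \<Lambda>"
    and "indec_proj_reps \<Lambda> n P"
    and "left_module \<Lambda> X" and "fin_gen \<Lambda> X"
    and "left_module \<Lambda> Y" and "fin_gen \<Lambda> Y"
  shows "int (E_prime K \<Lambda> X Y)
           = int (hom_dim K \<Lambda> Y X) - vec_dot n (g_vector \<Lambda> n P Y) (dim_vector \<Lambda> P X)
       \<and> int (E_sym K \<Lambda> X Y)
           = int (hom_dim K \<Lambda> Y X) + int (hom_dim K \<Lambda> X Y)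
             - vec_dot n (g_vector \<Lambda> n P Y) (dim_vector \<Lambda> P X)
             - vec_dot n (g_vector \<Lambda> n P X) (dim_vector \<Lambda> P Y)
       \<and> int (E_self K \<Lambda> X)
           = 2 * (int (hom_dim K \<Lambda> X X) - vec_dot n (g_vector \<Lambda> n P X) (dim_vector \<Lambda> P X))"
proof -
  interpret fd_algebra K \<Lambda> by (rule assms(2))
  note formula = E_prime_formula[OF assms(1,3)]
  show ?thesis
    using formula[OF assms(4-7)] formula[OF assms(6,7,4,5)] formula[OF assms(4,5,4,5)]
    by (simp add: E_sym_def E_self_def)
qed

end
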